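(* Let $\lambda_0\in\mathbb{R}$ and $t_0\in(0,1)$, and assume: (i) $\lambda_0\notin\operatorname{Spec}_{\mathrm{ess}}(\mathcal{N}_{t_0}+V_{t_0})$; (ii) $\dim\ker(\mathcal{N}_{t_0}+V_{t_0}-\lambda_0)=1$, with eigenfunction $\mathbf{u}_{t_0}$; and that there is an interval $\mathcal{I}\subset[0,1]$ containing $t_0$ in its interior such that (iii) the mappings $t\mapsto V_t$, $t\mapsto P_t$, $t\mapsto Q_t$, $t\mapsto\mathrm{T}_t$ are $C^2$ on $\mathcal{I}$; (iv) $\ker\big((N^*+V_t^*-\lambda)\tau\big)\cap\operatorname{dom}(\tau N)=\{0\}$ for all $t\in\mathcal{I}$ and all real $\lambda$ near $\lambda_0$. Let $\mathbf{q}=(\mathrm{T}_{t_0}\mathbf{u}_{t_0},\mathrm{T}_{t_0}\mathbf{u}_{t_0})^\top$, and let $\mathfrak{m}_{t_0}$, $\mathfrak{m}_{\lambda_0}$ be the $t$- and $\lambda$-crossing forms at $(\lambda_0,t_0)$ defined in the context. 1. If $\mathfrak{m}_{\lambda_0}(\mathbf{q},\mathbf{q})\ne0$, then there is a $C^1$ curve $\lambda=\lambda(t)$ near $t_0$, with $\lambda(t_0)=\lambda_0$, such that $$\lambda(t)\in\operatorname{Spec}(\mathcal{N}_t+V_t),\qquad \lambda'(t_0)=-\frac{\mathfrak{m}_{t_0}(\mathbf{q},\mathbf{q})}{\mathfrak{m}_{\lambda_0}(\mathbf{q},\mathbf{q})}.$$ 2. If $\mathfrak{m}_{t_0}(\mathbf{q},\mathbf{q})\ne0$,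 then there is a $C^1$ curve $t=t(\lambda)$ near $\lambda_0$, with $t(\lambda_0)=t_0$, such that $$\lambda\in\operatorname{Spec}(\mathcal{N}_{t(\lambda)}+V_{t(\lambda)}),\qquad t'(\lambda_0)=-\frac{\mathfrak{m}_{\lambda_0}(\mathbf{q},\mathbf{q})}{\mathfrak{m}_{t_0}(\mathbf{q},\mathbf{q})}.$$
   Context: $\mathcal{H},\mathfrak{H}$ are separable complex Hilbert spaces. $A$ is a closed, densely defined, symmetric linear operator in $\mathcal{H}$ with $\dim\ker(A^*+i)=\dim\ker(A^*-i)<\infty$. $\mathcal{H}_+:=\operatorname{dom}(A^* )$ carries the graph scalar product of $A^*$. Put $\mathcal{H}^2=\mathcal{H}\times\mathcal{H}$, $\mathcal{H}_+^2=\mathcal{H}_+\times\mathcal{H}_+$, $\mathfrak{H}^2=\mathfrak{H}\times\mathfrak{H}$, $\mathfrak{H}^4=\mathfrak{H}^2\times\mathfrak{H}^2$, and $$N=\begin{pmatrix}0&-A\\ A&0\end{pmatrix},\ \operatorname{dom}N=\operatorname{dom}A\times\operatorname{dom}A,\qquad N^*=\begin{pmatrix}0&A^*\\ -A^*&0\end{pmatrix},\ \operatorname{dom}N^*=\mathcal{H}_+^2,\qquad \tau=\begin{pmatrix}0&I_{\mathcal{H}}\\ I_{\mathcal{H}}&0\end{pmatrix},$$ $$J=\begin{pmatrix}0&I_{\mathfrak{H}}\\ -I_{\mathfrak{H}}&0\end{pmatrix}\ \text{on }\mathfrak{H}^2,\qquad \mathcal{J}=J\oplus(-J)\ \text{on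 }\mathfrak{H}^4,\qquad \Omega(f,g)=\langle\mathcal{J}f,g\rangle_{\mathfrak{H}^4},\qquad \tilde\Omega=\Omega\oplus(-\Omega)\ \text{on }\mathfrak{H}^4\oplus\mathfrak{H}^4.$$ A subspace of $\mathfrak{H}^2$ is Lagrangian if it equals its annihilator with respect to $\omega(f,g)=\langle Jf,g\rangle_{\mathfrak{H}^2}$. Standing assumptions on one-parameter families, $t\in[0,1]$: (a) $\operatorname{tr}_t=(\Gamma_{0,t},\Gamma_{1,t})^\top\in\mathcal{B}(\mathcal{H}_+,\mathfrak{H}^2)$ is surjective and satisfies $\langle A^*u,v\rangle_{\mathcal{H}}-\langle u,A^*v\rangle_{\mathcal{H}}=\langle\Gamma_{1,t}u,\Gamma_{0,t}v\rangle_{\mathfrak{H}}-\langle\Gamma_{0,t}u,\Gamma_{1,t}v\rangle_{\mathfrak{H}}$ for all $u,v\in\mathcal{H}_+$; $\mathrm{T}_t:=\operatorname{tr}_t\oplus\operatorname{tr}_t\in\mathcal{B}(\mathcal{H}_+^2,\mathfrak{H}^4)$. (b) $P_t,Q_t\in\mathcal{B}(\mathfrak{H}^2)$ are orthogonal projections with Lagrangian ranges. (c) $\mathcal{A}_t,\mathcal{B}_t$ are self-adjoint extensions of $A$ with $\operatorname{tr}_t(\operatorname{dom}\mathcal{A}_t)=\operatorname{ran}P_t$, $\operatorname{tr}_t(\operatorname{dom}\mathcal{B}_t)=\operatorname{ran}Q_t$, and $\mathcal{N}_t=\begin{pmatrix}0&-\mathcal{B}_t\\ \mathcal{A}_t&0\end{pmatrix}$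 with $\operatorname{dom}\mathcal{N}_t=\operatorname{dom}\mathcal{A}_t\times\operatorname{dom}\mathcal{B}_t$. (d) $F_t,G_t\in\mathcal{B}(\mathcal{H})$ are self-adjoint and $V_t=\begin{pmatrix}0&-G_t\\ F_t&0\end{pmatrix}\in\mathcal{B}(\mathcal{H}^2)$. Regularity of $V_t,\mathrm{T}_t,P_t,Q_t$ is in operator norm (with $\mathrm{T}_t\in\mathcal{B}(\mathcal{H}_+^2,\mathfrak{H}^4)$). $\operatorname{Spec}_{\mathrm{ess}}(\mathcal{N}_t+V_t)$ is the set of $\lambda$ for which $\mathcal{N}_t+V_t-\lambda$ is not Fredholm. Crossing forms. For $\lambda\in\mathbb{R}$, $t\in[0,1]$ let $$\mathbb{K}_{\lambda,t}=\mathrm{T}_t\big(\ker((N^*+V_t^*-\lambda)\tau)\big),\quad \mathcal{F}_t=\operatorname{ran}P_t\times\operatorname{ran}Q_t,\quad \Upsilon_{\lambda,t}=\mathbb{K}_{\lambda,t}\oplus\mathcal{F}_t\subset\mathfrak{H}^4\oplus\mathfrak{H}^4,\quad \mathfrak{D}=\{(q,q)^\top:q\in\mathfrak{H}^4\}.$$ For $t$ near $t_0$, $\Upsilon_{\lambda_0,t}$ is the graph $\{\mathbf{q}+\mathscr{M}_{\lambda_0,t}\mathbf{q}:\mathbf{q}\in\Upsilon_{\lambda_0,t_0}\}$ of an operator $\mathscr{M}_{\lambda_0,t}:\Upsilon_{\lambda_0,t_0}\to(\Upsilon_{\lambda_0,t_0})^\perp$, $C^1$ in $t$, vanishing at $t=t_0$;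 similarly, for $\lambda$ near $\lambda_0$, $\Upsilon_{\lambda,t_0}$ is the graph over $\Upsilon_{\lambda_0,t_0}$ of an operator $\mathscr{M}_{\lambda,t_0}:\Upsilon_{\lambda_0,t_0}\to(\Upsilon_{\lambda_0,t_0})^\perp$ vanishing at $\lambda=\lambda_0$. For $\mathbf{q},\mathbf{p}\in\Upsilon_{\lambda_0,t_0}\cap\mathfrak{D}$ the crossing forms are $$\mathfrak{m}_{t_0}(\mathbf{q},\mathbf{p})=\frac{d}{dt}\Big|_{t=t_0}\tilde\Omega(\mathbf{q},\mathscr{M}_{\lambda_0,t}\mathbf{p}),\qquad \mathfrak{m}_{\lambda_0}(\mathbf{q},\mathbf{p})=\frac{d}{d\lambda}\Big|_{\lambda=\lambda_0}\tilde\Omega(\mathbf{q},\mathscr{M}_{\lambda,t_0}\mathbf{p}).$$ *)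

theory Defs
  imports "HOL-Analysis.Analysis"
begin

section \<open>Complex Hilbert spaces\<close>

text \<open>The inner product \<^term>\<open>cinner\<close> is linear in its first argument. Its real part is the
  real inner product of the library, so norm, topology and completeness are those of the library.\<close>

class chilbert_space = real_inner + complete_space +
  fixes scaleC :: "complex \<Rightarrow> 'a \<Rightarrow> 'a"  (infixr \<open>*\<^sub>C\<close> 75)
    and cinner :: "'a \<Rightarrow> 'a \<Rightarrow> complex"
  assumes scaleC_add_right: "a *\<^sub>C (x + y) = a *\<^sub>C x + a *\<^sub>C y"
    and scaleC_add_left: "(a + b) *\<^sub>C x = a *\<^sub>C x + b *\<^sub>C x"
    and scaleC_scaleC: "a *\<^sub>C (b *\<^sub>C x) = (a * b) *\<^sub>C x"
    and scaleC_of_real: "complex_of_real r *\<^sub>C x = r *\<^sub>R x"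
    and cinner_commute: "cinner x y = cnj (cinner y x)"
    and cinner_add_left: "cinner (x + y) z = cinner x z + cinner y z"
    and cinner_scaleC_left: "cinner (a *\<^sub>C x) y = a * cinner x y"
    and inner_eq_Re_cinner: "inner x y = Re (cinner x y)"
begin

subclass banach ..

end

lemma scaleC_one [simp]: "1 *\<^sub>C x = (x :: 'a::chilbert_space)"
  using scaleC_of_real[of 1 x] by simp

global_interpretation complex_vector: vector_space "scaleC :: complex \<Rightarrow> 'a \<Rightarrow> 'a::chilbert_space"
  defines csubspace = complex_vector.subspace
    and cspan = complex_vector.span
    and cdim = complex_vector.dim
  by unfold_locales (auto simp: scaleC_add_right scaleC_add_left scaleC_scaleC)

lemma cinner_zero_left [simp]: "cinner 0 (x :: 'a::chilbert_space) = 0"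
  using cinner_add_left[of 0 0 x] by simp

lemma cinner_zero_right [simp]: "cinner (x :: 'a::chilbert_space) 0 = 0"
  by (subst cinner_commute) simp

lemma cinner_minus_left: "cinner (- x) (y :: 'a::chilbert_space) = - cinner x y"
  using cinner_add_left[of "- x" x y] by (simp add: eq_neg_iff_add_eq_0)

lemma cinner_minus_right: "cinner x (- y :: 'a::chilbert_space) = - cinner x y"
  by (metis cinner_commute cinner_minus_left complex_cnj_minus)

instantiation prod :: (chilbert_space, chilbert_space) chilbert_space
begin

definition scaleC_prod_def: "a *\<^sub>C z = (a *\<^sub>C fst z, a *\<^sub>C snd z)"

definition cinner_prod_def: "cinner z w = cinner (fst z) (fst w) + cinner (snd z) (snd w)"

instance
proof
  fix x y z :: "'a \<times> 'b" and a b :: complex and r :: real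
  show "a *\<^sub>C (x + y) = a *\<^sub>C x + a *\<^sub>C y"
    and "(a + b) *\<^sub>C x = a *\<^sub>C x + b *\<^sub>C x"
    and "a *\<^sub>C b *\<^sub>C x = (a * b) *\<^sub>C x"
    by (simp_all add: scaleC_prod_def scaleC_add_right scaleC_add_left scaleC_scaleC)
  show "complex_of_real r *\<^sub>C x = r *\<^sub>R x"
    by (simp add: scaleC_prod_def scaleC_of_real scaleR_prod_def)
  show "cinner x y = cnj (cinner y x)"
    unfolding cinner_prod_def complex_cnj_add by (metis cinner_commute)
  show "cinner (x + y) z = cinner x z + cinner y z"
    by (simp add: cinner_prod_def cinner_add_left)
  show "cinner (a *\<^sub>C x) y = a * cinner x y"
    by (simp add: cinner_prod_def scaleC_prod_def cinner_scaleC_left algebra_simps)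
  show "inner x y = Re (cinner x y)"
    by (simp add: cinner_prod_def inner_prod_def inner_eq_Re_cinner)
qed

end

instantiation complex :: chilbert_space
begin

definition scaleC_complex_def: "a *\<^sub>C (z :: complex) = a * z"

definition cinner_complex_def: "cinner z w = z * cnj w"

instance
  by standard
    (simp_all add: scaleC_complex_def cinner_complex_def inner_complex_def algebra_simps scaleR_conv_of_real)

end

definition finite_cdim :: "'a::chilbert_space set \<Rightarrow> bool" where
  "finite_cdim S \<longleftrightarrow> (\<exists>E. finite E \<and> S \<subseteq> cspan E)"

definition corth :: "'a::chilbert_space set \<Rightarrow> 'a set" where
  "corth S = {x. \<forall>y\<in>S. cinner x y = 0}"

definition clinear_on :: "'a::chilbert_space set \<Rightarrow> ('a \<Rightarrow> 'b::chilbert_space) \<Rightarrow> bool" where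
  "clinear_on D f \<longleftrightarrow> (\<forall>x\<in>D. \<forall>y\<in>D. f (x + y) = f x + f y) \<and> (\<forall>a. \<forall>x\<in>D. f (a *\<^sub>C x) = a *\<^sub>C f x)"

text \<open>Elements of \<open>\<B>(H)\<close> are the complex linear elements of the library type of bounded real
  linear maps, whose norm is the operator norm.\<close>

definition selfadjoint_bounded :: "('a::chilbert_space \<Rightarrow>\<^sub>L 'a) \<Rightarrow> bool" where
  "selfadjoint_bounded T \<longleftrightarrow> clinear_on UNIV (blinfun_apply T) \<and> (\<forall>x y. cinner (T x) y = cinner x (T y))"

definition orthogonal_projection :: "('a::chilbert_space \<Rightarrow>\<^sub>L 'a) \<Rightarrow> bool" where
  "orthogonal_projection T \<longleftrightarrow> selfadjoint_bounded T \<and> (\<forall>x. T (T x) = T x)"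


section \<open>Unbounded operators\<close>

text \<open>A possibly unbounded operator is identified with its graph. Thus \<^term>\<open>Domain T\<close> and
  \<^term>\<open>Range T\<close> are its domain and range, \<open>S \<subseteq> T\<close> means that \<open>T\<close> extends \<open>S\<close>, and the product
  of operators ``first \<open>S\<close>, then \<open>T\<close>'' is \<^term>\<open>S O T\<close>.\<close>

definition linear_op :: "('a::chilbert_space \<times> 'b::chilbert_space) set \<Rightarrow> bool" where
  "linear_op T \<longleftrightarrow> csubspace T \<and> single_valued T"

definition densely_defined :: "('a::chilbert_space \<times> 'b::chilbert_space) set \<Rightarrow> bool" where
  "densely_defined T \<longleftrightarrow> closure (Domain T) = UNIV"

definition symmetric_op :: "('a::chilbert_space \<times> 'a) set \<Rightarrow> bool" where
  "symmetric_op T \<longleftrightarrow> (\<forall>(u, u')\<in>T. \<forall>(v, v')\<in>T. cinner u' v = cinner u v')"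

definition op_adj :: "('a::chilbert_space \<times> 'b::chilbert_space) set \<Rightarrow> ('b \<times> 'a) set" where
  "op_adj T = {(v, w). \<forall>(u, u')\<in>T. cinner u' v = cinner u w}"

definition selfadjoint_op :: "('a::chilbert_space \<times> 'a) set \<Rightarrow> bool" where
  "selfadjoint_op T \<longleftrightarrow> linear_op T \<and> densely_defined T \<and> op_adj T = T"

definition op_ker :: "('a::chilbert_space \<times> 'b::chilbert_space) set \<Rightarrow> 'a set" where
  "op_ker T = {u. (u, 0) \<in> T}"

definition op_of :: "('a \<Rightarrow> 'b) \<Rightarrow> ('a \<times> 'b) set" where
  "op_of f = {(x, f x) | x. True}"

definition op_plus :: "('a \<times> 'b::chilbert_space) set \<Rightarrow> ('a \<times> 'b) set \<Rightarrow> ('a \<times> 'b) set" where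
  "op_plus S T = {(x, y + z) | x y z. (x, y) \<in> S \<and> (x, z) \<in> T}"

definition op_shift :: "('a::chilbert_space \<times> 'a) set \<Rightarrow> complex \<Rightarrow> ('a \<times> 'a) set" where
  "op_shift T z = op_plus T (op_of (\<lambda>x. - (z *\<^sub>C x)))"

definition op_app :: "('a \<times> 'b) set \<Rightarrow> 'a \<Rightarrow> 'b" where
  "op_app T u = (THE w. (u, w) \<in> T)"

definition resolvent_set :: "('a::chilbert_space \<times> 'a) set \<Rightarrow> complex set" where
  "resolvent_set T = {z. \<exists>R :: 'a \<Rightarrow>\<^sub>L 'a. clinear_on UNIV (blinfun_apply R) \<and>
     (op_shift T z)\<inverse> = op_of (blinfun_apply R)}"

definition Spec :: "('a::chilbert_space \<times> 'a) set \<Rightarrow> complex set" where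
  "Spec T = - resolvent_set T"

definition fredholm_op :: "('a::chilbert_space \<times> 'b::chilbert_space) set \<Rightarrow> bool" where
  "fredholm_op T \<longleftrightarrow> linear_op T \<and> closed T \<and> finite_cdim (op_ker T) \<and> closed (Range T) \<and>
     (\<exists>E. finite E \<and> (\<forall>y. \<exists>x\<in>Range T. y - x \<in> cspan E))"

definition Spec_ess :: "('a::chilbert_space \<times> 'a) set \<Rightarrow> complex set" where
  "Spec_ess T = {z. \<not> fredholm_op (op_shift T z)}"

text \<open>The off-diagonal block operator with rows \<open>(0, -B)\<close> and \<open>(A, 0)\<close>.\<close>

definition block_op ::
    "('a::chilbert_space \<times> 'a) set \<Rightarrow> ('a \<times> 'a) set \<Rightarrow> (('a \<times> 'a) \<times> ('a \<times> 'a)) set" where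
  "block_op B A = {((u, v), (- v', u')) | u u' v v'. (u, u') \<in> A \<and> (v, v') \<in> B}"

lift_definition block_blinfun ::
    "('a::chilbert_space \<Rightarrow>\<^sub>L 'a) \<Rightarrow> ('a \<Rightarrow>\<^sub>L 'a) \<Rightarrow> ('a \<times> 'a) \<Rightarrow>\<^sub>L ('a \<times> 'a)"
  is "\<lambda>G F w. (- G (snd w), F (fst w))"
  by (intro bounded_linear_Pair bounded_linear_minus
      bounded_linear_compose[OF _ bounded_linear_fst] bounded_linear_compose[OF _ bounded_linear_snd])

lemma op_of_block_blinfun: "op_of (block_blinfun G F) = block_op (op_of G) (op_of F)"
  by (auto simp: op_of_def block_op_def block_blinfun.rep_eq)

lemma op_adj_block_op:
  assumes "(0, 0) \<in> A"
  shows "op_adj (block_op A A) = {((u, v), (v', - u')) | u u' v v'. (u, u') \<in> op_adj A \<and> (v, v') \<in> op_adj A}"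
proof (intro set_eqI iffI)
  fix z assume "z \<in> op_adj (block_op A A)"
  moreover obtain u v p q where z: "z = ((u, v), (p, q))" by (metis surj_pair)
  ultimately have *: "cinner (- b') u + cinner a' v = cinner a p + cinner b q"
    if "(a, a') \<in> A" "(b, b') \<in> A" for a a' b b'
    using that by (fastforce simp: op_adj_def block_op_def cinner_prod_def)
  have "(v, p) \<in> op_adj A"
    using *[OF _ assms] by (auto simp: op_adj_def)
  moreover have "(u, - q) \<in> op_adj A"
    using *[OF assms] by (auto simp: op_adj_def cinner_minus_left cinner_minus_right minus_equation_iff)
  ultimately show "z \<in> {((u, v), (v', - u')) | u u' v v'. (u, u') \<in> op_adj A \<and> (v, v') \<in> op_adj A}"
    unfolding z by (intro CollectI exI[of _ u] exI[of _ "- q"] exI[of _ v] exI[of _ p]) simp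
next
  fix z assume "z \<in> {((u, v), (v', - u')) | u u' v v'. (u, u') \<in> op_adj A \<and> (v, v') \<in> op_adj A}"
  then obtain u u' v v' where z: "z = ((u, v), (v', - u'))"
    and "(u, u') \<in> op_adj A" "(v, v') \<in> op_adj A" by auto
  then have "cinner a' u = cinner a u'" "cinner a' v = cinner a v'" if "(a, a') \<in> A" for a a'
    using that by (auto simp: op_adj_def)
  then show "z \<in> op_adj (block_op A A)"
    by (auto simp: z op_adj_def block_op_def cinner_prod_def cinner_minus_left cinner_minus_right)
qed


section \<open>Bounded operators on a subspace carrying its own norm\<close>

text \<open>For \<open>S = A\<^sup>*\<close> the space \<open>\<H>\<^sub>+\<close> is \<^term>\<open>Domain S\<close> with norm \<^term>\<open>graph_norm S\<close>, and
  \<open>\<H>\<^sub>+\<^sup>2\<close> is \<^term>\<open>Domain S \<times> Domain S\<close> with norm \<^term>\<open>graph_norm2 S\<close>.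
  Below, \<open>D\<close> is a subspace and \<open>\<nu>\<close> a norm on it; values of maps outside \<open>D\<close> are irrelevant.\<close>

definition graph_norm :: "('a::chilbert_space \<times> 'b::chilbert_space) set \<Rightarrow> 'a \<Rightarrow> real" where
  "graph_norm S u = norm (u, op_app S u)"

definition graph_norm2 :: "('a::chilbert_space \<times> 'b::chilbert_space) set \<Rightarrow> 'a \<times> 'a \<Rightarrow> real" where
  "graph_norm2 S w = norm (graph_norm S (fst w), graph_norm S (snd w))"

definition bounded_clinear_on ::
    "'a::chilbert_space set \<Rightarrow> ('a \<Rightarrow> real) \<Rightarrow> ('a \<Rightarrow> 'b::chilbert_space) \<Rightarrow> bool" where
  "bounded_clinear_on D \<nu> f \<longleftrightarrow> clinear_on D f \<and> (\<exists>K. \<forall>x\<in>D. norm (f x) \<le> K * \<nu> x)"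

definition onorm_on :: "'a::chilbert_space set \<Rightarrow> ('a \<Rightarrow> real) \<Rightarrow> ('a \<Rightarrow> 'b::chilbert_space) \<Rightarrow> real" where
  "onorm_on D \<nu> f = (SUP x\<in>D. norm (f x) / \<nu> x)"

text \<open>Class \<open>C\<^sup>2\<close> on an interval \<open>I\<close>, with one-sided derivatives at end points. \<^term>\<open>C2_onorm_on\<close> is
  the version in the operator norm \<^term>\<open>onorm_on D \<nu>\<close>. That norm is meaningful only for bounded
  maps, hence the boundedness requirements there.\<close>

definition C2_on :: "real set \<Rightarrow> (real \<Rightarrow> 'a::real_normed_vector) \<Rightarrow> bool" where
  "C2_on I f \<longleftrightarrow> (\<exists>f1 f2.
     (\<forall>t\<in>I. (f has_vector_derivative f1 t) (at t within I)) \<and>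
     (\<forall>t\<in>I. (f1 has_vector_derivative f2 t) (at t within I)) \<and>
     continuous_on I f2)"

definition has_onorm_derivative_on ::
    "'a::chilbert_space set \<Rightarrow> ('a \<Rightarrow> real) \<Rightarrow> real set \<Rightarrow>
     (real \<Rightarrow> 'a \<Rightarrow> 'b::chilbert_space) \<Rightarrow> (real \<Rightarrow> 'a \<Rightarrow> 'b) \<Rightarrow> bool" where
  "has_onorm_derivative_on D \<nu> I T T' \<longleftrightarrow> (\<forall>t\<in>I.
     ((\<lambda>s. onorm_on D \<nu> (\<lambda>x. (T s x - T t x) /\<^sub>R (s - t) - T' t x)) \<longlongrightarrow> 0) (at t within I))"

definition C2_onorm_on ::
    "'a::chilbert_space set \<Rightarrow> ('a \<Rightarrow> real) \<Rightarrow> real set \<Rightarrow> (real \<Rightarrow> 'a \<Rightarrow> 'b::chilbert_space) \<Rightarrow> bool" where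
  "C2_onorm_on D \<nu> I T \<longleftrightarrow> (\<exists>T1 T2.
     (\<forall>t\<in>I. bounded_clinear_on D \<nu> (T t) \<and> bounded_clinear_on D \<nu> (T1 t) \<and> bounded_clinear_on D \<nu> (T2 t)) \<and>
     has_onorm_derivative_on D \<nu> I T T1 \<and>
     has_onorm_derivative_on D \<nu> I T1 T2 \<and>
     (\<forall>t\<in>I. ((\<lambda>s. onorm_on D \<nu> (\<lambda>x. T2 s x - T2 t x)) \<longlongrightarrow> 0) (at t within I)))"


section \<open>Symplectic forms\<close>

definition Jmat :: "'k::chilbert_space \<times> 'k \<Rightarrow> 'k \<times> 'k" where
  "Jmat f = (snd f, - fst f)"

definition omega :: "'k::chilbert_space \<times> 'k \<Rightarrow> 'k \<times> 'k \<Rightarrow> complex" where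
  "omega f g = cinner (Jmat f) g"

definition lagrangian :: "('k::chilbert_space \<times> 'k) set \<Rightarrow> bool" where
  "lagrangian L \<longleftrightarrow> L = {f. \<forall>g\<in>L. omega f g = 0}"

type_synonym 'k pow4 = "('k \<times> 'k) \<times> ('k \<times> 'k)"

definition calJ :: "'k::chilbert_space pow4 \<Rightarrow> 'k pow4" where
  "calJ f = (Jmat (fst f), - Jmat (snd f))"

definition Omega :: "'k::chilbert_space pow4 \<Rightarrow> 'k pow4 \<Rightarrow> complex" where
  "Omega f g = cinner (calJ f) g"

definition Omega_tilde :: "'k::chilbert_space pow4 \<times> 'k pow4 \<Rightarrow> 'k pow4 \<times> 'k pow4 \<Rightarrow> complex" where
  "Omega_tilde p q = Omega (fst p) (fst q) - Omega (snd p) (snd q)"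


section \<open>Boundary traces and crossing forms\<close>

definition trace_map :: "('h \<Rightarrow> 'k) \<Rightarrow> ('h \<Rightarrow> 'k) \<Rightarrow> 'h \<Rightarrow> 'k \<times> 'k" where
  "trace_map \<Gamma>0 \<Gamma>1 u = (\<Gamma>0 u, \<Gamma>1 u)"

definition Trace_map :: "('h \<Rightarrow> 'k) \<Rightarrow> ('h \<Rightarrow> 'k) \<Rightarrow> 'h \<times> 'h \<Rightarrow> 'k pow4" where
  "Trace_map \<Gamma>0 \<Gamma>1 w = (trace_map \<Gamma>0 \<Gamma>1 (fst w), trace_map \<Gamma>0 \<Gamma>1 (snd w))"

definition green_identity ::
    "('h::chilbert_space \<times> 'h) set \<Rightarrow> ('h \<Rightarrow> 'k::chilbert_space) \<Rightarrow> ('h \<Rightarrow> 'k) \<Rightarrow> bool" where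
  "green_identity S \<Gamma>0 \<Gamma>1 \<longleftrightarrow> (\<forall>(u, u')\<in>S. \<forall>(v, v')\<in>S.
     cinner u' v - cinner u v' = cinner (\<Gamma>1 u) (\<Gamma>0 v) - cinner (\<Gamma>0 u) (\<Gamma>1 v))"

definition boundary_op ::
    "('h::chilbert_space \<times> 'h) set \<Rightarrow> ('h \<Rightarrow>\<^sub>L 'h) \<Rightarrow> ('h \<Rightarrow>\<^sub>L 'h) \<Rightarrow> real \<Rightarrow> (('h \<times> 'h) \<times> ('h \<times> 'h)) set" where
  \<comment> \<open>\<open>(N\<^sup>* + V\<^sup>* - l) \<tau>\<close>\<close>
  "boundary_op A F G l = op_of prod.swap O
     op_shift (op_plus (op_adj (block_op A A)) (op_adj (op_of (block_blinfun G F)))) (complex_of_real l)"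

definition perturbed_op ::
    "('h::chilbert_space \<times> 'h) set \<Rightarrow> ('h \<times> 'h) set \<Rightarrow> ('h \<Rightarrow>\<^sub>L 'h) \<Rightarrow> ('h \<Rightarrow>\<^sub>L 'h) \<Rightarrow> (('h \<times> 'h) \<times> ('h \<times> 'h)) set" where
  \<comment> \<open>\<open>\<N> + V\<close>\<close>
  "perturbed_op \<A> \<B> F G = op_plus (block_op \<B> \<A>) (op_of (block_blinfun G F))"

definition Upsilon ::
    "('h::chilbert_space \<times> 'h) set \<Rightarrow> (real \<Rightarrow> 'h \<Rightarrow> 'k::chilbert_space) \<Rightarrow> (real \<Rightarrow> 'h \<Rightarrow> 'k) \<Rightarrow>
     (real \<Rightarrow> ('k \<times> 'k) \<Rightarrow>\<^sub>L ('k \<times> 'k)) \<Rightarrow> (real \<Rightarrow> ('k \<times> 'k) \<Rightarrow>\<^sub>L ('k \<times> 'k)) \<Rightarrow>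
     (real \<Rightarrow> 'h \<Rightarrow>\<^sub>L 'h) \<Rightarrow> (real \<Rightarrow> 'h \<Rightarrow>\<^sub>L 'h) \<Rightarrow> real \<Rightarrow> real \<Rightarrow> ('k pow4 \<times> 'k pow4) set" where
  "Upsilon A \<Gamma>0 \<Gamma>1 P Q F G l t =
     (Trace_map (\<Gamma>0 t) (\<Gamma>1 t) ` op_ker (boundary_op A (F t) (G t) l))
     \<times> (range (P t) \<times> range (Q t))"

text \<open>If a subspace \<open>Y\<close> is the graph over \<open>Y0\<close> of an operator \<open>M : Y0 \<rightarrow> corth Y0\<close>, then \<open>M\<close> is
  uniquely determined and given by the following formula.\<close>

definition graph_map :: "'a::chilbert_space set \<Rightarrow> 'a set \<Rightarrow> 'a \<Rightarrow> 'a" where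
  "graph_map Y0 Y q = (THE r. r \<in> corth Y0 \<and> q + r \<in> Y)"

lemma graph_map_eq:
  assumes Y0: "csubspace Y0" and M: "\<And>q. q \<in> Y0 \<Longrightarrow> M q \<in> corth Y0"
    and Y: "Y = {q + M q | q. q \<in> Y0}" and q: "q \<in> Y0"
  shows "graph_map Y0 Y q = M q"
  unfolding graph_map_def
proof (rule the_equality)
  fix r assume r: "r \<in> corth Y0 \<and> q + r \<in> Y"
  then obtain q' where q': "q' \<in> Y0" "q + r = q' + M q'" using Y by auto
  have d: "q - q' \<in> Y0"
    using Y0 q q'(1) by (rule complex_vector.subspace_diff)
  have "q - q' = M q' + - r"
    using q'(2) by (simp add: algebra_simps)
  then have "cinner (q - q') (q - q') = cinner (M q' + - r) (q - q')"
    by simp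
  also have "\<dots> = cinner (M q') (q - q') + cinner (- r) (q - q')"
    by (rule cinner_add_left)
  also have "\<dots> = 0"
    using r M[OF q'(1)] d by (simp add: corth_def cinner_minus_left)
  finally have "q = q'" using inner_eq_Re_cinner[of "q - q'" "q - q'"] by simp
  then show "r = M q" using q'(2) by simp
qed (use M[OF q] Y q in auto)


definition crossing_form ::
    "(real \<Rightarrow> ('k::chilbert_space pow4 \<times> 'k pow4) set) \<Rightarrow> real \<Rightarrow>
     'k pow4 \<times> 'k pow4 \<Rightarrow> 'k pow4 \<times> 'k pow4 \<Rightarrow> complex" where
  "crossing_form Y s0 q p = vector_derivative (\<lambda>s. Omega_tilde q (graph_map (Y s0) (Y s) p)) (at s0)"

end

theory Submission
  imports Defs
begin

text \<open>
  The operator \<open>S = (N\<^sup>* + V\<^sup>* - l) \<tau>\<close> on \<open>dom A\<^sup>* \<times> dom A\<^sup>*\<close> is formally symmetric: Green's identity for the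
  boundary triple reads \<open>\<langle>S w, v\<rangle> - \<langle>w, S v\<rangle> = \<Omega> (T w, T v)\<close>, where \<open>T = T\<^sub>t\<close> is the trace, independently of
  the bounded symmetric terms \<open>F\<close>, \<open>G\<close> and \<open>l\<close>. Up to an interchange of rows, \<open>\<N>\<^sub>t + V\<^sub>t - l\<close> is the
  restriction of \<open>S\<close> by the boundary condition \<open>T w \<in> ran P\<^sub>t \<times> ran Q\<^sub>t\<close> (lemma \<open>perturbed_op_coupled\<close>). This
  restriction is self-adjoint, so \<open>l\<close> is an eigenvalue of \<open>\<N>\<^sub>t + V\<^sub>t\<close> exactly when the self-adjoint family
  has the eigenvalue zero. At the base point its kernel is spanned by \<open>u\<close> and its range is closed, hence
  equal to the orthogonal complement of \<open>u\<close>.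

  A real function \<open>c\<close> of \<open>(l, t)\<close> detects the eigenvalue. For parameters near the base point, look for a
  vector \<open>w\<close> with \<open>\<langle>w, u\<rangle> = \<langle>u, u\<rangle>\<close> that satisfies the boundary condition and \<open>S w = c u\<close>. At the base point
  the corresponding inhomogeneous problem, with prescribed interior and boundary data, is uniquely
  solvable (\<open>bordered_solvable\<close>), and the solution operator is bounded by Green's identity and the
  uniform boundedness principle (\<open>bounded_linear_sol\<close>). The problem for other parameters is then a small
  perturbation of the identity, so \<open>w\<close> and \<open>c\<close> are \<open>C\<^sup>1\<close> in \<open>(l, t)\<close>; \<open>c\<close> is real by symmetry, and
  \<open>c = 0\<close> makes \<open>w\<close> an eigenvector (\<open>eigenvalue_function\<close>). Hence the zero set of \<open>c\<close> gives the curves by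
  the implicit function theorem (\<open>implicit_curve\<close>), with slopes given by quotients of the partial
  derivatives of \<open>c\<close>.

  It remains to identify these derivatives with the crossing forms. Since \<open>\<Upsilon>\<close> is isotropic for
  \<open>Omega_tilde\<close>, the derivative of the graph map at \<open>q\<close> may be replaced in the form by the velocity of any
  suitable curve through \<open>q\<close> in the moving subspace (\<open>crossing_form_eq_derivative\<close>). Such a curve consists of the
  traces of vectors in the kernel of \<open>S\<close>, together with projections of \<open>T u\<close> onto the moving boundary
  condition. Kernels can be transported because \<open>S\<close> has a bounded right inverse
  (\<open>bounded_right_inverse\<close>), which rests on \<open>T u \<noteq> 0\<close>, a consequence of the unique continuation
  hypothesis. Green's identity evaluates the form on this curve, and the outcome is the squared norm of
  \<open>u\<close> times the partial derivative of \<open>c\<close> (\<open>crossing_form_at_eigenvalue\<close>).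
\<close>

section \<open>Complex inner products, orthogonal projection and weak boundedness\<close>

lemma cinner_add_right: "cinner x (y + z) = cinner x y + cinner x (z :: 'a::chilbert_space)"
  by (metis cinner_add_left cinner_commute complex_cnj_add)

lemma cinner_diff_left: "cinner (x - y) z = cinner x z - cinner y (z :: 'a::chilbert_space)"
  using cinner_add_left[of x "- y" z] by (simp add: cinner_minus_left)

lemma cinner_diff_right: "cinner x (y - z) = cinner x y - cinner x (z :: 'a::chilbert_space)"
  using cinner_add_right[of x y "- z"] by (simp add: cinner_minus_right)

lemma cinner_scaleC_right: "cinner x (a *\<^sub>C y) = cnj a * cinner x (y :: 'a::chilbert_space)"
  by (metis cinner_commute cinner_scaleC_left complex_cnj_mult)

lemma cinner_scaleR_left: "cinner (r *\<^sub>R x) y = of_real r * cinner x (y :: 'a::chilbert_space)"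
  by (metis cinner_scaleC_left scaleC_of_real)

lemma cinner_scaleR_right: "cinner x (r *\<^sub>R y) = of_real r * cinner x (y :: 'a::chilbert_space)"
  by (metis cinner_scaleC_right scaleC_of_real complex_cnj_complex_of_real)

lemma cinner_self: "cinner x x = of_real ((norm (x :: 'a::chilbert_space))\<^sup>2)"
proof -
  have "Im (cinner x x) = 0"
    using arg_cong[OF cinner_commute[of x x], of Im] by simp
  moreover have "Re (cinner x x) = (norm x)\<^sup>2"
    by (simp add: inner_eq_Re_cinner[symmetric] power2_norm_eq_inner)
  ultimately show ?thesis by (simp add: complex_eq_iff)
qed

lemma norm_scaleC: "norm (a *\<^sub>C x) = cmod a * norm (x :: 'a::chilbert_space)"
proof -
  have "of_real ((norm (a *\<^sub>C x))\<^sup>2) = cinner (a *\<^sub>C x) (a *\<^sub>C x)"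
    by (simp add: cinner_self)
  also have "\<dots> = a * cnj a * of_real ((norm x)\<^sup>2)"
    unfolding cinner_scaleC_left cinner_scaleC_right by (simp add: cinner_self)
  also have "\<dots> = of_real ((cmod a * norm x)\<^sup>2)"
    by (subst complex_norm_square[symmetric]) (simp add: power_mult_distrib)
  finally show ?thesis
    by (metis norm_ge_zero of_real_eq_iff power2_eq_iff_nonneg zero_le_mult_iff)
qed

lemma norm_cinner_le: "cmod (cinner x y) \<le> norm x * norm (y :: 'a::chilbert_space)"
proof (cases "cinner x y = 0")
  case False
  define a where "a = cnj (sgn (cinner x y))"
  have "cmod a = 1" using False by (simp add: a_def norm_sgn)
  have "of_real (cmod (cinner x y)) = a * cinner x y"
    using False complex_norm_square[of "cinner x y"]
    by (simp add: a_def sgn_eq power2_eq_square field_simps)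
  then have "cmod (cinner x y) = inner (a *\<^sub>C x) y"
    by (metis cinner_scaleC_left inner_eq_Re_cinner Re_complex_of_real)
  also have "\<dots> \<le> norm (a *\<^sub>C x) * norm y" by (rule norm_cauchy_schwarz)
  finally show ?thesis using \<open>cmod a = 1\<close> by (simp add: norm_scaleC)
qed simp

lemma bounded_bilinear_cinner: "bounded_bilinear (cinner :: 'a::chilbert_space \<Rightarrow> 'a \<Rightarrow> complex)"
  by standard (auto simp: cinner_add_left cinner_add_right cinner_scaleR_left cinner_scaleR_right
      scaleR_conv_of_real intro!: exI[of _ 1] norm_cinner_le)

lemma bounded_bilinear_scaleC: "bounded_bilinear (scaleC :: complex \<Rightarrow> 'a::chilbert_space \<Rightarrow> 'a)"
proof
  fix r :: real and a :: complex and b :: 'a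
  have "(r *\<^sub>R a) *\<^sub>C b = (of_real r * a) *\<^sub>C b" by (simp add: scaleR_conv_of_real)
  then show "(r *\<^sub>R a) *\<^sub>C b = r *\<^sub>R (a *\<^sub>C b)"
    by (simp only: scaleC_scaleC[symmetric] scaleC_of_real)
  have "a *\<^sub>C (r *\<^sub>R b) = (of_real r * a) *\<^sub>C b"
    by (simp add: scaleC_of_real[symmetric] scaleC_scaleC mult.commute)
  then show "a *\<^sub>C (r *\<^sub>R b) = r *\<^sub>R (a *\<^sub>C b)"
    by (simp only: scaleC_scaleC[symmetric] scaleC_of_real)
qed (auto simp: scaleC_add_left scaleC_add_right norm_scaleC intro!: exI[of _ 1])

lemma csubspaceI:
  assumes "0 \<in> M" "\<And>x y. x \<in> M \<Longrightarrow> y \<in> M \<Longrightarrow> x + y \<in> M" "\<And>a x. x \<in> M \<Longrightarrow> a *\<^sub>C x \<in> M"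
  shows "csubspace M"
  using assms by (simp add: complex_vector.subspace_def)

lemma csubspaceD:
  assumes "csubspace M"
  shows "0 \<in> M" and "x \<in> M \<Longrightarrow> y \<in> M \<Longrightarrow> x + y \<in> M" and "x \<in> M \<Longrightarrow> y \<in> M \<Longrightarrow> x - y \<in> M"
    and "x \<in> M \<Longrightarrow> a *\<^sub>C x \<in> M" and "x \<in> M \<Longrightarrow> - x \<in> M"
proof -
  show "0 \<in> M" and "x \<in> M \<Longrightarrow> y \<in> M \<Longrightarrow> x + y \<in> M" and "x \<in> M \<Longrightarrow> a *\<^sub>C x \<in> M"
    using assms by (auto simp: complex_vector.subspace_def)
  show "x \<in> M \<Longrightarrow> y \<in> M \<Longrightarrow> x - y \<in> M" "x \<in> M \<Longrightarrow> - x \<in> M"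
    using assms complex_vector.subspace_diff complex_vector.subspace_neg by blast+
qed

lemma csubspace_Times: "csubspace M \<Longrightarrow> csubspace N \<Longrightarrow> csubspace (M \<times> N)"
  using csubspaceD[of M] csubspaceD[of N]
  by (intro csubspaceI) (simp_all add: mem_Times_iff scaleC_prod_def)

text \<open>Two almost minimizing points of the subspace are close to each other by the parallelogram
  law, so a minimizing sequence converges, and its limit is the foot of the perpendicular.\<close>

lemma orthogonal_decomposition:
  fixes x :: "'a::chilbert_space"
  assumes M: "csubspace M" and "closed M"
  obtains y where "y \<in> M" "x - y \<in> corth M"
proof -
  have "M \<noteq> {}" using csubspaceD(1)[OF M] by auto
  define d where "d = infdist x M"
  have d_le: "d \<le> norm (x - y)" if "y \<in> M" for y
    unfolding d_def using infdist_le[OF that, of x] by (simp add: dist_norm)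
  have d0: "d \<ge> 0" by (simp add: d_def infdist_nonneg)
  have "\<exists>y\<in>M. norm (x - y) < d + 1 / Suc n" for n
  proof -
    have "Inf ((\<lambda>a. dist x a) ` M) < d + 1 / Suc n"
      using \<open>M \<noteq> {}\<close> by (simp add: d_def infdist_def)
    then show ?thesis
      using \<open>M \<noteq> {}\<close> by (subst (asm) cInf_less_iff) (auto simp: dist_norm intro!: bdd_belowI[of _ 0])
  qed
  then obtain y where y: "\<And>n. y n \<in> M" "\<And>n. norm (x - y n) < d + 1 / Suc n" by metis
  have gap: "(norm (y m - y n))\<^sup>2 \<le> 4 * (2 * d + 1) * (1 / Suc N)" if "m \<ge> N" "n \<ge> N" for m n N
  proof -
    have sub: "(norm (x - y k))\<^sup>2 \<le> d\<^sup>2 + (2 * d + 1) * (1 / Suc N)" if "k \<ge> N" for k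
    proof -
      have inv: "1 / real (Suc k) \<le> 1 / Suc N" "1 / real (Suc N) \<le> 1"
        using that by (auto simp: divide_simps)
      have "norm (x - y k) \<le> d + 1 / Suc N"
        using y(2)[of k] inv by linarith
      then have "(norm (x - y k))\<^sup>2 \<le> (d + 1 / Suc N)\<^sup>2" by (intro power_mono) auto
      also have "\<dots> = d\<^sup>2 + 2 * d * (1 / Suc N) + (1 / Suc N) * (1 / Suc N)"
        by (simp only: power2_eq_square) (simp add: algebra_simps)
      also have "(1 / Suc N) * (1 / real (Suc N)) \<le> 1 * (1 / Suc N)"
        by (intro mult_right_mono inv) auto
      finally show ?thesis by (simp add: algebra_simps)
    qed
    define c where "c = (1 / 2) *\<^sub>R (y m + y n)"
    have "c \<in> M" unfolding c_def scaleC_of_real[symmetric]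
      by (intro csubspaceD[OF M] y)
    then have mid: "d\<^sup>2 \<le> (norm (x - c))\<^sup>2"
      using d_le d0 by (intro power_mono) auto
    have "(norm (y m - y n))\<^sup>2 = 2 * (norm (x - y m))\<^sup>2 + 2 * (norm (x - y n))\<^sup>2 - 4 * (norm (x - c))\<^sup>2"
      unfolding power2_norm_eq_inner c_def
      by (simp add: inner_diff_left inner_diff_right inner_add_left inner_add_right inner_commute
          algebra_simps)
    then show ?thesis using mid sub[OF that(1)] sub[OF that(2)] by argo
  qed
  have "Cauchy y"
  proof (rule metric_CauchyI)
    fix e :: real assume "e > 0"
    obtain N where N: "4 * (2 * d + 1) / e\<^sup>2 < real N" using reals_Archimedean2 by blast
    have "4 * (2 * d + 1) * (1 / Suc N) < e\<^sup>2"
      using N \<open>e > 0\<close> d0 by (simp add: divide_simps distrib_right mult.commute add_strict_increasing)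
    then have "norm (y m - y n) < e" if "m \<ge> N" "n \<ge> N" for m n
      using gap[OF that] \<open>e > 0\<close> by (smt (verit) power2_less_imp_less)
    then show "\<exists>N. \<forall>m\<ge>N. \<forall>n\<ge>N. dist (y m) (y n) < e" by (auto simp: dist_norm)
  qed
  then obtain z where z: "y \<longlonglongrightarrow> z" using Cauchy_convergent_iff convergentD by blast
  have "z \<in> M" using closed_sequentially[OF \<open>closed M\<close> _ z] y by auto
  have "(\<lambda>n. norm (x - y n)) \<longlonglongrightarrow> norm (x - z)" by (intro tendsto_intros z)
  moreover have "(\<lambda>n. d + 1 / real (Suc n)) \<longlonglongrightarrow> d + 0"
    using LIMSEQ_Suc[OF lim_1_over_n] by (intro tendsto_intros) auto
  ultimately have "norm (x - z) \<le> d + 0"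
    using y(2) less_imp_le by (intro LIMSEQ_le) blast+
  then have min: "norm (x - z) \<le> norm (x - v)" if "v \<in> M" for v using d_le[OF that] by simp
  have re: "inner (x - z) v = 0" if "v \<in> M" for v
  proof (cases "v = 0")
    case False
    define t where "t = inner (x - z) v / (norm v)\<^sup>2"
    have "z + t *\<^sub>R v \<in> M" unfolding scaleC_of_real[symmetric]
      using \<open>z \<in> M\<close> that by (intro csubspaceD[OF M])
    from min[OF this] have "(norm (x - z))\<^sup>2 \<le> (norm ((x - z) - t *\<^sub>R v))\<^sup>2"
      by (simp add: diff_diff_eq)
    also have "\<dots> = (norm (x - z))\<^sup>2 - 2 * t * inner (x - z) v + t\<^sup>2 * (norm v)\<^sup>2"
      unfolding power2_norm_eq_inner
      by (simp add: inner_diff_left inner_diff_right inner_commute power2_eq_square algebra_simps)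
    finally have "0 \<le> - (inner (x - z) v)\<^sup>2 / (norm v)\<^sup>2"
      using False by (simp add: t_def power2_eq_square divide_simps)
    then show ?thesis
      using False by (simp add: divide_simps)
  qed simp
  have "cinner (x - z) v = 0" if "v \<in> M" for v
  proof -
    have "Re (cinner (x - z) v) = 0" "Re (cinner (x - z) (\<i> *\<^sub>C v)) = 0"
      using re[OF that] re[OF csubspaceD(4)[OF M that, of \<i>]] by (simp_all add: inner_eq_Re_cinner)
    then show ?thesis by (simp add: cinner_scaleC_right complex_eq_iff)
  qed
  then show ?thesis using that \<open>z \<in> M\<close> by (auto simp: corth_def)
qed

text \<open>The sets of those \<open>g\<close> whose functional is bounded by a fixed constant on \<open>S\<close> are closed and
  cover the space, so one of them contains a ball by Baire's theorem.\<close>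

lemma weakly_bounded_imp_bounded:
  fixes S :: "'a::{real_inner, complete_space} set"
  assumes "\<And>g. \<exists>C. \<forall>x\<in>S. \<bar>inner x g\<bar> \<le> C"
  shows "\<exists>C\<ge>0. \<forall>x\<in>S. norm x \<le> C"
proof -
  define K where "K n = {g. \<forall>x\<in>S. \<bar>inner x g\<bar> \<le> real n}" for n
  have "closed (K n)" for n
  proof -
    have "K n = (\<Inter>x\<in>S. {g. \<bar>inner x g\<bar> \<le> real n})" by (auto simp: K_def)
    then show ?thesis by (auto intro!: closed_INT closed_Collect_le continuous_intros)
  qed
  moreover have cover: "(\<Union>n. K n) = UNIV"
  proof safe
    fix g :: 'a
    obtain C where "\<forall>x\<in>S. \<bar>inner x g\<bar> \<le> C" using assms by blast
    moreover obtain n where "C \<le> real n" using real_arch_simple by blast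
    ultimately show "g \<in> (\<Union>n. K n)" by (intro UN_I[of n]) (force simp: K_def)+
  qed auto
  ultimately have "\<exists>n. interior (K n) \<noteq> {}"
    using Met_TC.metric_Baire_category_alt[of "range K"] complete_UNIV[where 'a='a]
    by auto
  then obtain n g r where "r > 0" and ball: "ball g r \<subseteq> K n"
    by (metis ex_in_conv mem_interior)
  have "norm x \<le> 4 * real n / r" if "x \<in> S" for x
  proof (cases "x = 0")
    case False
    define h where "h = (r / (2 * norm x)) *\<^sub>R x"
    have nh: "norm h = r / 2" using False \<open>r > 0\<close> by (simp add: h_def)
    have "g + h \<in> K n" "g \<in> K n"
      using ball nh \<open>r > 0\<close> by (auto intro!: subsetD[OF ball] simp: dist_norm)
    then have "\<bar>inner x (g + h)\<bar> \<le> n" "\<bar>inner x g\<bar> \<le> n" using that by (auto simp: K_def)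
    then have "inner x h \<le> 2 * n" by (simp add: inner_add_right)
    moreover have "inner x h = r / 2 * norm x"
      using False by (simp add: h_def power2_norm_eq_inner[symmetric] power2_eq_square)
    ultimately show ?thesis using \<open>r > 0\<close> by (simp add: divide_simps mult.commute)
  qed (use \<open>r > 0\<close> in simp)
  then show ?thesis using \<open>r > 0\<close> by (intro exI[of _ "4 * real n / r"]) auto
qed

section \<open>Perturbed linear equations and implicit curves\<close>

text \<open>Inverses of operators near the identity occur three times below: for the bordered equation, for
  transporting kernels and for transporting the ranges of projections. The bound makes the inverse
  continuous in the operator.\<close>

lemma near_identity_invertible:
  fixes T :: "'y::banach \<Rightarrow>\<^sub>L 'y"
  assumes "norm (T - id_blinfun) \<le> 1 / 2"
  obtains G where "T o\<^sub>L G = id_blinfun" "G o\<^sub>L T = id_blinfun" "norm G \<le> 2"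
proof -
  define E where "E = T - id_blinfun"
  have E: "norm (E x) \<le> norm x / 2" for x
    using norm_blinfun[of E x] mult_right_mono[OF assms norm_ge_zero[of x]] by (simp add: E_def)
  have T: "T x = x + E x" for x by (simp add: E_def blinfun.diff_left)
  have lower: "norm x \<le> 2 * norm (T x)" for x
    using E[of x] norm_triangle_ineq4[of "T x" "E x"] by (simp add: T)
  have ex: "\<exists>x. T x = y" for y
  proof -
    have "dist (y - E x) (y - E x') \<le> 1 / 2 * dist x x'" for x x'
      using E[of "x - x'"] by (simp add: dist_norm blinfun.diff_right norm_minus_commute)
    then have "\<exists>!x. y - E x = x"
      by (intro banach_fix_type[where c = "1 / 2"]) auto
    then show ?thesis by (metis T add_diff_cancel diff_add_cancel)
  qed
  define g where "g y = (SOME x. T x = y)" for y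
  have Tg: "T (g y) = y" for y unfolding g_def using someI_ex[OF ex] .
  have inj: "x = x'" if "T x = T x'" for x x'
    using lower[of "x - x'"] that by (simp add: blinfun.diff_right)
  have "bounded_linear g"
  proof (rule bounded_linear_intro[where K = 2])
    show "g (x + y) = g x + g y" for x y by (rule inj) (simp add: Tg blinfun.add_right)
    show "g (r *\<^sub>R x) = r *\<^sub>R g x" for r x by (rule inj) (simp add: Tg blinfun.scaleR_right)
    show "norm (g x) \<le> norm x * 2" for x using lower[of "g x"] by (simp add: Tg)
  qed
  then have g: "blinfun_apply (Blinfun g) = g" by (rule bounded_linear_Blinfun_apply)
  show thesis
  proof
    show "T o\<^sub>L Blinfun g = id_blinfun" by (rule blinfun_eqI) (simp add: g Tg)
    show "Blinfun g o\<^sub>L T = id_blinfun" by (rule blinfun_eqI, rule inj) (simp add: g Tg)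
    show "norm (Blinfun g) \<le> 2"
      using lower[of "g _"] by (intro norm_blinfun_bound) (auto simp: g Tg)
  qed
qed

text \<open>For a product with a factor that vanishes at the point, continuity of the other factor is
  enough.\<close>

lemma (in bounded_bilinear) has_derivative_vanishing:
  assumes f: "f \<midarrow>x\<rightarrow> f x" and g: "(g has_derivative g') (at x)" and "g x = 0"
  shows "((\<lambda>y. prod (f y) (g y)) has_derivative (\<lambda>h. prod (f x) (g' h))) (at x)"
proof -
  interpret g': bounded_linear g' by (rule has_derivative_bounded_linear[OF g])
  obtain K where K: "\<And>h. norm (g' h) \<le> norm h * K" "K > 0" using g'.pos_bounded by blast
  obtain C where C: "\<And>a b. norm (prod a b) \<le> norm a * norm b * C" "C > 0" using pos_bounded by blast
  have rest: "((\<lambda>y. prod (f y - f x) (g y)) has_derivative (\<lambda>h. 0)) (at x)"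
    unfolding has_derivative_iff_norm
  proof safe
    let ?r = "\<lambda>y. norm (g y - g x - g' (y - x)) / norm (y - x)"
    have "((\<lambda>y. norm (f y - f x) * (?r y + K) * C) \<longlongrightarrow> 0 * (0 + K) * C) (at x)"
      using f g unfolding has_derivative_iff_norm
      by (intro tendsto_intros tendsto_norm_zero) (auto simp: LIM_zero_iff)
    then have lim: "((\<lambda>y. norm (f y - f x) * (?r y + K) * C) \<longlongrightarrow> 0) (at x)" by simp
    have le: "\<forall>\<^sub>F y in at x. norm (prod (f y - f x) (g y) - prod (f x - f x) (g x) - 0) / norm (y - x)
        \<le> norm (f y - f x) * (?r y + K) * C"
    proof (rule eventually_mono[OF eventually_neq_at_within[of x x UNIV]])
      fix y assume "y \<noteq> x"
      then have n: "norm (y - x) > 0" by simp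
      have "norm (g y) \<le> norm (g y - g x - g' (y - x)) + norm (y - x) * K"
        using norm_triangle_ineq[of "g y - g x - g' (y - x)" "g' (y - x)"] K(1)[of "y - x"] \<open>g x = 0\<close> by simp
      also have "\<dots> = norm (y - x) * (?r y + K)" using n by (simp add: distrib_left)
      finally have "norm (prod (f y - f x) (g y)) \<le> norm (f y - f x) * (norm (y - x) * (?r y + K)) * C"
        using C K by (intro order_trans[OF C(1)] mult_right_mono mult_left_mono) auto
      then show "norm (prod (f y - f x) (g y) - prod (f x - f x) (g x) - 0) / norm (y - x)
          \<le> norm (f y - f x) * (?r y + K) * C"
        using n by (simp add: \<open>g x = 0\<close> zero_right divide_le_eq mult.commute mult.left_commute)
    qed
    show "((\<lambda>y. norm (prod (f y - f x) (g y) - prod (f x - f x) (g x) - 0) / norm (y - x)) \<longlongrightarrow> 0) (at x)"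
      by (rule tendsto_sandwich[OF _ le tendsto_const lim]) auto
  qed auto
  have "((\<lambda>y. prod (f y - f x) (g y) + prod (f x) (g y)) has_derivative (\<lambda>h. 0 + prod (f x) (g' h))) (at x)"
    by (intro has_derivative_add rest bounded_linear.has_derivative[OF bounded_linear_right] g)
  then show ?thesis by (simp add: diff_left)
qed

text \<open>The unknown is differentiated by writing the increment of the solution as an inverse operator,
  which is continuous in the parameters, applied to a residual that is differentiable and vanishes
  at the base point.\<close>

lemma affine_equation_C1_solution:
  fixes N N' :: "real \<Rightarrow> 'y::banach \<Rightarrow>\<^sub>L 'y" and L :: "'y \<Rightarrow>\<^sub>L 'y"
    and k k' :: "real \<Rightarrow> 'y" and l :: 'y and x0 t0 :: real
  assumes J: "open J" "t0 \<in> J"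
    and N: "\<And>t. t \<in> J \<Longrightarrow> (N has_vector_derivative N' t) (at t)" "continuous_on J N'" "N t0 = 0"
    and k: "\<And>t. t \<in> J \<Longrightarrow> (k has_vector_derivative k' t) (at t)" "continuous_on J k'" "k t0 = 0"
  obtains U y a b where "open U" "(x0, t0) \<in> U" "U \<subseteq> UNIV \<times> J" "y (x0, t0) = 0"
    "\<And>x t. (x, t) \<in> U \<Longrightarrow>
       y (x, t) + N t (y (x, t)) + (x - x0) *\<^sub>R L (y (x, t)) + k t + (x - x0) *\<^sub>R l = 0"
    "\<And>p. p \<in> U \<Longrightarrow> (y has_derivative (\<lambda>(x, t). x *\<^sub>R a p + t *\<^sub>R b p)) (at p)"
    "continuous_on U a" "continuous_on U b" "a (x0, t0) = - l" "b (x0, t0) = - k' t0"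
proof -
  define M where "M p = id_blinfun + N (snd p) + (fst p - x0) *\<^sub>R L" for p :: "real \<times> real"
  define r where "r p = k (snd p) + (fst p - x0) *\<^sub>R l" for p :: "real \<times> real"
  have openJ: "open (UNIV \<times> J)" using J by (intro open_Times) auto
  have dM: "(M has_derivative (\<lambda>h. snd h *\<^sub>R N' (snd p) + fst h *\<^sub>R L)) (at p)" if "snd p \<in> J" for p
  proof -
    have "((\<lambda>p. N (snd p)) has_derivative (\<lambda>h. snd h *\<^sub>R N' (snd p))) (at p)"
      by (rule has_derivative_compose[OF has_derivative_snd[OF has_derivative_ident]])
        (use N(1)[OF that] in \<open>simp add: has_vector_derivative_def\<close>)
    then show ?thesis unfolding M_def by (auto intro!: derivative_eq_intros)
  qed
  have dr: "(r has_derivative (\<lambda>h. snd h *\<^sub>R k' (snd p) + fst h *\<^sub>R l)) (at p)" if "snd p \<in> J" for p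
  proof -
    have "((\<lambda>p. k (snd p)) has_derivative (\<lambda>h. snd h *\<^sub>R k' (snd p))) (at p)"
      by (rule has_derivative_compose[OF has_derivative_snd[OF has_derivative_ident]])
        (use k(1)[OF that] in \<open>simp add: has_vector_derivative_def\<close>)
    then show ?thesis unfolding r_def by (auto intro!: derivative_eq_intros)
  qed
  have contM: "continuous_on (UNIV \<times> J) M"
    by (intro continuous_at_imp_continuous_on ballI has_derivative_continuous[OF dM]) auto
  define U where "U = (UNIV \<times> J) \<inter> (\<lambda>p. norm (M p - id_blinfun)) -` {..<1 / 2}"
  have "open U" unfolding U_def
    by (intro continuous_open_preimage openJ continuous_intros contM)
  have U: "snd p \<in> J" "norm (M p - id_blinfun) \<le> 1 / 2" if "p \<in> U" for p
    using that by (auto simp: U_def)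
  have p0: "(x0, t0) \<in> U" using J N(3) by (simp add: U_def M_def)
  obtain G where G: "\<And>p. p \<in> U \<Longrightarrow> M p o\<^sub>L G p = id_blinfun"
      "\<And>p. p \<in> U \<Longrightarrow> G p o\<^sub>L M p = id_blinfun" "\<And>p. p \<in> U \<Longrightarrow> norm (G p) \<le> 2"
  proof -
    have "\<exists>G. M p o\<^sub>L G = id_blinfun \<and> G o\<^sub>L M p = id_blinfun \<and> norm G \<le> 2" if "p \<in> U" for p
      using near_identity_invertible[OF U(2)[OF that]] by blast
    then show ?thesis using that by metis
  qed
  have MG: "M p (G p v) = v" and GM: "G p (M p v) = v" if "p \<in> U" for p v
    using G(1,2)[OF that] by (metis blinfun_apply_blinfun_compose blinfun_apply_id_blinfun)+
  have contG: "continuous_on U G"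
  proof (rule continuous_at_imp_continuous_on, safe)
    fix x t assume p: "(x, t) \<in> U"
    let ?p = "(x, t)"
    have "((\<lambda>q. 4 * norm (M q - M ?p)) \<longlongrightarrow> 4 * norm (M ?p - M ?p)) (at ?p)"
      by (intro tendsto_intros isContD has_derivative_continuous[OF dM] U p)
    then have lim: "((\<lambda>q. 4 * norm (M q - M ?p)) \<longlongrightarrow> 0) (at ?p)" by simp
    have "\<forall>\<^sub>F q in at ?p. norm (G q - G ?p) \<le> 4 * norm (M q - M ?p)"
      using eventually_at_in_open'[OF \<open>open U\<close> p]
    proof eventually_elim
      case (elim q)
      have "G q - G ?p = - (G q o\<^sub>L ((M q - M ?p) o\<^sub>L G ?p))"
        by (rule blinfun_eqI) (simp add: blinfun.bilinear_simps MG[OF p] GM[OF elim])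
      then have "norm (G q - G ?p) = norm (G q o\<^sub>L ((M q - M ?p) o\<^sub>L G ?p))"
        by (simp only: norm_minus_cancel)
      also have "\<dots> \<le> norm (G q) * norm ((M q - M ?p) o\<^sub>L G ?p)"
        by (rule norm_blinfun_compose)
      also have "\<dots> \<le> norm (G q) * (norm (M q - M ?p) * norm (G ?p))"
        by (intro mult_left_mono norm_blinfun_compose norm_ge_zero)
      also have "\<dots> \<le> 2 * (norm (M q - M ?p) * 2)"
        using G(3)[OF p] G(3)[OF elim] by (intro mult_mono) auto
      finally show ?case by simp
    qed
    then have "((\<lambda>q. G q - G ?p) \<longlongrightarrow> 0) (at ?p)"
      by (intro tendsto_norm_zero_cancel[OF tendsto_sandwich[OF _ _ tendsto_const lim]]) auto
    then show "isCont G ?p" by (simp add: isCont_def LIM_zero_iff)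
  qed
  define y where "y p = - G p (r p)" for p
  define a where "a p = G p (- l - L (y p))" for p
  define b where "b p = G p (- k' (snd p) - N' (snd p) (y p))" for p
  have dy: "(y has_derivative (\<lambda>(x, t). x *\<^sub>R a p + t *\<^sub>R b p)) (at p)" if p: "p \<in> U" for p
  proof -
    define g where "g q = - r q - M q (y p)" for q
    have "(g has_derivative (\<lambda>h. - (snd h *\<^sub>R k' (snd p) + fst h *\<^sub>R l)
        - (snd h *\<^sub>R N' (snd p) + fst h *\<^sub>R L) (y p))) (at p)"
      unfolding g_def
      by (intro has_derivative_diff has_derivative_minus dr dM U p
          bounded_linear.has_derivative[OF blinfun.bounded_linear_left])
    moreover have "g p = 0" by (simp add: g_def y_def MG[OF p] blinfun.minus_right)
    moreover have "G \<midarrow>p\<rightarrow> G p"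
      using contG p \<open>open U\<close> by (simp add: continuous_on_eq_continuous_at continuous_at)
    ultimately have "((\<lambda>q. G q (g q)) has_derivative (\<lambda>h. G p (- (snd h *\<^sub>R k' (snd p) + fst h *\<^sub>R l)
        - (snd h *\<^sub>R N' (snd p) + fst h *\<^sub>R L) (y p)))) (at p)"
      using blinfun.has_derivative_vanishing by blast
    then have "((\<lambda>q. y p + G q (g q)) has_derivative (\<lambda>h. 0 + G p (- (snd h *\<^sub>R k' (snd p) + fst h *\<^sub>R l)
        - (snd h *\<^sub>R N' (snd p) + fst h *\<^sub>R L) (y p)))) (at p)"
      by (intro has_derivative_add has_derivative_const)
    also have "(\<lambda>h. 0 + G p (- (snd h *\<^sub>R k' (snd p) + fst h *\<^sub>R l)
        - (snd h *\<^sub>R N' (snd p) + fst h *\<^sub>R L) (y p))) = (\<lambda>(x, t). x *\<^sub>R a p + t *\<^sub>R b p)"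
      by (auto simp: fun_eq_iff a_def b_def blinfun.bilinear_simps algebra_simps)
    finally show ?thesis
    proof (rule has_derivative_transform_within_open)
      show "y p + G q (g q) = y q" if "q \<in> U" for q
        by (simp add: g_def y_def[of q] blinfun.diff_right blinfun.minus_right GM[OF that])
    qed (use \<open>open U\<close> p in auto)
  qed
  have conty: "continuous_on U y"
    by (intro continuous_at_imp_continuous_on ballI has_derivative_continuous[OF dy])
  have snd: "continuous_on U (\<lambda>p. f (snd p))" if "continuous_on J f" for f :: "real \<Rightarrow> 'z::topological_space"
    using U by (intro continuous_on_compose2[OF that]) (auto intro: continuous_intros)
  show thesis
  proof (rule that[of U y a b])
    show "y (x, t) + N t (y (x, t)) + (x - x0) *\<^sub>R L (y (x, t)) + k t + (x - x0) *\<^sub>R l = 0"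
      if "(x, t) \<in> U" for x t
    proof -
      have "M (x, t) (y (x, t)) = - r (x, t)"
        by (simp add: y_def blinfun.minus_right MG[OF that])
      then show ?thesis by (simp add: M_def r_def blinfun.bilinear_simps algebra_simps)
    qed
    have r0: "r (x0, t0) = 0" using k by (simp add: r_def)
    then show y0: "y (x0, t0) = 0" by (simp add: y_def blinfun.bilinear_simps)
    have "G (x0, t0) v = v" for v using GM[OF p0, of v] N(3) by (simp add: M_def)
    then show "a (x0, t0) = - l" "b (x0, t0) = - k' t0"
      by (simp_all add: a_def b_def y0 blinfun.bilinear_simps)
    show "continuous_on U a" "continuous_on U b" unfolding a_def b_def
      by (intro continuous_intros contG conty snd k N)+
  qed (use \<open>open U\<close> p0 dy in \<open>auto simp: U_def\<close>)
qed

text \<open>The map \<open>(x, t) \<mapsto> (c (x, t), t)\<close> of the plane is a local diffeomorphism, and its inverse restricted to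
  the line \<open>c = 0\<close> is the curve.\<close>

lemma implicit_curve:
  fixes c a b :: "real \<times> real \<Rightarrow> real"
  assumes U: "open U" "(x0, t0) \<in> U"
    and c: "\<And>p. p \<in> U \<Longrightarrow> (c has_derivative (\<lambda>(x, t). x * a p + t * b p)) (at p)"
    and cont: "continuous_on U a" "continuous_on U b"
    and zero: "c (x0, t0) = 0" and nz: "a (x0, t0) \<noteq> 0"
  obtains e \<mu> where "e > 0" "\<mu> t0 = x0" "\<mu> C1_differentiable_on {t0 - e<..<t0 + e}"
    "\<And>t. t \<in> {t0 - e<..<t0 + e} \<Longrightarrow> (\<mu> t, t) \<in> U \<and> c (\<mu> t, t) = 0"
    "deriv \<mu> t0 = - b (x0, t0) / a (x0, t0)"
proof -
  define f where "f p = (c p, snd p)" for p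
  define E1 :: "(real \<times> real) \<Rightarrow>\<^sub>L (real \<times> real)" where "E1 = Blinfun (\<lambda>h. (fst h, 0))"
  define E2 :: "(real \<times> real) \<Rightarrow>\<^sub>L (real \<times> real)" where "E2 = Blinfun (\<lambda>h. (snd h, 0))"
  define E3 :: "(real \<times> real) \<Rightarrow>\<^sub>L (real \<times> real)" where "E3 = Blinfun (\<lambda>h. (0, snd h))"
  have E: "blinfun_apply E1 = (\<lambda>h. (fst h, 0))" "blinfun_apply E2 = (\<lambda>h. (snd h, 0))"
     "blinfun_apply E3 = (\<lambda>h. (0, snd h))"
    unfolding E1_def E2_def E3_def
    by (intro bounded_linear_Blinfun_apply bounded_linear_intros)+
  define f' where "f' p = a p *\<^sub>R E1 + b p *\<^sub>R E2 + E3" for p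
  have f': "f' p (x, t) = (x * a p + t * b p, t)" for p x t
    by (simp add: f'_def blinfun.bilinear_simps E mult.commute)
  define invf where "invf = (1 / a (x0, t0)) *\<^sub>R E1 - (b (x0, t0) / a (x0, t0)) *\<^sub>R E2 + E3"
  have df: "(f has_derivative f' p) (at p)" if "p \<in> U" for p
  proof -
    have "(f has_derivative (\<lambda>h. ((\<lambda>(x, t). x * a p + t * b p) h, snd h))) (at p)"
      unfolding f_def by (intro has_derivative_Pair c that has_derivative_snd has_derivative_ident)
    also have "(\<lambda>h. ((\<lambda>(x, t). x * a p + t * b p) h, snd h)) = f' p" by (auto simp: f' fun_eq_iff)
    finally show ?thesis .
  qed
  have cf: "continuous_on U f'" unfolding f'_def by (intro continuous_intros cont)
  have invf: "invf o\<^sub>L f' (x0, t0) = id_blinfun"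
    by (rule blinfun_eqI) (use nz in \<open>auto simp: f' invf_def blinfun.bilinear_simps E field_simps\<close>)
  obtain U' V g g' where U': "open U'" "U' \<subseteq> U" "(x0, t0) \<in> U'" "open V" "f (x0, t0) \<in> V"
      "homeomorphism U' V f g"
    and g: "\<And>y. y \<in> V \<Longrightarrow> (g has_derivative (g' y)) (at y)"
      "\<And>y. y \<in> V \<Longrightarrow> g' y = inv (blinfun_apply (f' (g y)))"
      "\<And>y. y \<in> V \<Longrightarrow> bij (blinfun_apply (f' (g y)))"
    by (rule inverse_function_theorem[OF U(1) df cf U(2) invf]) (assumption, rule that)
  define \<mu> where "\<mu> t = fst (g (0, t))" for t
  have "(0, t0) \<in> V" using U' zero by (simp add: f_def)
  then obtain e where "e > 0" and e: "ball (0, t0) e \<subseteq> V" using \<open>open V\<close> open_contains_ball by blast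
  have V: "(0, t) \<in> V" if "t \<in> {t0 - e<..<t0 + e}" for t
    using that by (intro subsetD[OF e]) (auto simp: dist_Pair_Pair dist_real_def)
  have on: "g (0, t) = (\<mu> t, t)" "(\<mu> t, t) \<in> U" "c (\<mu> t, t) = 0" if "t \<in> {t0 - e<..<t0 + e}" for t
  proof -
    have "g (0, t) \<in> U'" "f (g (0, t)) = (0, t)"
      using U'(6) V[OF that] unfolding homeomorphism_def by auto
    then show "g (0, t) = (\<mu> t, t)" "(\<mu> t, t) \<in> U" "c (\<mu> t, t) = 0"
      using U'(2) by (auto simp: \<mu>_def f_def prod_eq_iff subset_iff) (metis prod.collapse)+
  qed
  have d: "a (\<mu> t, t) \<noteq> 0" "(\<mu> has_real_derivative (- b (\<mu> t, t) / a (\<mu> t, t))) (at t)"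
    if t: "t \<in> {t0 - e<..<t0 + e}" for t
  proof -
    let ?L = "blinfun_apply (f' (\<mu> t, t))"
    have bij: "bij ?L" using g(3)[OF V[OF t]] on(1)[OF t] by simp
    show nza: "a (\<mu> t, t) \<noteq> 0"
    proof
      assume "a (\<mu> t, t) = 0"
      then have "?L (1, 0) = ?L (0, 0)" by (simp add: f')
      then show False using bij by (auto dest!: bij_is_inj injD)
    qed
    have "?L (- b (\<mu> t, t) / a (\<mu> t, t), 1) = (0, 1)" using nza by (simp add: f')
    then have inv: "inv ?L (0, 1) = (- b (\<mu> t, t) / a (\<mu> t, t), 1)"
      using bij by (metis bij_is_inj inv_f_f)
    have "((\<lambda>s. g (0, s)) has_derivative (\<lambda>h. g' (0, t) (0, h))) (at t)"
      by (rule has_derivative_compose[where f = "\<lambda>s. (0, s)"])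
        (auto intro!: derivative_eq_intros g V t)
    then have "(\<mu> has_derivative (\<lambda>h. fst (g' (0, t) (0, h)))) (at t)"
      unfolding \<mu>_def by (rule has_derivative_fst)
    moreover have "fst (g' (0, t) (0, h)) = (- b (\<mu> t, t) / a (\<mu> t, t)) * h" for h
    proof -
      interpret bounded_linear "g' (0, t)"
        by (rule has_derivative_bounded_linear[OF g(1)[OF V[OF t]]])
      have "g' (0, t) (0, h) = h *\<^sub>R g' (0, t) (0, 1)" by (simp add: scaleR[symmetric])
      then show ?thesis using g(2)[OF V[OF t]] on(1)[OF t] inv by simp
    qed
    ultimately show "(\<mu> has_real_derivative (- b (\<mu> t, t) / a (\<mu> t, t))) (at t)"
      unfolding has_field_derivative_def by (simp only:)
  qed
  have t0: "t0 \<in> {t0 - e<..<t0 + e}" using \<open>e > 0\<close> by simp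
  have \<mu>0: "\<mu> t0 = x0"
  proof -
    have "g (f (x0, t0)) = (x0, t0)" using U' unfolding homeomorphism_def by auto
    then show ?thesis by (simp add: \<mu>_def f_def zero)
  qed
  show thesis
  proof (rule that[of e \<mu>, OF \<open>e > 0\<close> \<mu>0])
    have "continuous_on {t0 - e<..<t0 + e} \<mu>"
      using d(2) by (intro continuous_at_imp_continuous_on ballI DERIV_isCont)
    then have "continuous_on {t0 - e<..<t0 + e} (\<lambda>t. f (\<mu> t, t))" if "continuous_on U f" for f :: "real \<times> real \<Rightarrow> real"
      by (intro continuous_on_compose2[OF that]) (auto intro!: continuous_intros on)
    then show "\<mu> C1_differentiable_on {t0 - e<..<t0 + e}"
      using d unfolding C1_differentiable_on_def
      by (intro exI[of _ "\<lambda>t. - b (\<mu> t, t) / a (\<mu> t, t)"])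
        (auto intro!: continuous_intros cont simp: has_real_derivative_iff_has_vector_derivative)
    show "deriv \<mu> t0 = - b (x0, t0) / a (x0, t0)"
      using d(2)[OF t0] by (simp add: DERIV_imp_deriv \<mu>0)
  qed (use on in auto)
qed

section \<open>The bordered boundary value problem at a simple eigenvalue\<close>

lemma clinear_onD:
  assumes "clinear_on D f"
  shows "x \<in> D \<Longrightarrow> y \<in> D \<Longrightarrow> f (x + y) = f x + f y" and "x \<in> D \<Longrightarrow> f (a *\<^sub>C x) = a *\<^sub>C f x"
    and "x \<in> D \<Longrightarrow> f (r *\<^sub>R x) = r *\<^sub>R f x" and "x \<in> D \<Longrightarrow> f (- x) = - f x"
    and "x \<in> D \<Longrightarrow> f 0 = 0"
proof -
  show add: "x \<in> D \<Longrightarrow> y \<in> D \<Longrightarrow> f (x + y) = f x + f y" and sc: "x \<in> D \<Longrightarrow> f (a *\<^sub>C x) = a *\<^sub>C f x" for a x y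
    using assms by (auto simp: clinear_on_def)
  show R: "x \<in> D \<Longrightarrow> f (r *\<^sub>R x) = r *\<^sub>R f x" for r using sc[of x "of_real r"] by (simp add: scaleC_of_real)
  show "x \<in> D \<Longrightarrow> f (- x) = - f x" using R[of "-1"] by simp
  show "x \<in> D \<Longrightarrow> f 0 = 0" using R[of 0] by simp
qed

lemma clinear_on_diff:
  assumes "csubspace D" "clinear_on D f" "x \<in> D" "y \<in> D"
  shows "f (x - y) = f x - f y"
  using clinear_onD(1)[OF assms(2,3) csubspaceD(5)[OF assms(1,4)]] clinear_onD(4)[OF assms(2,4)] by simp

lemma norm_fst_le_norm: "norm (fst y) \<le> norm y" and norm_snd_le_norm: "norm (snd y) \<le> norm y"
  using norm_fst_le[of "fst y" "snd y"] norm_snd_le[of "snd y" "fst y"] by simp_all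

lemma calJ_eq: "calJ f = ((snd (fst f), - fst (fst f)), (- snd (snd f), fst (snd f)))"
  by (simp add: calJ_def Jmat_def)

lemma norm_calJ: "norm (calJ f) = norm f"
proof -
  have "inner (calJ f) (calJ f) = inner f f" by (simp add: calJ_eq inner_prod_def)
  then show ?thesis by (simp add: norm_eq_sqrt_inner)
qed

lemma bounded_bilinear_Omega: "bounded_bilinear (Omega :: 'k::chilbert_space pow4 \<Rightarrow> 'k pow4 \<Rightarrow> complex)"
proof -
  have "bounded_linear (calJ :: 'k pow4 \<Rightarrow> 'k pow4)"
    unfolding calJ_eq by (intro bounded_linear_intros bounded_linear_minus)
  then show ?thesis
    unfolding Omega_def by (rule bounded_bilinear.comp1[OF bounded_bilinear_cinner])
qed

global_interpretation Omega: bounded_bilinear "Omega :: 'k::chilbert_space pow4 \<Rightarrow> 'k pow4 \<Rightarrow> complex"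
  by (rule bounded_bilinear_Omega)

lemma Omega_eq:
  "Omega f g = cinner (snd (fst f)) (fst (fst g)) - cinner (fst (fst f)) (snd (fst g))
     - (cinner (snd (snd f)) (fst (snd g)) - cinner (fst (snd f)) (snd (snd g)))"
  by (simp add: Omega_def calJ_eq cinner_prod_def cinner_minus_left)

lemma Omega_skew: "Omega g f = - cnj (Omega f g)"
  unfolding Omega_eq by (simp add: cinner_commute[symmetric])

lemma Omega_scaleC_left: "Omega (a *\<^sub>C f) g = a * Omega f g"
  unfolding Omega_eq by (simp add: scaleC_prod_def cinner_scaleC_left algebra_simps)

lemma norm_Omega_le: "cmod (Omega f g) \<le> norm f * norm g"
  unfolding Omega_def using norm_cinner_le[of "calJ f" g] by (simp add: norm_calJ)

lemma Omega_calJ: "Omega (- calJ f) f = of_real ((norm f)\<^sup>2)"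
proof -
  have "calJ (- calJ f) = f" by (simp add: calJ_eq)
  then show ?thesis by (simp add: Omega_def cinner_self)
qed

text \<open>\<open>S\<close> is the maximal operator at the eigenvalue, formally symmetric up to the boundary term
  \<^term>\<open>Omega\<close>, and the boundary condition \<open>Pr (T w) = T w\<close> cuts out a self-adjoint restriction with
  closed range and one-dimensional kernel. The last assumption says both that a vector orthogonal
  to the range lies in the kernel and that the kernel is spanned by \<open>u\<close>.\<close>

locale simple_eigenvalue =
  fixes D :: "'x::chilbert_space set" and S :: "'x \<Rightarrow> 'x" and T :: "'x \<Rightarrow> 'k::chilbert_space pow4"
    and Pr :: "'k pow4 \<Rightarrow>\<^sub>L 'k pow4" and u :: 'x
  assumes D: "csubspace D" and S: "clinear_on D S" and T: "clinear_on D T"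
    and T_bounded: "\<exists>K. \<forall>w\<in>D. norm (T w) \<le> K * (norm w + norm (S w))"
    and T_onto: "T ` D = UNIV"
    and green: "\<And>w v. w \<in> D \<Longrightarrow> v \<in> D \<Longrightarrow> cinner (S w) v - cinner w (S v) = Omega (T w) (T v)"
    and Pr: "clinear_on UNIV Pr" "\<And>z. Pr (Pr z) = Pr z"
    and isotropic: "\<And>y z. Omega (Pr y) (Pr z) = 0"
    and u: "u \<in> D" "S u = 0" "Pr (T u) = T u" "T u \<noteq> 0"
    and closed_range: "closed {S w | w. w \<in> D \<and> Pr (T w) = T w}"
    and corange: "\<And>v. (\<And>w. w \<in> D \<Longrightarrow> Pr (T w) = T w \<Longrightarrow> cinner (S w) v = 0) \<Longrightarrow> \<exists>a. v = a *\<^sub>C u"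
begin

lemmas S_add = clinear_onD(1)[OF S] and S_scaleC = clinear_onD(2)[OF S]
  and S_scaleR = clinear_onD(3)[OF S]
  and S_diff = clinear_on_diff[OF D S]
lemmas T_add = clinear_onD(1)[OF T] and T_scaleC = clinear_onD(2)[OF T]
  and T_scaleR = clinear_onD(3)[OF T]
  and T_diff = clinear_on_diff[OF D T]
lemmas D_intros = csubspaceD[OF D]

lemma D_scaleR: "w \<in> D \<Longrightarrow> r *\<^sub>R w \<in> D"
  using D_intros(4)[of w "of_real r"] by (simp add: scaleC_of_real)

lemma S_zero: "S 0 = 0" and T_zero: "T 0 = 0"
  using clinear_onD(5)[OF S u(1)] clinear_onD(5)[OF T u(1)] by auto

lemma Pr_scaleC: "Pr (a *\<^sub>C z) = a *\<^sub>C Pr z"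
  by (rule clinear_onD(2)[OF Pr(1)]) simp

lemma norm_u: "norm u > 0"
  using u(4) T_zero by auto

lemma isotropic': "Pr y = y \<Longrightarrow> Pr z = z \<Longrightarrow> Omega y z = 0"
  using isotropic[of y z] by simp

lemma kernel:
  assumes "w \<in> D" "S w = 0" "Pr (T w) = T w"
  shows "\<exists>a. w = a *\<^sub>C u"
  using assms green[of _ w] isotropic' by (intro corange) auto

text \<open>The only multiple of \<open>u\<close> that can be added to \<open>fst y\<close> so that the problem with boundary data \<open>snd y\<close>
  becomes solvable: pair the equation with \<open>u\<close> and apply Green's identity.\<close>

definition coef :: "'x \<times> 'k pow4 \<Rightarrow> complex" where
  "coef y = (Omega (snd y) (T u) - cinner (fst y) u) / of_real ((norm u)\<^sup>2)"

lemma coef_mult: "coef y * of_real ((norm u)\<^sup>2) = Omega (snd y) (T u) - cinner (fst y) u"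
  using norm_u by (simp add: coef_def)

lemma bounded_linear_coef: "bounded_linear coef"
  unfolding coef_def
  by (intro bounded_linear_compose[OF bounded_linear_divide] bounded_linear_sub
      bounded_linear_compose[OF bounded_bilinear.bounded_linear_left[OF bounded_bilinear_Omega]]
      bounded_linear_compose[OF bounded_bilinear.bounded_linear_left[OF bounded_bilinear_cinner]]
      bounded_linear_fst bounded_linear_snd)

text \<open>By self-adjointness and closedness, the range of the restriction is the orthogonal complement
  of \<open>u\<close>; the multiple of \<open>u\<close> on the right-hand side moves the data into it.\<close>

lemma bordered_solvable:
  "\<exists>w\<in>D. Pr (T w - z) = T w - z \<and> cinner w u = 0 \<and> S w = h + coef (h, z) *\<^sub>C u"
proof -
  obtain w1 where w1: "w1 \<in> D" "T w1 = z" using T_onto by (metis UNIV_I imageE)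
  define g where "g = h + coef (h, z) *\<^sub>C u - S w1"
  have "cinner (S w1) u = Omega z (T u)" using green[OF w1(1) u(1)] w1 u by simp
  then have gu: "cinner g u = 0"
    using coef_mult[of "(h, z)"]
    by (simp add: g_def cinner_diff_left cinner_add_left cinner_scaleC_left cinner_self)
  define Ra where "Ra = {S w | w. w \<in> D \<and> Pr (T w) = T w}"
  have "csubspace Ra"
  proof (rule csubspaceI)
    show "0 \<in> Ra" unfolding Ra_def using D_intros(1) S_zero T_zero by (auto intro!: exI[of _ 0])
    fix x y a assume "x \<in> Ra"
    then obtain w where w: "x = S w" "w \<in> D" "Pr (T w) = T w" by (auto simp: Ra_def)
    show "a *\<^sub>C x \<in> Ra"
      unfolding Ra_def using w by (auto intro!: exI[of _ "a *\<^sub>C w"] D_intros simp: S_scaleC T_scaleC Pr_scaleC)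
    assume "y \<in> Ra"
    then obtain v where v: "y = S v" "v \<in> D" "Pr (T v) = T v" by (auto simp: Ra_def)
    show "x + y \<in> Ra"
      unfolding Ra_def using w v
      by (auto intro!: exI[of _ "w + v"] D_intros simp: S_add T_add blinfun.add_right)
  qed
  then obtain r where r: "r \<in> Ra" "g - r \<in> corth Ra"
    using orthogonal_decomposition[of Ra g] closed_range Ra_def by auto
  then obtain w2 where w2: "w2 \<in> D" "Pr (T w2) = T w2" "r = S w2" by (auto simp: Ra_def)
  have "cinner (S w) (g - r) = 0" if "w \<in> D" "Pr (T w) = T w" for w
  proof -
    have "cinner (g - r) (S w) = 0" using r(2) that by (auto simp: corth_def Ra_def)
    then show ?thesis by (subst cinner_commute) simp
  qed
  then obtain a where a: "g - r = a *\<^sub>C u" using corange by blast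
  have "cinner r u = 0" using green[OF w2(1) u(1)] isotropic'[OF w2(2) u(3)] w2 u by simp
  then have "a * of_real ((norm u)\<^sup>2) = 0"
    using a gu by (metis cinner_diff_left cinner_scaleC_left cinner_self diff_self)
  then have "g = S w2" using norm_u a w2 by simp
  define b where "b = cinner (w1 + w2) u / of_real ((norm u)\<^sup>2)"
  define w where "w = w1 + w2 - b *\<^sub>C u"
  show ?thesis
  proof (intro bexI[of _ w] conjI)
    show "w \<in> D" unfolding w_def by (intro D_intros w1 w2 u)
    have "T w - z = T w2 - b *\<^sub>C T u"
      using w1 w2 u by (simp add: w_def T_diff T_add T_scaleC D_intros)
    then show "Pr (T w - z) = T w - z"
      using w2 u by (simp add: blinfun.diff_right Pr_scaleC)
    show "cinner w u = 0"
      using norm_u by (simp add: w_def cinner_diff_left cinner_scaleC_left cinner_self b_def)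
    show "S w = h + coef (h, z) *\<^sub>C u"
      using w1 w2 u \<open>g = S w2\<close>[symmetric] by (simp add: w_def S_diff S_add S_scaleC D_intros g_def)
  qed
qed

definition sol :: "'x \<times> 'k pow4 \<Rightarrow> 'x" where
  "sol y = (SOME w. w \<in> D \<and> Pr (T w - snd y) = T w - snd y \<and> cinner w u = 0 \<and> S w = fst y + coef y *\<^sub>C u)"

lemma sol: "sol y \<in> D" "Pr (T (sol y) - snd y) = T (sol y) - snd y" "cinner (sol y) u = 0"
    "S (sol y) = fst y + coef y *\<^sub>C u"
  using someI_ex[of "\<lambda>w. w \<in> D \<and> Pr (T w - snd y) = T w - snd y \<and> cinner w u = 0 \<and> S w = fst y + coef y *\<^sub>C u"]
    bordered_solvable[of "snd y" "fst y"]
  by (auto simp: sol_def)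

lemma sol_unique:
  assumes w: "w \<in> D" "Pr (T w - snd y) = T w - snd y" "cinner w u = 0" "S w = fst y + a *\<^sub>C u"
  shows "w = sol y"
proof -
  define d where "d = w - sol y"
  have d: "d \<in> D" "cinner d u = 0" "S d = (a - coef y) *\<^sub>C u"
    unfolding d_def using w sol[of y]
    by (auto intro!: D_intros simp: cinner_diff_left S_diff complex_vector.scale_left_diff_distrib)
  have "T d = (T w - snd y) - (T (sol y) - snd y)"
    unfolding d_def using w sol[of y] by (simp add: T_diff)
  then have PT: "Pr (T d) = T d" using w(2) sol(2)[of y] by (metis blinfun.diff_right)
  have "(a - coef y) * of_real ((norm u)\<^sup>2) = 0"
    using green[OF d(1) u(1)] d u isotropic'[OF PT u(3)] by (simp add: cinner_scaleC_left cinner_self)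
  then have "S d = 0" using norm_u d by simp
  then obtain b where b: "d = b *\<^sub>C u" using kernel[OF d(1) _ PT] by blast
  then have "b * of_real ((norm u)\<^sup>2) = 0" using d by (simp add: cinner_scaleC_left cinner_self)
  then show ?thesis using b norm_u by (simp add: d_def)
qed

lemma sol_add: "sol (y + y') = sol y + sol y'"
proof (rule sol_unique[symmetric])
  interpret coef: bounded_linear coef by (rule bounded_linear_coef)
  have "T (sol y + sol y') - snd (y + y') = (T (sol y) - snd y) + (T (sol y') - snd y')"
    using sol by (simp add: T_add)
  then show "Pr (T (sol y + sol y') - snd (y + y')) = T (sol y + sol y') - snd (y + y')"
    by (simp only: blinfun.add_right sol)
  show "S (sol y + sol y') = fst (y + y') + coef (y + y') *\<^sub>C u"
    using sol by (simp add: S_add coef.add scaleC_add_left)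
qed (auto intro!: D_intros sol simp: cinner_add_left sol(3))

lemma sol_scaleR: "sol (r *\<^sub>R y) = r *\<^sub>R sol y"
proof (rule sol_unique[symmetric])
  interpret coef: bounded_linear coef by (rule bounded_linear_coef)
  have "T (r *\<^sub>R sol y) - snd (r *\<^sub>R y) = r *\<^sub>R (T (sol y) - snd y)"
    using sol by (simp add: T_scaleR scaleR_diff_right)
  then show "Pr (T (r *\<^sub>R sol y) - snd (r *\<^sub>R y)) = T (r *\<^sub>R sol y) - snd (r *\<^sub>R y)"
    by (simp only: blinfun.scaleR_right sol)
  show "S (r *\<^sub>R sol y) = fst (r *\<^sub>R y) + coef (r *\<^sub>R y) *\<^sub>C u"
    using sol unfolding coef.scaleR bounded_bilinear.scaleR_left[OF bounded_bilinear_scaleC]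
    by (simp add: S_scaleR scaleR_add_right)
qed (auto intro!: D_scaleR sol simp: cinner_scaleR_left sol(3))

text \<open>Green's identity exhibits an adjoint of the solution operator, hence every functional is
  bounded on the image of the unit ball, and the uniform boundedness principle applies.\<close>

lemma bounded_linear_sol: "bounded_linear sol"
proof -
  have "\<exists>C. \<forall>w\<in>sol ` cball 0 1. \<bar>inner w g\<bar> \<le> C" for g
  proof (intro exI ballI)
    fix w assume "w \<in> sol ` cball 0 1"
    then obtain y where y: "w = sol y" "norm y \<le> 1" by auto
    have y': "norm (fst y) \<le> 1" "norm (snd y) \<le> 1"
      using y(2) norm_fst_le_norm[of y] norm_snd_le_norm[of y] by linarith+
    define v where "v = sol (g, 0)"
    note w = sol[of y, folded y(1)] and v = sol[of "(g, 0)", folded v_def]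
    have wu: "cinner u v = 0" "cinner w u = 0"
      using v(3) w(3) by (auto simp: cinner_commute[of u v])
    have "cinner w g = cinner w (S v)"
      using v(4) wu by (simp add: cinner_add_right cinner_scaleC_right)
    also have "\<dots> = cinner (S w) v - Omega (T w) (T v)"
      by (simp add: green[OF w(1) v(1), symmetric])
    also have "cinner (S w) v = cinner (fst y) v"
      using w(4) wu by (simp add: cinner_add_left cinner_scaleC_left)
    also have "Omega (T w) (T v) = Omega (snd y) (T v)"
      using isotropic'[OF w(2), of "T v"] v(2) by (simp add: Omega.diff_left)
    finally have "cmod (cinner w g) \<le> cmod (cinner (fst y) v) + cmod (Omega (snd y) (T v))"
      by (simp add: norm_triangle_ineq4)
    also have "\<dots> \<le> norm (fst y) * norm v + norm (snd y) * norm (T v)"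
      by (intro add_mono norm_cinner_le norm_Omega_le)
    also have "\<dots> \<le> 1 * norm v + 1 * norm (T v)"
      by (intro add_mono mult_right_mono y') auto
    finally show "\<bar>inner w g\<bar> \<le> norm (sol (g, 0)) + norm (T (sol (g, 0)))"
      using abs_Re_le_cmod[of "cinner w g"] by (simp add: inner_eq_Re_cinner v_def)
  qed
  from weakly_bounded_imp_bounded[OF this]
  obtain C where C: "C \<ge> 0" "\<And>y. norm y \<le> 1 \<Longrightarrow> norm (sol y) \<le> C" by auto
  show ?thesis
  proof (rule bounded_linear_intro[where K = C])
    show "norm (sol y) \<le> norm y * C" for y
    proof (cases "y = 0")
      case True
      then show ?thesis using sol_scaleR[of 0 0] by simp
    next
      case False
      then have "norm (sol ((1 / norm y) *\<^sub>R y)) \<le> C" by (intro C) simp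
      then show ?thesis using False by (simp add: sol_scaleR divide_simps mult.commute)
    qed
  qed (rule sol_add sol_scaleR)+
qed

lemma sol_graph_bounded: "\<exists>C\<ge>0. \<forall>y. norm (sol y) + norm (S (sol y)) \<le> C * norm y"
proof -
  obtain K1 where K1: "\<And>y. norm (sol y) \<le> norm y * K1" "K1 \<ge> 0"
    using bounded_linear.nonneg_bounded[OF bounded_linear_sol] by blast
  obtain K2 where K2: "\<And>y. norm (coef y) \<le> norm y * K2" "K2 \<ge> 0"
    using bounded_linear.nonneg_bounded[OF bounded_linear_coef] by blast
  have "norm (sol y) + norm (S (sol y)) \<le> (K1 + 1 + K2 * norm u) * norm y" for y
  proof -
    have "norm (S (sol y)) \<le> norm (fst y) + cmod (coef y) * norm u"
      using norm_triangle_ineq[of "fst y" "coef y *\<^sub>C u"] by (simp add: sol(4) norm_scaleC)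
    also have "\<dots> \<le> norm y + norm y * K2 * norm u"
      by (intro add_mono mult_right_mono K2 norm_fst_le_norm) auto
    finally show ?thesis using K1(1)[of y] by (simp add: algebra_simps)
  qed
  then show ?thesis using K1 K2 by (intro exI[of _ "K1 + 1 + K2 * norm u"]) auto
qed

end

section \<open>The eigenvalue function of a family\<close>

text \<open>Continuous differentiability in the operator norm of maps \<open>(D, \<nu>) \<rightarrow> 'z\<close> with derivative \<open>T'\<close>. It is
  phrased by pointwise estimates relative to \<open>\<nu>\<close>, which can be composed with any map that is
  bounded from a normed space to \<open>(D, \<nu>)\<close> and which survive replacing \<open>\<nu>\<close> by an equivalent norm.\<close>

definition C1_family_on ::
    "'x::chilbert_space set \<Rightarrow> ('x \<Rightarrow> real) \<Rightarrow> real set \<Rightarrow> (real \<Rightarrow> 'x \<Rightarrow> 'z::chilbert_space) \<Rightarrow> (real \<Rightarrow> 'x \<Rightarrow> 'z) \<Rightarrow> bool"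
  where
  "C1_family_on D \<nu> J T T' \<longleftrightarrow>
     (\<forall>t\<in>J. bounded_clinear_on D \<nu> (T t) \<and> bounded_clinear_on D \<nu> (T' t)) \<and>
     (\<forall>t\<in>J. \<forall>e>0. \<exists>d>0. \<forall>s\<in>J. \<bar>s - t\<bar> < d \<longrightarrow> (\<forall>w\<in>D.
        norm (T s w - T t w - (s - t) *\<^sub>R T' t w) \<le> e * \<bar>s - t\<bar> * \<nu> w \<and>
        norm (T' s w - T' t w) \<le> e * \<nu> w))"

lemma C1_family_onD:
  assumes "C1_family_on D \<nu> J T T'" "t \<in> J"
  shows "bounded_clinear_on D \<nu> (T t)" "bounded_clinear_on D \<nu> (T' t)"
    and "e > 0 \<Longrightarrow> \<exists>d>0. \<forall>s\<in>J. \<bar>s - t\<bar> < d \<longrightarrow> (\<forall>w\<in>D.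
        norm (T s w - T t w - (s - t) *\<^sub>R T' t w) \<le> e * \<bar>s - t\<bar> * \<nu> w \<and>
        norm (T' s w - T' t w) \<le> e * \<nu> w)"
  using assms by (auto simp: C1_family_on_def)

lemma bounded_clinear_on_compose:
  assumes f: "bounded_clinear_on D \<nu> f" and R: "bounded_linear R"
    and RD: "\<And>y. R y \<in> D" and \<nu>: "\<And>y. 0 \<le> \<nu> (R y)" "\<And>y. \<nu> (R y) \<le> C * norm y"
  shows "bounded_linear (\<lambda>y. f (R y))"
proof -
  obtain K where lin: "clinear_on D f" and K: "\<And>x. x \<in> D \<Longrightarrow> norm (f x) \<le> K * \<nu> x"
    using f by (auto simp: bounded_clinear_on_def)
  interpret R: bounded_linear R by (rule R)
  show ?thesis
  proof (rule bounded_linear_intro[where K = "\<bar>K\<bar> * C"])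
    show "norm (f (R y)) \<le> norm y * (\<bar>K\<bar> * C)" for y
    proof -
      have "norm (f (R y)) \<le> K * \<nu> (R y)" by (rule K[OF RD])
      also have "\<dots> \<le> \<bar>K\<bar> * \<nu> (R y)" by (intro mult_right_mono \<nu>) auto
      also have "\<dots> \<le> \<bar>K\<bar> * (C * norm y)" by (intro mult_left_mono \<nu>) auto
      finally show ?thesis by (simp add: mult_ac)
    qed
  qed (auto simp: R.add R.scaleR clinear_onD[OF lin] RD)
qed

text \<open>Precomposition with an everywhere defined \<open>R\<close> turns the family into a curve in a space of bounded
  operators, to which the calculus of such curves applies.\<close>

lemma C1_family_on_compose:
  fixes R :: "'y::real_normed_vector \<Rightarrow> 'x::chilbert_space" and T T' :: "real \<Rightarrow> 'x \<Rightarrow> 'z::chilbert_space"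
  assumes T: "C1_family_on D \<nu> J T T'" and J: "open J" and R: "bounded_linear R"
    and RD: "\<And>y. R y \<in> D" and \<nu>: "\<And>y. 0 \<le> \<nu> (R y)" "\<And>y. \<nu> (R y) \<le> C * norm y"
  defines "B \<equiv> \<lambda>f. Blinfun (\<lambda>y. f (R y))"
  shows "\<And>t y. t \<in> J \<Longrightarrow> B (T t) y = T t (R y)" "\<And>t y. t \<in> J \<Longrightarrow> B (T' t) y = T' t (R y)"
    and "\<And>t. t \<in> J \<Longrightarrow> ((\<lambda>t. B (T t)) has_vector_derivative B (T' t)) (at t)"
    and "continuous_on J (\<lambda>t. B (T' t))"
proof -
  note D = C1_family_onD[OF T]
  show B: "\<And>t y. t \<in> J \<Longrightarrow> B (T t) y = T t (R y)" "\<And>t y. t \<in> J \<Longrightarrow> B (T' t) y = T' t (R y)"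
    unfolding B_def by (simp_all add: bounded_linear_Blinfun_apply bounded_clinear_on_compose[OF D(1) R RD \<nu>]
      bounded_clinear_on_compose[OF D(2) R RD \<nu>])
  define C' where "C' = \<bar>C\<bar> + 1"
  have C': "C' > 0" "\<nu> (R y) \<le> C' * norm y" for y
    using \<nu>(2)[of y] mult_right_mono[of C C' "norm y"] by (auto simp: C'_def intro: order_trans)
  have close: "\<exists>d>0. \<forall>s. \<bar>s - t\<bar> < d \<longrightarrow> s \<in> J \<and>
      norm (B (T s) - B (T t) - (s - t) *\<^sub>R B (T' t)) \<le> e * \<bar>s - t\<bar> \<and> norm (B (T' s) - B (T' t)) \<le> e"
    if t: "t \<in> J" and "e > 0" for t e
  proof -
    have "e / C' > 0" using that C' by simp
    from D(3)[OF t this] obtain d1 where "d1 > 0" and d1: "\<And>s w. s \<in> J \<Longrightarrow> \<bar>s - t\<bar> < d1 \<Longrightarrow> w \<in> D \<Longrightarrow>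
        norm (T s w - T t w - (s - t) *\<^sub>R T' t w) \<le> e / C' * \<bar>s - t\<bar> * \<nu> w \<and>
        norm (T' s w - T' t w) \<le> e / C' * \<nu> w" by blast
    obtain d2 where "d2 > 0" and d2: "\<And>s. \<bar>s - t\<bar> < d2 \<Longrightarrow> s \<in> J"
      using J t by (auto simp: open_dist dist_real_def)
    have "s \<in> J \<and> norm (B (T s) - B (T t) - (s - t) *\<^sub>R B (T' t)) \<le> e * \<bar>s - t\<bar> \<and> norm (B (T' s) - B (T' t)) \<le> e"
      if s: "\<bar>s - t\<bar> < min d1 d2" for s
    proof (intro conjI norm_blinfun_bound)
      show "s \<in> J" using d2 s by simp
      have *: "e / C' * r * \<nu> (R y) \<le> e * r * norm y" if "r \<ge> 0" for r y
      proof -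
        have "e / C' * r * \<nu> (R y) \<le> e / C' * r * (C' * norm y)"
          using that C' \<open>e > 0\<close> by (intro mult_left_mono C') auto
        then show ?thesis using C'(1) by (simp add: field_simps)
      qed
      show "norm ((B (T s) - B (T t) - (s - t) *\<^sub>R B (T' t)) y) \<le> e * \<bar>s - t\<bar> * norm y" for y
        using d1[OF \<open>s \<in> J\<close> _ RD[of y]] s *[of "\<bar>s - t\<bar>" y] by (simp add: blinfun.bilinear_simps B t \<open>s \<in> J\<close>)
      show "norm ((B (T' s) - B (T' t)) y) \<le> e * norm y" for y
        using d1[OF \<open>s \<in> J\<close> _ RD[of y]] s *[of 1 y] by (simp add: blinfun.bilinear_simps B t \<open>s \<in> J\<close>)
    qed (use \<open>e > 0\<close> in auto)
    then show ?thesis using \<open>d1 > 0\<close> \<open>d2 > 0\<close> by (intro exI[of _ "min d1 d2"]) auto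
  qed
  show "((\<lambda>t. B (T t)) has_vector_derivative B (T' t)) (at t)" if "t \<in> J" for t
    unfolding has_vector_derivative_def has_derivative_at_alt
    using close[OF that] by (auto intro: bounded_linear_scaleR_left) meson
  show "continuous_on J (\<lambda>t. B (T' t))"
  proof (intro continuous_at_imp_continuous_on ballI)
    fix t assume t: "t \<in> J"
    show "isCont (\<lambda>t. B (T' t)) t"
      unfolding continuous_at_eps_delta dist_norm
    proof (intro allI impI)
      fix e :: real assume "e > 0"
      then obtain d where "d > 0" "\<And>s. \<bar>s - t\<bar> < d \<Longrightarrow> norm (B (T' s) - B (T' t)) \<le> e / 2"
        using close[OF t, of "e / 2"] by auto
      then show "\<exists>d>0. \<forall>s. norm (s - t) < d \<longrightarrow> norm (B (T' s) - B (T' t)) < e"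
        using \<open>e > 0\<close> by (intro exI[of _ d]) force
    qed
  qed
qed

lemma C1_family_on_apply:
  fixes T T' :: "real \<Rightarrow> 'x::chilbert_space \<Rightarrow> 'z::chilbert_space"
  assumes T: "C1_family_on D \<nu> J T T'" and J: "open J" and D: "csubspace D" and w: "w \<in> D"
    and \<nu>: "\<And>r. \<nu> (r *\<^sub>R w) = \<bar>r\<bar> * C" "C \<ge> 0"
  shows "\<And>t. t \<in> J \<Longrightarrow> ((\<lambda>t. T t w) has_vector_derivative T' t w) (at t)"
    and "continuous_on J (\<lambda>t. T' t w)"
proof -
  have RD: "r *\<^sub>R w \<in> D" for r
    using csubspaceD(4)[OF D w, of "of_real r"] by (simp add: scaleC_of_real)
  note C = C1_family_on_compose[OF T J, where R = "\<lambda>r. r *\<^sub>R w" and C = C,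
      OF bounded_linear_scaleR_left RD, unfolded \<nu>, simplified]
  have bl: "bounded_linear (\<lambda>f. blinfun_apply f (1::real))" by (rule blinfun.bounded_linear_left)
  show "((\<lambda>t. T t w) has_vector_derivative T' t w) (at t)" if "t \<in> J" for t
  proof (rule has_vector_derivative_transform_within_open[OF _ J that])
    show "((\<lambda>t. Blinfun (\<lambda>r. T t (r *\<^sub>R w)) 1) has_vector_derivative T' t w) (at t)"
      using bounded_linear.has_vector_derivative[OF bl C(3)[OF _ that]] C(2)[OF _ that, of 1] \<nu>
      by (simp add: mult.commute)
    show "Blinfun (\<lambda>r. T s (r *\<^sub>R w)) 1 = T s w" if "s \<in> J" for s
      using C(1)[OF _ that, of 1] \<nu> by (simp add: mult.commute)
  qed
  have "continuous_on J (\<lambda>t. Blinfun (\<lambda>r. T' t (r *\<^sub>R w)) 1)"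
    using bounded_linear.continuous_on[OF bl C(4)] \<nu> by (simp add: mult.commute)
  then show "continuous_on J (\<lambda>t. T' t w)"
    by (rule continuous_on_eq) (use C(2)[of _ 1] \<nu> in \<open>simp add: mult.commute\<close>)
qed

lemma has_vector_derivative_blinfun_compose:
  assumes "(f has_vector_derivative f') (at t)" "(g has_vector_derivative g') (at t)"
  shows "((\<lambda>t. f t o\<^sub>L g t) has_vector_derivative ((f t o\<^sub>L g') + (f' o\<^sub>L g t))) (at t)"
  by (rule bounded_bilinear.has_vector_derivative[OF bounded_bilinear_blinfun_compose assms])

lemma has_vector_derivative_blinfun_apply:
  assumes "(f has_vector_derivative f') (at t)" "(g has_vector_derivative g') (at t)"
  shows "((\<lambda>t. blinfun_apply (f t) (g t)) has_vector_derivative (f t g' + f' (g t))) (at t)"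
  by (rule bounded_bilinear.has_vector_derivative[OF bounded_bilinear_blinfun_apply assms])

lift_definition inl_blinfun :: "'a::real_normed_vector \<Rightarrow>\<^sub>L ('a \<times> 'b::real_normed_vector)"
  is "\<lambda>x. (x, 0)" by (intro bounded_linear_intros)

lift_definition inr_blinfun :: "'b::real_normed_vector \<Rightarrow>\<^sub>L ('a::real_normed_vector \<times> 'b)"
  is "\<lambda>x. (0, x)" by (intro bounded_linear_intros)

declare inl_blinfun.rep_eq [simp] inr_blinfun.rep_eq [simp]

context simple_eigenvalue
begin

abbreviation graph_size :: "'x \<Rightarrow> real" where
  "graph_size w \<equiv> norm w + norm (S w)"

lemma graph_size_scaleR: "w \<in> D \<Longrightarrow> graph_size (r *\<^sub>R w) = \<bar>r\<bar> * graph_size w"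
  by (simp add: S_scaleR distrib_left)

text \<open>Normalizing a perturbed kernel vector by \<open>w = u + sol y\<close> and asking only that the residual be a
  multiple of \<open>u\<close> gives a uniquely solvable linear equation for the data \<open>y\<close>. The multiple is the
  eigenvalue function: it is real by symmetry and \<open>C\<^sup>1\<close> since the equation is.\<close>

lemma eigenvalue_function:
  fixes B B' :: "real \<Rightarrow> 'x \<Rightarrow>\<^sub>L 'x" and L :: "'x \<Rightarrow>\<^sub>L 'x"
    and Tr Tr' :: "real \<Rightarrow> 'x \<Rightarrow> 'k pow4" and Q Q' :: "real \<Rightarrow> 'k pow4 \<Rightarrow>\<^sub>L 'k pow4" and x0 t0 :: real
  assumes J: "open J" "t0 \<in> J"
    and B: "\<And>t. t \<in> J \<Longrightarrow> (B has_vector_derivative B' t) (at t)" "continuous_on J B'" "B t0 = 0"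
      "\<And>t v. t \<in> J \<Longrightarrow> cinner (B t v) v \<in> \<real>"
    and L: "\<And>v. cinner (L v) v \<in> \<real>"
    and Q: "\<And>t. t \<in> J \<Longrightarrow> (Q has_vector_derivative Q' t) (at t)" "continuous_on J Q'" "Q t0 = Pr"
      "\<And>t z. t \<in> J \<Longrightarrow> Q t (Q t z) = Q t z" "\<And>t y z. t \<in> J \<Longrightarrow> Omega (Q t y) (Q t z) = 0"
    and Tr: "C1_family_on D graph_size J Tr Tr'" "\<And>w. w \<in> D \<Longrightarrow> Tr t0 w = T w"
      "\<And>t w v. t \<in> J \<Longrightarrow> w \<in> D \<Longrightarrow> v \<in> D \<Longrightarrow> cinner (S w) v - cinner w (S v) = Omega (Tr t w) (Tr t v)"
  obtains U c a b where "open U" "(x0, t0) \<in> U" "U \<subseteq> UNIV \<times> J" "c (x0, t0) = (0::real)"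
    "\<And>p. p \<in> U \<Longrightarrow> (c has_derivative (\<lambda>(x, t). x * a p + t * b p)) (at p)"
    "continuous_on U a" "continuous_on U b"
    "of_real (a (x0, t0) * (norm u)\<^sup>2) = cinner (L u) u"
    "of_real (b (x0, t0) * (norm u)\<^sup>2) =
       cinner (B' t0 u) u - Omega (Tr' t0 u) (T u) + Omega (Q' t0 (T u)) (T u)"
    "\<And>x t. (x, t) \<in> U \<Longrightarrow> c (x, t) = 0 \<Longrightarrow>
       \<exists>w\<in>D. w \<noteq> 0 \<and> S w + B t w + (x - x0) *\<^sub>R L w = 0 \<and> Q t (Tr t w) = Tr t w"
proof -
  define R where "R = Blinfun sol"
  have R: "blinfun_apply R = sol" unfolding R_def by (rule bounded_linear_Blinfun_apply[OF bounded_linear_sol])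
  define X where "X t = Blinfun (\<lambda>y. Tr t (sol y))" for t
  define X' where "X' t = Blinfun (\<lambda>y. Tr' t (sol y))" for t
  obtain C where C: "\<And>y. graph_size (sol y) \<le> C * norm y" using sol_graph_bounded by blast
  note X = C1_family_on_compose[OF Tr(1) J(1) bounded_linear_sol sol(1) _ C, folded X_def X'_def, simplified]
  note Tru = C1_family_on_apply[OF Tr(1) J(1) D u(1) graph_size_scaleR[OF u(1)], simplified]
  \<comment> \<open>In terms of \<open>w = u + sol y\<close>, the first component of the equation \<open>y + N t y + \<dots> = 0\<close> says that the
    residual is \<open>coef y *\<^sub>C u\<close>, and \<open>E\<close> applied to the second one says that
    \<open>E ((id_blinfun - Q t) (Tr t w)) = 0\<close>.\<close>
  define E where "E = id_blinfun - Pr"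
  define N where "N t = (inl_blinfun o\<^sub>L (B t o\<^sub>L R))
      + (inr_blinfun o\<^sub>L (E o\<^sub>L (((id_blinfun - Q t) o\<^sub>L X t) - X t0)))" for t
  define N' where "N' t = (inl_blinfun o\<^sub>L (B' t o\<^sub>L R))
      + (inr_blinfun o\<^sub>L (E o\<^sub>L (((id_blinfun - Q t) o\<^sub>L X' t) - (Q' t o\<^sub>L X t))))" for t
  define k where "k t = inl_blinfun (B t u) + inr_blinfun (E ((id_blinfun - Q t) (Tr t u) - T u))" for t
  define k' where "k' t = inl_blinfun (B' t u)
      + inr_blinfun (E ((id_blinfun - Q t) (Tr' t u) - Q' t (Tr t u)))" for t
  have EPr: "E (Pr z) = 0" "E (E z) = E z" for z
    by (simp_all add: E_def blinfun.bilinear_simps Pr(2))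
  have const: "((\<lambda>t. A) has_vector_derivative 0) (at t)" for A :: "'z::real_normed_vector" and t :: real
    by simp
  have contX: "continuous_on J X" "continuous_on J (\<lambda>t. Tr t u)" "continuous_on J Q"
    using X(3) Tru(1) Q(1)
    by (auto intro!: continuous_at_imp_continuous_on has_vector_derivative_continuous)
  have dN: "(N has_vector_derivative N' t) (at t)" if "t \<in> J" for t
  proof -
    have "(N has_vector_derivative
        (((inl_blinfun o\<^sub>L ((B t o\<^sub>L 0) + (B' t o\<^sub>L R))) + (0 o\<^sub>L (B t o\<^sub>L R)))
        + ((inr_blinfun o\<^sub>L ((E o\<^sub>L ((((id_blinfun - Q t) o\<^sub>L X' t) + ((0 - Q' t) o\<^sub>L X t)) - 0))
              + (0 o\<^sub>L (((id_blinfun - Q t) o\<^sub>L X t) - X t0))))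
           + (0 o\<^sub>L (E o\<^sub>L (((id_blinfun - Q t) o\<^sub>L X t) - X t0)))))) (at t)"
      unfolding N_def
      by (intro has_vector_derivative_blinfun_compose has_vector_derivative_add
          has_vector_derivative_diff const B Q X that)
    then show ?thesis
      by (rule has_vector_derivative_eq_rhs)
        (auto intro!: blinfun_eqI simp: N'_def blinfun.bilinear_simps)
  qed
  have dk: "(k has_vector_derivative k' t) (at t)" if "t \<in> J" for t
  proof -
    have "(k has_vector_derivative
        ((inl_blinfun (B t 0 + B' t u) + blinfun_apply 0 (B t u))
        + (inr_blinfun (E (((id_blinfun - Q t) (Tr' t u) + (0 - Q' t) (Tr t u)) - 0)
              + blinfun_apply 0 ((id_blinfun - Q t) (Tr t u) - T u))
           + blinfun_apply 0 (E ((id_blinfun - Q t) (Tr t u) - T u))))) (at t)"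
      unfolding k_def
      by (intro has_vector_derivative_blinfun_apply has_vector_derivative_add
          has_vector_derivative_diff const B Q Tru that)
    then show ?thesis
      by (rule has_vector_derivative_eq_rhs) (simp add: k'_def blinfun.bilinear_simps)
  qed
  have cont': "continuous_on J N'" "continuous_on J k'"
    unfolding N'_def k'_def
    by (intro continuous_intros bounded_bilinear.continuous_on[OF bounded_bilinear_blinfun_compose]
        B Q X Tru contX)+
  have N0: "N t0 = 0"
    using Tr(2) J by (intro blinfun_eqI)
      (auto simp: N_def blinfun.bilinear_simps X(1) EPr Q(3) B(3) sol(1) zero_prod_def[symmetric])
  have k0: "k t0 = 0"
    using Tr(2)[OF u(1)] by (simp add: k_def blinfun.bilinear_simps EPr Q(3) B(3) zero_prod_def[symmetric])
  obtain U y a b where U: "open U" "(x0, t0) \<in> U" "U \<subseteq> UNIV \<times> J" "y (x0, t0) = 0"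
    and eq: "\<And>x t. (x, t) \<in> U \<Longrightarrow> y (x, t) + N t (y (x, t)) + (x - x0) *\<^sub>R (inl_blinfun o\<^sub>L (L o\<^sub>L R)) (y (x, t))
        + k t + (x - x0) *\<^sub>R inl_blinfun (L u) = 0"
    and dy: "\<And>p. p \<in> U \<Longrightarrow> (y has_derivative (\<lambda>(x, t). x *\<^sub>R a p + t *\<^sub>R b p)) (at p)"
    and ab: "continuous_on U a" "continuous_on U b" "a (x0, t0) = - inl_blinfun (L u)" "b (x0, t0) = - k' t0"
    by (rule affine_equation_C1_solution[OF J dN cont'(1) N0 dk cont'(2) k0,
          of x0 "inl_blinfun o\<^sub>L (L o\<^sub>L R)" "inl_blinfun (L u)"]) (assumption, assumption, rule that)
  \<comment> \<open>Closeness of the projections makes \<open>E\<close> injective on the range of \<open>id_blinfun - Q t\<close>.\<close>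
  define W where "W = U \<inter> (UNIV \<times> (J \<inter> (\<lambda>t. norm (Q t - Pr)) -` {..<1}))"
  have "open (J \<inter> (\<lambda>t. norm (Q t - Pr)) -` {..<1})"
    by (intro continuous_open_preimage J continuous_intros contX open_lessThan)
  then have W: "open W" "(x0, t0) \<in> W" "W \<subseteq> UNIV \<times> J" "W \<subseteq> U"
    unfolding W_def using U J Q(3) by (auto intro!: open_Int open_Times)
  define w where "w p = u + sol (y p)" for p
  have wD: "w p \<in> D" for p unfolding w_def by (intro D_intros u sol)
  have key: "S (w (x, t)) + B t (w (x, t)) + (x - x0) *\<^sub>R L (w (x, t)) = coef (y (x, t)) *\<^sub>C u"
      "Q t (Tr t (w (x, t))) = Tr t (w (x, t))" if p: "(x, t) \<in> W" for x t
  proof -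
    have t: "t \<in> J" "norm (Q t - Pr) < 1" using p by (auto simp: W_def)
    have "clinear_on D (Tr t)" using C1_family_onD(1)[OF Tr(1) t(1)] by (simp add: bounded_clinear_on_def)
    then have Trw: "Tr t (w (x, t)) = Tr t u + Tr t (sol (y (x, t)))"
      unfolding w_def using u(1) sol(1) by (rule clinear_onD(1))
    have "fst (y (x, t)) + B t (sol (y (x, t))) + (x - x0) *\<^sub>R L (sol (y (x, t))) + B t u + (x - x0) *\<^sub>R L u = 0"
      using arg_cong[OF eq[OF subsetD[OF W(4) p]], of fst] t
      by (simp add: N_def k_def blinfun.bilinear_simps R)
    then show "S (w (x, t)) + B t (w (x, t)) + (x - x0) *\<^sub>R L (w (x, t)) = coef (y (x, t)) *\<^sub>C u"
      using u sol by (simp add: w_def S_add blinfun.add_right scaleR_add_right algebra_simps)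
    have "snd (y (x, t)) + E ((id_blinfun - Q t) (Tr t (sol (y (x, t)))) - T (sol (y (x, t))))
        + E ((id_blinfun - Q t) (Tr t u) - T u) = 0"
      using arg_cong[OF eq[OF subsetD[OF W(4) p]], of snd] t J Tr(2) sol
      by (simp add: N_def k_def blinfun.bilinear_simps R X(1))
    from arg_cong[OF this, of E]
    have "E (snd (y (x, t)) - T (sol (y (x, t)))) - E (T u) + E ((id_blinfun - Q t) (Tr t (w (x, t)))) = 0"
      by (simp add: blinfun.bilinear_simps EPr Trw algebra_simps)
    moreover have "E (snd (y (x, t)) - T (sol (y (x, t)))) = 0"
      using sol(2)[of "y (x, t)"] by (simp add: E_def blinfun.bilinear_simps algebra_simps)
    moreover have "E (T u) = 0" using u by (simp add: E_def blinfun.bilinear_simps)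
    ultimately have E0: "E ((id_blinfun - Q t) (Tr t (w (x, t)))) = 0" by simp
    define z where "z = (id_blinfun - Q t) (Tr t (w (x, t)))"
    have "Q t z = 0" using Q(4)[OF t(1)] by (simp add: z_def blinfun.bilinear_simps)
    moreover have "Pr z = z" using E0 unfolding z_def[symmetric] by (simp add: E_def blinfun.diff_left)
    ultimately have "z = - ((Q t - Pr) z)" by (simp add: blinfun.diff_left)
    then have "norm z \<le> norm (Q t - Pr) * norm z" by (metis norm_blinfun norm_minus_cancel)
    then have "z = 0"
      using mult_strict_right_mono[OF t(2), of "norm z"] by (cases "z = 0") auto
    then show "Q t (Tr t (w (x, t))) = Tr t (w (x, t))" by (simp add: z_def blinfun.bilinear_simps)
  qed
  have wu: "cinner u (w p) = of_real ((norm u)\<^sup>2)" for p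
    using sol(3)[of "y p"] by (simp add: w_def cinner_add_right cinner_self) (metis cinner_commute complex_cnj_zero_iff)
  have real: "Im (coef (y p)) = 0" if p: "p \<in> W" for p
  proof -
    obtain x t where xt: "p = (x, t)" by (cases p)
    have t: "t \<in> J" using p xt W by auto
    have "cinner (S (w p)) (w p) - cinner (w p) (S (w p)) = 0"
      using Tr(3)[OF t wD wD] Q(5)[OF t] key(2)[of x t] p xt by metis
    then have "cinner (S (w p)) (w p) \<in> \<real>"
      by (metis cinner_commute eq_iff_diff_eq_0 Reals_cnj_iff)
    then have "cinner (S (w p) + B t (w p) + (x - x0) *\<^sub>R L (w p)) (w p) \<in> \<real>"
      using B(4)[OF t] L by (simp add: cinner_add_left cinner_scaleR_left)
    then have "coef (y p) * of_real ((norm u)\<^sup>2) \<in> \<real>"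
      using key(1)[of x t] p xt by (simp add: cinner_scaleC_left wu)
    then show ?thesis using norm_u by (simp add: complex_is_Real_iff)
  qed
  interpret coef: bounded_linear coef by (rule bounded_linear_coef)
  have dcoef: "((\<lambda>p. coef (y p)) has_derivative (\<lambda>(x, t). x *\<^sub>R coef (a p) + t *\<^sub>R coef (b p))) (at p)"
    if "p \<in> W" for p
    using coef.has_derivative[OF dy[OF subsetD[OF W(4) that]]]
    by (simp add: coef.add coef.scaleR case_prod_unfold)
  have Im0: "Im (coef (a p)) = 0" "Im (coef (b p)) = 0" if p: "p \<in> W" for p
  proof -
    have "((\<lambda>p. Im (coef (y p))) has_derivative (\<lambda>h. Im ((\<lambda>(x, t). x *\<^sub>R coef (a p) + t *\<^sub>R coef (b p)) h))) (at p)"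
      by (rule bounded_linear.has_derivative[OF bounded_linear_Im dcoef[OF p]])
    moreover have "((\<lambda>p. Im (coef (y p))) has_derivative (\<lambda>h. 0)) (at p)"
      by (rule has_derivative_transform_within_open[OF has_derivative_const W(1) p]) (simp add: real)
    ultimately have *: "(\<lambda>h. Im ((\<lambda>(x, t). x *\<^sub>R coef (a p) + t *\<^sub>R coef (b p)) h)) = (\<lambda>h. 0)"
      by (rule has_derivative_unique)
    show "Im (coef (a p)) = 0" "Im (coef (b p)) = 0"
      using fun_cong[OF *, of "(1, 0)"] fun_cong[OF *, of "(0, 1)"] by simp_all
  qed
  show thesis
  proof (rule that[of W "\<lambda>p. Re (coef (y p))" "\<lambda>p. Re (coef (a p))" "\<lambda>p. Re (coef (b p))"])
    show "Re (coef (y (x0, t0))) = 0" using U(4) by (simp add: coef.zero)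
    show "((\<lambda>p. Re (coef (y p))) has_derivative (\<lambda>(x, t). x * Re (coef (a p)) + t * Re (coef (b p)))) (at p)"
      if "p \<in> W" for p
      using bounded_linear.has_derivative[OF bounded_linear_Re dcoef[OF that]]
      by (simp add: case_prod_unfold)
    show "continuous_on W (\<lambda>p. Re (coef (a p)))" "continuous_on W (\<lambda>p. Re (coef (b p)))"
      by (intro continuous_intros coef.continuous_on continuous_on_subset[OF _ W(4)] ab)+
    have "of_real (Re (coef (a (x0, t0))) * (norm u)\<^sup>2) = coef (a (x0, t0)) * of_real ((norm u)\<^sup>2)"
      using Im0[OF W(2)] by (simp add: complex_eq_iff)
    also have "\<dots> = cinner (L u) u"
      by (simp add: coef_mult ab Omega.zero_left cinner_minus_left del: of_real_power)
    finally show "of_real (Re (coef (a (x0, t0))) * (norm u)\<^sup>2) = cinner (L u) u" .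
    have "of_real (Re (coef (b (x0, t0))) * (norm u)\<^sup>2) = coef (b (x0, t0)) * of_real ((norm u)\<^sup>2)"
      using Im0[OF W(2)] by (simp add: complex_eq_iff)
    also have "\<dots> = cinner (B' t0 u) u - Omega (E ((id_blinfun - Pr) (Tr' t0 u) - Q' t0 (T u))) (T u)"
      by (simp add: coef_mult ab cinner_minus_left k'_def Q(3) Tr(2)[OF u(1)]
          Omega.minus_left del: of_real_power)
    also have "Omega (E ((id_blinfun - Pr) (Tr' t0 u) - Q' t0 (T u))) (T u)
        = Omega (Tr' t0 u) (T u) - Omega (Q' t0 (T u)) (T u)"
    proof -
      have "Omega (Pr z) (T u) = 0" for z using isotropic'[of "Pr z" "T u"] Pr(2) u by simp
      then show ?thesis by (simp add: E_def blinfun.bilinear_simps Omega.diff_left)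
    qed
    finally show "of_real (Re (coef (b (x0, t0))) * (norm u)\<^sup>2) =
       cinner (B' t0 u) u - Omega (Tr' t0 u) (T u) + Omega (Q' t0 (T u)) (T u)" by simp
    show "\<exists>w\<in>D. w \<noteq> 0 \<and> S w + B t w + (x - x0) *\<^sub>R L w = 0 \<and> Q t (Tr t w) = Tr t w"
      if p: "(x, t) \<in> W" and "Re (coef (y (x, t))) = 0" for x t
    proof (intro bexI[of _ "w (x, t)"] conjI wD)
      have "coef (y (x, t)) = 0" using that real[OF p] by (simp add: complex_eq_iff)
      then show "S (w (x, t)) + B t (w (x, t)) + (x - x0) *\<^sub>R L (w (x, t)) = 0" using key(1)[OF p] by simp
      show "w (x, t) \<noteq> 0" using wu[of "(x, t)"] norm_u by auto
      show "Q t (Tr t (w (x, t))) = Tr t (w (x, t))" by (rule key(2)[OF p])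
    qed
  qed (use W in auto)
qed

end

section \<open>Crossing forms\<close>

lemma bounded_bilinear_Omega_tilde:
  "bounded_bilinear (Omega_tilde :: 'k::chilbert_space pow4 \<times> 'k pow4 \<Rightarrow> _ \<Rightarrow> complex)"
  unfolding Omega_tilde_def
proof
  show "\<exists>K. \<forall>a b :: 'k pow4 \<times> 'k pow4. norm (Omega (fst a) (fst b) - Omega (snd a) (snd b)) \<le> norm a * norm b * K"
  proof (intro exI allI)
    fix a b :: "'k pow4 \<times> 'k pow4"
    have "norm (Omega (fst a) (fst b) - Omega (snd a) (snd b))
        \<le> norm (fst a) * norm (fst b) + norm (snd a) * norm (snd b)"
      by (intro order_trans[OF norm_triangle_ineq4] add_mono norm_Omega_le)
    also have "\<dots> \<le> norm a * norm b + norm a * norm b"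
      by (intro add_mono mult_mono norm_fst_le_norm norm_snd_le_norm) auto
    finally show "norm (Omega (fst a) (fst b) - Omega (snd a) (snd b)) \<le> norm a * norm b * 2" by simp
  qed
qed (auto simp: Omega.add_left Omega.add_right Omega.scaleR_left Omega.scaleR_right scaleR_diff_right)

global_interpretation Omega_tilde: bounded_bilinear "Omega_tilde :: 'k::chilbert_space pow4 \<times> 'k pow4 \<Rightarrow> _ \<Rightarrow> complex"
  by (rule bounded_bilinear_Omega_tilde)

lemma quadratic_bound_derivative:
  fixes f :: "real \<Rightarrow> 'a::real_normed_vector"
  assumes "r > 0" and "\<And>s. \<bar>s - t\<bar> < r \<Longrightarrow> norm (f s) \<le> K * \<bar>s - t\<bar>\<^sup>2"
  shows "(f has_vector_derivative 0) (at t)"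
  unfolding has_vector_derivative_def
proof (rule has_derivativeI_sandwich[where e = r and H = "\<lambda>s. K * \<bar>s - t\<bar>"])
  have "f t = 0" using assms(2)[of t] \<open>r > 0\<close> by simp
  then show "norm (f s - f t - (s - t) *\<^sub>R 0) / norm (s - t) \<le> K * \<bar>s - t\<bar>" if "s \<noteq> t" "dist s t < r" for s
    using assms(2)[of s] that by (simp add: dist_real_def divide_le_eq power2_eq_square mult.assoc)
  have "((\<lambda>s. K * \<bar>s - t\<bar>) \<longlongrightarrow> K * \<bar>t - t\<bar>) (at t)" by (intro tendsto_intros)
  then show "((\<lambda>s. K * \<bar>s - t\<bar>) \<longlongrightarrow> 0) (at t)" by simp
qed (use \<open>r > 0\<close> in auto)

lemma has_vector_derivative_Lipschitz_at:
  assumes "(f has_vector_derivative f') (at t)"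
  shows "\<exists>d>0. \<forall>s. \<bar>s - t\<bar> < d \<longrightarrow> norm (f s - f t) \<le> (norm f' + 1) * \<bar>s - t\<bar>"
proof -
  obtain d where "d > 0" and d: "\<And>s. \<bar>s - t\<bar> < d \<Longrightarrow> norm (f s - f t - (s - t) *\<^sub>R f') \<le> 1 * \<bar>s - t\<bar>"
    using assms unfolding has_vector_derivative_def has_derivative_at_alt
    by (metis real_norm_def zero_less_one)
  have "norm (f s - f t) \<le> (norm f' + 1) * \<bar>s - t\<bar>" if "\<bar>s - t\<bar> < d" for s
  proof -
    have "norm (f s - f t) = norm ((f s - f t - (s - t) *\<^sub>R f') + (s - t) *\<^sub>R f')" by simp
    also have "\<dots> \<le> 1 * \<bar>s - t\<bar> + \<bar>s - t\<bar> * norm f'"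
      by (intro order_trans[OF norm_triangle_ineq] add_mono d that) simp
    finally show ?thesis by (simp add: algebra_simps)
  qed
  then show ?thesis using \<open>d > 0\<close> by blast
qed

text \<open>If the subspaces are images of the initial one under maps \<open>\<Lambda> s\<close> close to the identity, the
  graph map at \<open>q\<close> is \<open>\<Lambda> s k - q\<close> for the vector \<open>k\<close> that makes it orthogonal, found by a
  contraction. Replacing \<open>k\<close> by \<open>q\<close> changes the form to second order only, because the initial
  subspace is isotropic.\<close>

lemma crossing_form_eq_derivative:
  fixes Y :: "real \<Rightarrow> ('k::chilbert_space pow4 \<times> 'k pow4) set"
  assumes Y0: "csubspace (Y s0)" "closed (Y s0)"
    and iso: "\<And>p q. p \<in> Y s0 \<Longrightarrow> q \<in> Y s0 \<Longrightarrow> Omega_tilde p q = 0"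
    and q: "q \<in> Y s0" and "r > 0"
    and Y: "\<And>s. \<bar>s - s0\<bar> < r \<Longrightarrow> Y s = \<Lambda> s ` Y s0"
    and diff: "\<And>s x y. \<bar>s - s0\<bar> < r \<Longrightarrow> x \<in> Y s0 \<Longrightarrow> y \<in> Y s0 \<Longrightarrow> \<Lambda> s (x - y) = \<Lambda> s x - \<Lambda> s y"
    and near: "\<And>s y. \<bar>s - s0\<bar> < r \<Longrightarrow> y \<in> Y s0 \<Longrightarrow> norm (\<Lambda> s y - y) \<le> C * \<bar>s - s0\<bar> * norm y"
    and der: "((\<lambda>s. Omega_tilde q (\<Lambda> s q)) has_vector_derivative d) (at s0)"
  shows "crossing_form Y s0 q q = d"
proof -
  have "\<exists>y\<in>Y s0. x - y \<in> corth (Y s0)" for x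
    using orthogonal_decomposition[OF Y0, of x] by blast
  then obtain pj where pj: "\<And>x. pj x \<in> Y s0" "\<And>x. x - pj x \<in> corth (Y s0)" by metis
  have contr: "norm (pj x - pj y) \<le> norm (x - y)" for x y
  proof -
    let ?p = "pj x - pj y"
    have p: "?p \<in> Y s0" by (intro csubspaceD[OF Y0(1)] pj)
    have "cinner ((x - y) - ?p) ?p = cinner (x - pj x) ?p - cinner (y - pj y) ?p"
      by (simp add: cinner_diff_left)
    also have "\<dots> = 0" using pj(2) p by (simp add: corth_def)
    finally have "of_real ((norm ?p)\<^sup>2) = cinner (x - y) ?p"
      by (simp add: cinner_diff_left[of "x - y"] cinner_self del: of_real_power)
    then have "(norm ?p)\<^sup>2 = cmod (cinner (x - y) ?p)" by (metis norm_of_real abs_power2)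
    also have "\<dots> \<le> norm (x - y) * norm ?p" by (rule norm_cinner_le)
    finally show ?thesis by (cases "norm ?p = 0") (auto simp: power2_eq_square)
  qed
  have pj0: "pj 0 = 0"
  proof -
    have "cinner (0 - pj 0) (pj 0) = 0" using pj(1)[of 0] pj(2)[of 0] by (simp add: corth_def)
    then show ?thesis by (simp add: cinner_minus_left cinner_self)
  qed
  define C' where "C' = \<bar>C\<bar> + 1"
  define \<rho> where "\<rho> = min r (1 / (2 * C'))"
  have "C' > 0" "\<rho> > 0" using \<open>r > 0\<close> by (auto simp: C'_def \<rho>_def)
  have near': "norm (\<Lambda> s y - y) \<le> C' * \<bar>s - s0\<bar> * norm y" "norm (\<Lambda> s y - y) \<le> 1 / 2 * norm y"
    if s: "\<bar>s - s0\<bar> < \<rho>" and y: "y \<in> Y s0" for s y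
  proof -
    have "norm (\<Lambda> s y - y) \<le> C * \<bar>s - s0\<bar> * norm y" using near s y by (simp add: \<rho>_def)
    also have "\<dots> \<le> C' * \<bar>s - s0\<bar> * norm y" by (intro mult_right_mono) (auto simp: C'_def)
    finally show *: "norm (\<Lambda> s y - y) \<le> C' * \<bar>s - s0\<bar> * norm y" .
    have "C' * \<bar>s - s0\<bar> \<le> 1 / 2" using s \<open>C' > 0\<close> by (simp add: \<rho>_def field_simps)
    then show "norm (\<Lambda> s y - y) \<le> 1 / 2 * norm y"
      using * by (meson mult_right_mono norm_ge_zero order_trans)
  qed
  have "\<exists>k\<in>Y s0. q + pj (k - \<Lambda> s k) = k" if s: "\<bar>s - s0\<bar> < \<rho>" for s
  proof -
    have "\<exists>!k\<in>Y s0. q + pj (k - \<Lambda> s k) = k"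
    proof (rule Banach_fix[where c = "1 / 2"])
      show "complete (Y s0)" using Y0(2) by (simp add: complete_eq_closed)
      show "Y s0 \<noteq> {}" using q by auto
      show "(\<lambda>k. q + pj (k - \<Lambda> s k)) ` Y s0 \<subseteq> Y s0"
        by (intro image_subsetI csubspaceD(2)[OF Y0(1) q pj(1)])
      fix x y assume xy: "x \<in> Y s0" "y \<in> Y s0"
      have "dist (q + pj (x - \<Lambda> s x)) (q + pj (y - \<Lambda> s y)) \<le> norm ((x - \<Lambda> s x) - (y - \<Lambda> s y))"
        using contr[of "x - \<Lambda> s x" "y - \<Lambda> s y"] by (simp add: dist_norm)
      also have "(x - \<Lambda> s x) - (y - \<Lambda> s y) = - (\<Lambda> s (x - y) - (x - y))"
        using diff[of s x y] xy s by (simp add: \<rho>_def)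
      also have "norm \<dots> \<le> 1 / 2 * dist x y"
        unfolding norm_minus_cancel dist_norm by (intro near' s csubspaceD[OF Y0(1)] xy)
      finally show "dist (q + pj (x - \<Lambda> s x)) (q + pj (y - \<Lambda> s y)) \<le> 1 / 2 * dist x y" .
    qed auto
    then show ?thesis by blast
  qed
  then obtain k where k: "\<And>s. \<bar>s - s0\<bar> < \<rho> \<Longrightarrow> k s \<in> Y s0"
      "\<And>s. \<bar>s - s0\<bar> < \<rho> \<Longrightarrow> q + pj (k s - \<Lambda> s (k s)) = k s" by metis
  have gm: "graph_map (Y s0) (Y s) q = \<Lambda> s (k s) - q" if s: "\<bar>s - s0\<bar> < \<rho>" for s
    unfolding graph_map_def
  proof (rule the_equality)
    have sr: "\<bar>s - s0\<bar> < r" using s by (simp add: \<rho>_def)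
    have eq: "\<Lambda> s (k s) - q = - ((k s - \<Lambda> s (k s)) - pj (k s - \<Lambda> s (k s)))"
      using k(2)[OF s] by (simp add: algebra_simps)
    have orth: "\<Lambda> s (k s) - q \<in> corth (Y s0)"
      unfolding eq using pj(2)[of "k s - \<Lambda> s (k s)"] by (simp add: corth_def cinner_minus_left del: minus_diff_eq)
    show "\<Lambda> s (k s) - q \<in> corth (Y s0) \<and> q + (\<Lambda> s (k s) - q) \<in> Y s"
      using orth Y[OF sr] k(1)[OF s] by simp
    fix v assume v: "v \<in> corth (Y s0) \<and> q + v \<in> Y s"
    then obtain k' where k': "k' \<in> Y s0" "q + v = \<Lambda> s k'" using Y[OF sr] by auto
    define x where "x = k' - k s"
    have x: "x \<in> Y s0" unfolding x_def by (intro csubspaceD[OF Y0(1)] k' k s)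
    have "\<Lambda> s x = v - (\<Lambda> s (k s) - q)"
      unfolding x_def diff[OF sr k'(1) k(1)[OF s]] using k'(2)[symmetric] by simp
    then have "cinner (\<Lambda> s x) x = 0" using v orth x by (simp add: corth_def cinner_diff_left)
    then have "of_real ((norm x)\<^sup>2) = - cinner (\<Lambda> s x - x) x"
      by (simp add: cinner_diff_left cinner_self)
    then have "(norm x)\<^sup>2 = cmod (cinner (\<Lambda> s x - x) x)" by (metis norm_of_real abs_power2 norm_minus_cancel)
    also have "\<dots> \<le> norm (\<Lambda> s x - x) * norm x" by (rule norm_cinner_le)
    also have "\<dots> \<le> 1 / 2 * norm x * norm x" by (intro mult_right_mono near' s x) auto
    finally have "x = 0" by (simp add: power2_eq_square mult_le_0_iff)
    then show "v = \<Lambda> s (k s) - q" using k'(2) by (simp add: x_def algebra_simps)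
  qed
  define e where "e s = Omega_tilde q (graph_map (Y s0) (Y s) q) - Omega_tilde q (\<Lambda> s q)" for s
  obtain M where M: "\<And>a b :: 'k pow4 \<times> 'k pow4. norm (Omega_tilde a b) \<le> norm a * norm b * M" "M > 0"
    using Omega_tilde.pos_bounded by blast
  have "norm (e s) \<le> (norm q * (C' * (C' * 2 * norm q)) * M) * \<bar>s - s0\<bar>\<^sup>2" if s: "\<bar>s - s0\<bar> < \<rho>" for s
  proof -
    have sr: "\<bar>s - s0\<bar> < r" using s by (simp add: \<rho>_def)
    let ?k = "k s" and ?x = "k s - q"
    have x: "?x \<in> Y s0" by (intro csubspaceD[OF Y0(1)] k s q)
    have "norm ?x = norm (pj (?k - \<Lambda> s ?k) - pj 0)"
      using k(2)[OF s] pj0 by (metis add_diff_cancel_left' diff_zero)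
    then have xk: "norm ?x \<le> norm (\<Lambda> s ?k - ?k)"
      using contr[of "?k - \<Lambda> s ?k" 0] by (simp add: norm_minus_commute)
    have "norm ?k \<le> norm q + norm ?x" using norm_triangle_ineq[of q ?x] by simp
    also have "norm ?x \<le> 1 / 2 * norm ?k" using xk near'(2)[OF s k(1)[OF s]] by simp
    finally have k2: "norm ?k \<le> 2 * norm q" by simp
    have "norm ?x \<le> C' * \<bar>s - s0\<bar> * norm ?k" using xk near'(1)[OF s k(1)[OF s]] by simp
    also have "\<dots> \<le> C' * \<bar>s - s0\<bar> * (2 * norm q)"
      using \<open>C' > 0\<close> by (intro mult_left_mono k2) auto
    finally have nx: "norm ?x \<le> C' * \<bar>s - s0\<bar> * (2 * norm q)" .
    have "e s = Omega_tilde q (\<Lambda> s ?x)"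
      unfolding e_def gm[OF s] diff[OF sr k(1)[OF s] q]
      by (simp add: Omega_tilde.diff_right iso[OF q q])
    also have "\<dots> = Omega_tilde q (\<Lambda> s ?x - ?x)" by (simp add: Omega_tilde.diff_right[of q "\<Lambda> s ?x"] iso[OF q x])
    finally have "norm (e s) \<le> norm q * norm (\<Lambda> s ?x - ?x) * M" by (simp add: M(1))
    also have "\<dots> \<le> norm q * (C' * \<bar>s - s0\<bar> * (C' * \<bar>s - s0\<bar> * (2 * norm q))) * M"
      using M(2) \<open>C' > 0\<close>
      by (intro mult_right_mono mult_left_mono order_trans[OF near'(1)[OF s x]] nx) auto
    also have "\<dots> = (norm q * (C' * (C' * 2 * norm q)) * M) * \<bar>s - s0\<bar>\<^sup>2"
      by (simp only: power2_eq_square mult_ac)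
    finally show ?thesis .
  qed
  from quadratic_bound_derivative[OF \<open>\<rho> > 0\<close> this]
  have "((\<lambda>s. Omega_tilde q (\<Lambda> s q) + e s) has_vector_derivative (d + 0)) (at s0)"
    by (intro has_vector_derivative_add der)
  then show ?thesis
    unfolding crossing_form_def e_def by (intro vector_derivative_at) simp
qed

context simple_eigenvalue
begin

lemma T_graph_bounded: "bounded_clinear_on D graph_size T"
  using T T_bounded by (auto simp: bounded_clinear_on_def)

lemma bounded_linear_T_sol: "bounded_linear (\<lambda>y. T (sol y))"
proof -
  obtain C where "\<And>y. graph_size (sol y) \<le> C * norm y" using sol_graph_bounded by blast
  then show ?thesis
    by (intro bounded_clinear_on_compose[OF T_graph_bounded bounded_linear_sol sol(1)]) auto
qed

text \<open>The kernel of the maximal operator: its traces are the first factor of the subspaces whose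
  crossings are studied.\<close>

definition kern :: "'x set" where
  "kern = {w \<in> D. S w = 0}"

lemma kern_intros:
  "w \<in> kern \<Longrightarrow> v \<in> kern \<Longrightarrow> w - v \<in> kern" "w \<in> kern \<Longrightarrow> v \<in> kern \<Longrightarrow> w + v \<in> kern"
  "w \<in> kern \<Longrightarrow> a *\<^sub>C w \<in> kern" "u \<in> kern" "0 \<in> kern"
  using u S_zero by (auto simp: kern_def intro!: D_intros simp: S_diff S_add S_scaleC)

lemma sol_of_kern:
  assumes "w \<in> kern"
  shows "sol (0, T w) = w - (cinner w u / of_real ((norm u)\<^sup>2)) *\<^sub>C u" and "coef (0, T w) = 0"
proof -
  let ?v = "w - (cinner w u / of_real ((norm u)\<^sup>2)) *\<^sub>C u"
  have w: "w \<in> D" "S w = 0" using assms by (auto simp: kern_def)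
  have v: "?v \<in> D" by (intro D_intros w u)
  have "T ?v - T w = - ((cinner w u / of_real ((norm u)\<^sup>2)) *\<^sub>C T u)"
    using w u by (simp add: T_diff T_scaleC D_intros)
  moreover have "S ?v = 0" using w u by (simp add: S_diff S_scaleC D_intros)
  ultimately show eq: "sol (0, T w) = ?v"
    using v u norm_u
    by (intro sol_unique[where a = 0, symmetric])
      (auto simp: blinfun.minus_right Pr_scaleC cinner_diff_left cinner_scaleC_left cinner_self)
  have "coef (0, T w) *\<^sub>C u = 0" using sol(4)[of "(0, T w)"] eq \<open>S ?v = 0\<close> by simp
  then show "coef (0, T w) = 0" using norm_u by (metis norm_scaleC mult_eq_0_iff norm_eq_zero less_irrefl)
qed

text \<open>A kernel vector is recovered from its boundary value up to a multiple of \<open>u\<close> by the solution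
  operator. This describes the traces of the kernel by closed conditions.\<close>

lemma T_kern_eq:
  "T ` kern = {z. coef (0, z) = 0 \<and>
     z - T (sol (0, z)) = (cinner (z - T (sol (0, z))) (T u) / of_real ((norm (T u))\<^sup>2)) *\<^sub>C T u}"
proof (intro set_eqI iffI)
  fix z assume "z \<in> T ` kern"
  then obtain w where w: "w \<in> kern" "z = T w" by auto
  define a where "a = cinner w u / of_real ((norm u)\<^sup>2)"
  have "z - T (sol (0, z)) = a *\<^sub>C T u"
    using w u unfolding w(2) sol_of_kern(1)[OF w(1)] a_def
    by (simp add: kern_def T_diff T_scaleC D_intros)
  then show "z \<in> {z. coef (0, z) = 0 \<and>
     z - T (sol (0, z)) = (cinner (z - T (sol (0, z))) (T u) / of_real ((norm (T u))\<^sup>2)) *\<^sub>C T u}"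
    using sol_of_kern(2)[OF w(1)] w(2) u by (auto simp: cinner_scaleC_left cinner_self)
next
  fix z assume "z \<in> {z. coef (0, z) = 0 \<and>
     z - T (sol (0, z)) = (cinner (z - T (sol (0, z))) (T u) / of_real ((norm (T u))\<^sup>2)) *\<^sub>C T u}"
  then obtain a where z: "coef (0, z) = 0" "z - T (sol (0, z)) = a *\<^sub>C T u" by blast
  have "sol (0, z) + a *\<^sub>C u \<in> kern" using sol[of "(0, z)"] z u
    by (auto simp: kern_def S_add S_scaleC D_intros)
  moreover have "z = T (sol (0, z) + a *\<^sub>C u)"
    using z(2) sol u by (simp add: T_add T_scaleC D_intros algebra_simps)
  ultimately show "z \<in> T ` kern" by blast
qed

lemma closed_T_kern: "closed (T ` kern)"
proof -
  have pair: "bounded_linear (\<lambda>z. (0, z))" by (intro bounded_linear_intros)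
  have [continuous_intros]: "continuous_on UNIV (\<lambda>z. coef (0, z))" "continuous_on UNIV (\<lambda>z. T (sol (0, z)))"
    using bounded_linear_compose[OF bounded_linear_coef pair] bounded_linear_compose[OF bounded_linear_T_sol pair]
    by (auto intro: linear_continuous_on)
  have cont: "continuous_on UNIV (\<lambda>z. z - T (sol (0, z)))" by (intro continuous_intros)
  show ?thesis
    unfolding T_kern_eq
    by (intro closed_Collect_conj closed_Collect_eq cont continuous_intros
        bounded_bilinear.continuous_on[OF bounded_bilinear_scaleC]
        bounded_bilinear.continuous_on[OF bounded_bilinear_cinner]) (use u in auto)
qed

lemma csubspace_T_kern: "csubspace (T ` kern)"
proof (rule csubspaceI)
  show "0 \<in> T ` kern" using T_zero kern_intros(5) by (metis imageI)
  fix x y a assume "x \<in> T ` kern"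
  then obtain w where w: "w \<in> kern" "x = T w" by auto
  then have "a *\<^sub>C x = T (a *\<^sub>C w)" by (simp add: kern_def T_scaleC)
  then show "a *\<^sub>C x \<in> T ` kern" using kern_intros(3)[OF w(1)] by blast
  assume "y \<in> T ` kern"
  then obtain v where v: "v \<in> kern" "y = T v" by auto
  then have "x + y = T (w + v)" using w by (simp add: kern_def T_add)
  then show "x + y \<in> T ` kern" using kern_intros(2)[OF w(1) v(1)] by blast
qed

text \<open>The solution operator controls a kernel vector modulo \<open>u\<close>, and the multiple of \<open>u\<close> is controlled
  by its trace since \<^prop>\<open>T u \<noteq> 0\<close>.\<close>

lemma kern_bounded_by_trace: "\<exists>C\<ge>0. \<forall>w\<in>kern. norm w \<le> C * norm (T w)"
proof -
  obtain C1 where C1: "C1 \<ge> 0" "\<And>y. norm (sol y) \<le> norm y * C1"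
    using bounded_linear.nonneg_bounded[OF bounded_linear_sol] by blast
  obtain C2 where C2: "C2 \<ge> 0" "\<And>y. norm (T (sol y)) \<le> norm y * C2"
    using bounded_linear.nonneg_bounded[OF bounded_linear_T_sol] by blast
  have Tu: "norm (T u) > 0" using u by simp
  have "norm w \<le> ((1 + C2) / norm (T u) * norm u + C1) * norm (T w)" if "w \<in> kern" for w
  proof -
    define a where "a = cinner w u / of_real ((norm u)\<^sup>2)"
    have w: "w \<in> D" "w = sol (0, T w) + a *\<^sub>C u"
      using that sol_of_kern(1)[OF that] by (auto simp: kern_def a_def)
    have "T w = T (sol (0, T w)) + a *\<^sub>C T u"
      by (subst w(2)) (simp add: T_add T_scaleC D_intros sol u)
    then have "cmod a * norm (T u) = norm (T w - T (sol (0, T w)))"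
      by (metis add_diff_cancel_left' norm_scaleC)
    also have "\<dots> \<le> norm (T w) + norm (T (sol (0, T w)))" by (rule norm_triangle_ineq4)
    also have "\<dots> \<le> (1 + C2) * norm (T w)" using C2(2)[of "(0, T w)"] by (simp add: algebra_simps)
    finally have a: "cmod a \<le> (1 + C2) / norm (T u) * norm (T w)" using Tu by (simp add: field_simps)
    have "norm w \<le> norm (sol (0, T w)) + cmod a * norm u"
      by (metis w(2) norm_triangle_ineq norm_scaleC)
    also have "\<dots> \<le> norm (T w) * C1 + ((1 + C2) / norm (T u) * norm (T w)) * norm u"
      using C1(2)[of "(0, T w)"] by (intro add_mono mult_right_mono a) auto
    finally show ?thesis by (simp add: algebra_simps)
  qed
  then show ?thesis
    using C1 C2 Tu by (intro exI[of _ "(1 + C2) / norm (T u) * norm u + C1"]) auto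
qed

text \<open>Boundary data can be chosen to cancel the defect of the range along \<open>u\<close>, because the
  trace of \<open>u\<close> does not vanish. So the maximal operator has a bounded right inverse.\<close>

lemma bounded_right_inverse:
  obtains W :: "'x \<Rightarrow>\<^sub>L 'x" where "\<And>h. W h \<in> D" "\<And>h. S (W h) = h"
proof -
  define \<zeta> where "\<zeta> = of_real (1 / (norm (T u))\<^sup>2) *\<^sub>C (- calJ (T u))"
  have \<zeta>: "Omega \<zeta> (T u) = 1" unfolding \<zeta>_def Omega_scaleC_left Omega_calJ using u by simp
  define p where "p h = (h, cinner h u *\<^sub>C \<zeta>)" for h
  have "bounded_linear p" unfolding p_def
    by (intro bounded_linear_Pair bounded_linear_ident
        bounded_linear_compose[OF bounded_bilinear.bounded_linear_left[OF bounded_bilinear_scaleC]]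
        bounded_bilinear.bounded_linear_left[OF bounded_bilinear_cinner])
  from bounded_linear_compose[OF bounded_linear_sol this]
  have W: "blinfun_apply (Blinfun (\<lambda>h. sol (p h))) = (\<lambda>h. sol (p h))"
    by (rule bounded_linear_Blinfun_apply)
  have "coef (p h) = 0" for h by (simp add: coef_def p_def Omega_scaleC_left \<zeta>)
  moreover have "fst (p h) = h" for h by (simp add: p_def)
  ultimately have "sol (p h) \<in> D" "S (sol (p h)) = h" for h using sol[of "p h"] by simp_all
  then show thesis by (intro that[of "Blinfun (\<lambda>h. sol (p h))"]) (simp_all only: W)
qed

text \<open>With a bounded right inverse \<open>W\<close> of \<open>S\<close>, the operator \<open>id_blinfun + W B\<close> maps the kernel of \<open>S + B\<close>
  onto that of \<open>S\<close>. Its inverse \<open>\<Theta>\<close> carries \<open>u\<close> along a curve of kernel vectors, and Green's identity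
  evaluates the form on their traces. The result is the complex conjugate of the expression for the
  derivative of the eigenvalue function.\<close>

lemma crossing_form_at_eigenvalue:
  fixes B :: "real \<Rightarrow> 'x \<Rightarrow>\<^sub>L 'x" and Tr Tr' :: "real \<Rightarrow> 'x \<Rightarrow> 'k pow4"
    and Q :: "real \<Rightarrow> 'k pow4 \<Rightarrow>\<^sub>L 'k pow4" and t0 :: real
  assumes J: "open J" "t0 \<in> J"
    and B: "(B has_vector_derivative B') (at t0)" "B t0 = 0"
    and Q: "(Q has_vector_derivative Q') (at t0)" "Q t0 = Pr" "\<And>t z. t \<in> J \<Longrightarrow> Q t (Q t z) = Q t z"
    and Tr: "C1_family_on D graph_size J Tr Tr'" "\<And>w. w \<in> D \<Longrightarrow> Tr t0 w = T w"
      "\<And>t w v. t \<in> J \<Longrightarrow> w \<in> D \<Longrightarrow> v \<in> D \<Longrightarrow> cinner (S w) v - cinner w (S v) = Omega (Tr t w) (Tr t v)"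
    and Y: "\<And>t. t \<in> J \<Longrightarrow> Y t = (Tr t ` {w \<in> D. S w + B t w = 0}) \<times> range (Q t)"
  shows "crossing_form Y t0 (T u, T u) (T u, T u) =
    cnj (cinner (B' u) u - Omega (Tr' t0 u) (T u) + Omega (Q' (T u)) (T u))"
proof -
  obtain W :: "'x \<Rightarrow>\<^sub>L 'x" where W: "\<And>h. W h \<in> D" "\<And>h. S (W h) = h"
    using bounded_right_inverse by blast
  obtain Ck where Ck: "Ck \<ge> 0" "\<And>w. w \<in> kern \<Longrightarrow> norm w \<le> Ck * norm (T w)"
    using kern_bounded_by_trace by blast
  obtain KT where KT: "\<And>w. w \<in> D \<Longrightarrow> norm (T w) \<le> KT * graph_size w" "KT \<ge> 0"
  proof -
    obtain K where "\<And>w. w \<in> D \<Longrightarrow> norm (T w) \<le> K * graph_size w" using T_bounded by blast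
    then have "norm (T w) \<le> \<bar>K\<bar> * graph_size w" if "w \<in> D" for w
      using that mult_right_mono[of K "\<bar>K\<bar>" "graph_size w"] by (meson abs_ge_self add_nonneg_nonneg norm_ge_zero order_trans)
    then show ?thesis using that[of "\<bar>K\<bar>"] by simp
  qed
  \<comment> \<open>All three families are Lipschitz at \<open>t0\<close>.\<close>
  obtain KT' where KT': "\<And>w. w \<in> D \<Longrightarrow> norm (Tr' t0 w) \<le> KT' * graph_size w"
    using C1_family_onD(2)[OF Tr(1) J(2)] by (auto simp: bounded_clinear_on_def)
  obtain d1 where d1: "d1 > 0" "\<And>s w. s \<in> J \<Longrightarrow> \<bar>s - t0\<bar> < d1 \<Longrightarrow> w \<in> D \<Longrightarrow>
      norm (Tr s w - Tr t0 w - (s - t0) *\<^sub>R Tr' t0 w) \<le> 1 * \<bar>s - t0\<bar> * graph_size w"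
    using C1_family_onD(3)[OF Tr(1) J(2), of 1] by auto
  obtain d2 where d2: "d2 > 0" "\<And>s. \<bar>s - t0\<bar> < d2 \<Longrightarrow> s \<in> J"
    using J by (auto simp: open_dist dist_real_def)
  define CB where "CB = norm B' + 1"
  obtain d3 where d3: "d3 > 0" "\<And>s. \<bar>s - t0\<bar> < d3 \<Longrightarrow> norm (B s) \<le> CB * \<bar>s - t0\<bar>"
    using has_vector_derivative_Lipschitz_at[OF B(1)] B(2) by (auto simp: CB_def)
  define CQ where "CQ = norm Q' + 1"
  obtain d4 where d4: "d4 > 0" "\<And>s. \<bar>s - t0\<bar> < d4 \<Longrightarrow> norm (Q s - Pr) \<le> CQ * \<bar>s - t0\<bar>"
    using has_vector_derivative_Lipschitz_at[OF Q(1)] Q(2) by (auto simp: CQ_def)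
  have pos: "CB > 0" "CQ > 0" by (auto simp: CB_def CQ_def add_nonneg_pos)
  define CT where "CT = \<bar>KT'\<bar> + 1"
  \<comment> \<open>Within distance \<open>b\<close> and \<open>c\<close> of \<open>t0\<close> the operators inverted below differ from the identity by at
    most \<open>1 / 2\<close>.\<close>
  define b where "b = 1 / (2 * (norm W + 1) * CB)"
  define c where "c = 1 / (2 * (norm Pr + 1) * CQ)"
  define r where "r = Min {d1, d2, d3, d4, b, c, 1 / CQ}"
  have "b > 0" "c > 0" using pos by (auto simp: b_def c_def add_nonneg_pos)
  then have "r > 0" using d1(1) d2(1) d3(1) d4(1) pos by (simp add: r_def)
  have less: "\<bar>s - t0\<bar> < d1" "\<bar>s - t0\<bar> < d2" "\<bar>s - t0\<bar> < d3" "\<bar>s - t0\<bar> < d4" "\<bar>s - t0\<bar> < b"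
      "\<bar>s - t0\<bar> < c" "\<bar>s - t0\<bar> < 1 / CQ" if "\<bar>s - t0\<bar> < r" for s
    using that by (auto simp: r_def)
  have sJ: "s \<in> J" if "\<bar>s - t0\<bar> < r" for s using d2 less[OF that] by blast
  have lipT: "norm (Tr s w - T w) \<le> CT * \<bar>s - t0\<bar> * graph_size w" if s: "\<bar>s - t0\<bar> < r" and w: "w \<in> D" for s w
  proof -
    have "norm (Tr s w - T w) = norm ((Tr s w - Tr t0 w - (s - t0) *\<^sub>R Tr' t0 w) + (s - t0) *\<^sub>R Tr' t0 w)"
      using Tr(2)[OF w] by simp
    also have "\<dots> \<le> 1 * \<bar>s - t0\<bar> * graph_size w + \<bar>s - t0\<bar> * norm (Tr' t0 w)"
      by (intro order_trans[OF norm_triangle_ineq] add_mono d1 sJ s less w) simp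
    also have "\<dots> \<le> 1 * \<bar>s - t0\<bar> * graph_size w + \<bar>s - t0\<bar> * (\<bar>KT'\<bar> * graph_size w)"
      by (intro add_mono order_refl mult_left_mono order_trans[OF KT'[OF w]] mult_right_mono) auto
    finally show ?thesis by (simp add: CT_def algebra_simps)
  qed
  have WB: "norm (W o\<^sub>L B s) \<le> 1 / 2" and B1: "norm (B s) \<le> 1" if s: "\<bar>s - t0\<bar> < r" for s
  proof -
    have "(norm W + 1) * norm (B s) \<le> (norm W + 1) * (CB * b)"
      using less[OF s] pos by (intro mult_left_mono order_trans[OF d3(2)]) auto
    also have "\<dots> = 1 / 2" using pos by (simp add: b_def add_nonneg_eq_0_iff divide_simps)
    finally have "norm W * norm (B s) + norm (B s) \<le> 1 / 2" by (simp add: distrib_right)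
    moreover have "0 \<le> norm W * norm (B s)" "0 \<le> norm (B s)" by auto
    ultimately show "norm (B s) \<le> 1" "norm (W o\<^sub>L B s) \<le> 1 / 2"
      using norm_blinfun_compose[of W "B s"] by linarith+
  qed
  obtain \<Theta> where \<Theta>: "\<And>s. \<bar>s - t0\<bar> < r \<Longrightarrow> (id_blinfun + (W o\<^sub>L B s)) o\<^sub>L \<Theta> s = id_blinfun"
      "\<And>s. \<bar>s - t0\<bar> < r \<Longrightarrow> \<Theta> s o\<^sub>L (id_blinfun + (W o\<^sub>L B s)) = id_blinfun"
      "\<And>s. \<bar>s - t0\<bar> < r \<Longrightarrow> norm (\<Theta> s) \<le> 2"
  proof -
    have "\<exists>G. (id_blinfun + (W o\<^sub>L B s)) o\<^sub>L G = id_blinfun \<and> G o\<^sub>L (id_blinfun + (W o\<^sub>L B s)) = id_blinfun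
        \<and> norm G \<le> 2" if "\<bar>s - t0\<bar> < r" for s
      using near_identity_invertible[of "id_blinfun + (W o\<^sub>L B s)"] WB[OF that] by auto
    then show ?thesis using that by metis
  qed
  have \<Theta>_eq: "\<Theta> s w = w - W (B s (\<Theta> s w))" and \<Theta>_inv: "\<Theta> s (w + W (B s w)) = w"
    and \<Theta>_norm: "norm (\<Theta> s w) \<le> 2 * norm w" if s: "\<bar>s - t0\<bar> < r" for s w
  proof -
    show "\<Theta> s w = w - W (B s (\<Theta> s w))"
      using arg_cong[OF \<Theta>(1)[OF s], of "\<lambda>f. blinfun_apply f w"]
      by (simp add: blinfun.add_left eq_diff_eq)
    show "\<Theta> s (w + W (B s w)) = w"
      using arg_cong[OF \<Theta>(2)[OF s], of "\<lambda>f. blinfun_apply f w"] by (simp add: blinfun.add_left)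
    show "norm (\<Theta> s w) \<le> 2 * norm w"
      using norm_blinfun[of "\<Theta> s" w] mult_right_mono[OF \<Theta>(3)[OF s] norm_ge_zero[of w]] by linarith
  qed
  have \<Theta>_ker: "\<Theta> s w \<in> D \<and> S (\<Theta> s w) = - B s (\<Theta> s w)" if s: "\<bar>s - t0\<bar> < r" and w: "w \<in> kern" for s w
  proof -
    have "\<Theta> s w \<in> D" using w W by (subst \<Theta>_eq[OF s]) (auto simp: kern_def intro!: D_intros)
    moreover have "S (\<Theta> s w) = - B s (\<Theta> s w)"
      using w W S_diff[of w "W (B s (\<Theta> s w))"] by (subst \<Theta>_eq[OF s]) (auto simp: kern_def)
    ultimately show ?thesis by simp
  qed
  have ker_image: "{w \<in> D. S w + B s w = 0} = \<Theta> s ` kern" if s: "\<bar>s - t0\<bar> < r" for s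
  proof (intro set_eqI iffI)
    fix w assume "w \<in> {w \<in> D. S w + B s w = 0}"
    then have "w + W (B s w) \<in> kern" using W by (auto simp: kern_def S_add intro!: D_intros)
    then show "w \<in> \<Theta> s ` kern" using \<Theta>_inv[OF s] by (metis imageI)
  qed (use \<Theta>_ker[OF s] in auto)
  define \<kappa> where "\<kappa> y = (SOME w. w \<in> kern \<and> T w = y)" for y
  have \<kappa>: "\<kappa> y \<in> kern" "T (\<kappa> y) = y" if "y \<in> T ` kern" for y
    unfolding \<kappa>_def using someI_ex[of "\<lambda>w. w \<in> kern \<and> T w = y"] that by auto
  have T_kern_diff: "T (w - v) = T w - T v" if "w \<in> kern" "v \<in> kern" for w v
    using that by (simp add: kern_def T_diff)
  have inj: "w = v" if "w \<in> kern" "v \<in> kern" "T w = T v" for w v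
    using Ck(2)[OF kern_intros(1)[OF that(1,2)]] T_kern_diff[OF that(1,2)] that(3) by simp
  have \<kappa>_diff: "\<kappa> (x - y) = \<kappa> x - \<kappa> y" if "x \<in> T ` kern" "y \<in> T ` kern" for x y
    using that by (intro inj) (auto intro!: \<kappa> kern_intros csubspaceD[OF csubspace_T_kern] simp: \<kappa> T_kern_diff)
  define \<Lambda> where "\<Lambda> s y = (Tr s (\<Theta> s (\<kappa> (fst y))), Q s (snd y))" for s and y :: "'k pow4 \<times> 'k pow4"
  have Y0: "Y t0 = T ` kern \<times> range Pr"
  proof -
    have "Tr t0 ` {w \<in> D. S w + B t0 w = 0} = T ` kern"
      unfolding kern_def by (rule image_cong) (auto simp: B(2) Tr(2))
    then show ?thesis by (simp add: Y[OF J(2)] Q(2))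
  qed
  have range_Pr: "range Pr = {z. Pr z = z}" using Pr(2) by (auto simp: image_iff) metis
  have \<kappa>_T: "\<kappa> (T w) = w" if "w \<in> kern" for w using that by (intro inj) (auto simp: \<kappa>)
  have Tr_lin: "clinear_on D (Tr s)" if "\<bar>s - t0\<bar> < r" for s
    using C1_family_onD(1)[OF Tr(1) sJ[OF that]] by (simp add: bounded_clinear_on_def)
  have Q_onto: "\<exists>y. Q s z = Q s (Pr y)" if s: "\<bar>s - t0\<bar> < r" for s z
  proof -
    have close: "norm (Q s - Pr) \<le> CQ * \<bar>s - t0\<bar>" using d4 less[OF s] by blast
    also have "\<dots> \<le> CQ * (1 / CQ)" using less[OF s] pos by (intro mult_left_mono) auto
    finally have "norm (Q s) \<le> norm Pr + 1"
      using norm_triangle_ineq[of "Q s - Pr" Pr] pos by simp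
    moreover have "norm (Pr - Q s) \<le> CQ * c"
      unfolding norm_minus_commute[of Pr] using less(6)[OF s] pos
      by (intro order_trans[OF close] mult_left_mono) auto
    ultimately have "norm (Q s) * norm (Pr - Q s) \<le> (norm Pr + 1) * (CQ * c)" by (intro mult_mono) auto
    also have "\<dots> = 1 / 2" using pos by (simp add: c_def add_nonneg_eq_0_iff divide_simps)
    finally have "norm (Q s o\<^sub>L (Pr - Q s)) \<le> 1 / 2" using norm_blinfun_compose order_trans by blast
    then obtain G where G: "(id_blinfun + (Q s o\<^sub>L (Pr - Q s))) o\<^sub>L G = id_blinfun"
      using near_identity_invertible[of "id_blinfun + (Q s o\<^sub>L (Pr - Q s))"] by auto
    \<comment> \<open>The inverted operator is \<open>(id_blinfun - Q s) + Q s Pr\<close>, so applying \<open>Q s\<close> to the equation for \<open>x\<close>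
      leaves \<open>Q s (Pr x) = Q s z\<close>.\<close>
    define x where "x = G (Q s z)"
    have "x + (Q s (Pr x) - Q s x) = Q s z"
      using arg_cong[OF G, of "\<lambda>f. blinfun_apply f (Q s z)"] Q(3)[OF sJ[OF s]]
      by (simp add: blinfun.bilinear_simps x_def)
    from arg_cong[OF this, of "Q s"] have "Q s (Pr x) = Q s z"
      using Q(3)[OF sJ[OF s]] by (simp add: blinfun.bilinear_simps)
    then show ?thesis by metis
  qed
  define C\<Lambda> where "C\<Lambda> = CT * 4 * Ck + KT * ((norm W + 1) * CB * 2 * Ck) + CQ"
  have near: "norm (\<Lambda> s y - y) \<le> C\<Lambda> * \<bar>s - t0\<bar> * norm y" if s: "\<bar>s - t0\<bar> < r" and y: "y \<in> Y t0" for s y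
  proof -
    define w where "w = \<kappa> (fst y)"
    define v where "v = \<Theta> s w"
    have y1: "fst y \<in> T ` kern" and y2: "Pr (snd y) = snd y" using y by (auto simp: Y0 range_Pr)
    have w: "w \<in> kern" "T w = fst y" unfolding w_def using \<kappa>[OF y1] by auto
    have v: "v \<in> D" "S v = - B s v" unfolding v_def using \<Theta>_ker[OF s w(1)] by auto
    have nv: "norm v \<le> 2 * (Ck * norm y)"
    proof -
      have "norm w \<le> Ck * norm (fst y)" using Ck(2)[OF w(1)] w(2) by simp
      also have "\<dots> \<le> Ck * norm y" by (intro mult_left_mono norm_fst_le_norm Ck)
      finally show ?thesis using \<Theta>_norm[OF s, of w] by (simp add: v_def)
    qed
    have Bv: "norm (B s v) \<le> CB * \<bar>s - t0\<bar> * (2 * (Ck * norm y))"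
      using pos d3(2)[OF less(3)[OF s]]
      by (intro order_trans[OF norm_blinfun] mult_mono nv) auto
    have "norm (S v) \<le> norm v"
      using v(2) norm_blinfun[of "B s" v] mult_right_mono[OF B1[OF s] norm_ge_zero[of v]] by simp
    then have gv: "graph_size v \<le> 4 * (Ck * norm y)" using nv by simp
    have "norm (Tr s v - T v) \<le> CT * \<bar>s - t0\<bar> * (4 * (Ck * norm y))"
      by (intro order_trans[OF lipT[OF s v(1)]] mult_left_mono gv) (auto simp: CT_def)
    moreover have "norm (T v - fst y) \<le> KT * ((norm W + 1) * (CB * \<bar>s - t0\<bar> * (2 * (Ck * norm y))))"
    proof -
      have "v = w - W (B s v)" unfolding v_def by (rule \<Theta>_eq[OF s])
      then have "T v = T w - T (W (B s v))" using T_diff[of w "W (B s v)"] w(1) W(1) by (simp add: kern_def)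
      then have "norm (T v - fst y) = norm (T (W (B s v)))" by (simp add: w(2))
      also have "\<dots> \<le> KT * graph_size (W (B s v))" by (rule KT(1)[OF W(1)])
      also have "\<dots> \<le> KT * ((norm W + 1) * norm (B s v))"
        using norm_blinfun[of W "B s v"] by (intro mult_left_mono KT) (simp add: W distrib_right)
      also have "\<dots> \<le> KT * ((norm W + 1) * (CB * \<bar>s - t0\<bar> * (2 * (Ck * norm y))))"
        by (intro mult_left_mono Bv KT) auto
      finally show ?thesis .
    qed
    moreover have "norm (Q s (snd y) - snd y) \<le> CQ * \<bar>s - t0\<bar> * norm y"
    proof -
      have "norm (Q s (snd y) - snd y) = norm ((Q s - Pr) (snd y))" by (simp add: blinfun.diff_left y2)
      also have "\<dots> \<le> CQ * \<bar>s - t0\<bar> * norm y"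
        using pos d4(2)[OF less(4)[OF s]]
        by (intro order_trans[OF norm_blinfun] mult_mono norm_snd_le_norm) auto
      finally show ?thesis .
    qed
    moreover have "norm (\<Lambda> s y - y) \<le> norm (Tr s v - fst y) + norm (Q s (snd y) - snd y)"
      using norm_Pair_le[of "Tr s v - fst y" "Q s (snd y) - snd y"]
      by (cases y) (simp add: \<Lambda>_def v_def w_def)
    moreover have "norm (Tr s v - fst y) \<le> norm (Tr s v - T v) + norm (T v - fst y)"
      using norm_triangle_ineq[of "Tr s v - T v" "T v - fst y"] by simp
    ultimately show ?thesis by (simp add: C\<Lambda>_def algebra_simps)
  qed
  have q: "(T u, T u) \<in> Y t0" using u kern_intros(4) by (auto simp: Y0 range_Pr)
  have \<Lambda>q: "\<Lambda> s (T u, T u) = (Tr s (\<Theta> s u), Q s (T u))" for s by (simp add: \<Lambda>_def \<kappa>_T kern_intros)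
  have t0: "\<bar>t0 - t0\<bar> < r" using \<open>r > 0\<close> by simp
  have near_t0: "\<forall>\<^sub>F s in at t0. \<bar>s - t0\<bar> < r"
    using \<open>r > 0\<close> by (auto simp: eventually_at dist_real_def intro!: exI[of _ r])
  have small: "((\<lambda>s. K * \<bar>s - t0\<bar> * M) \<longlongrightarrow> 0) (at t0)" for K M :: real
  proof -
    have "((\<lambda>s. K * \<bar>s - t0\<bar> * M) \<longlongrightarrow> K * \<bar>t0 - t0\<bar> * M) (at t0)" by (intro tendsto_intros)
    then show ?thesis by simp
  qed
  have lim_Tr: "((\<lambda>s. Tr s (\<Theta> s u)) \<longlongrightarrow> T u) (at t0)"
  proof (rule LIM_zero_cancel, rule Lim_null_comparison[OF _ small])
    show "\<forall>\<^sub>F s in at t0. norm (Tr s (\<Theta> s u) - T u) \<le> C\<Lambda> * \<bar>s - t0\<bar> * norm (T u, T u)"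
      using near_t0
    proof eventually_elim
      case (elim s)
      have "norm (Tr s (\<Theta> s u) - T u) \<le> norm (\<Lambda> s (T u, T u) - (T u, T u))"
        unfolding \<Lambda>q diff_Pair by (rule norm_fst_le)
      then show ?case using near[OF elim q] by simp
    qed
  qed
  have lim_\<Theta>: "((\<lambda>s. \<Theta> s u) \<longlongrightarrow> u) (at t0)"
  proof (rule LIM_zero_cancel, rule Lim_null_comparison[OF _ small])
    show "\<forall>\<^sub>F s in at t0. norm (\<Theta> s u - u) \<le> (norm W * CB) * \<bar>s - t0\<bar> * (2 * norm u)"
      using near_t0
    proof eventually_elim
      case (elim s)
      have "norm (\<Theta> s u - u) = norm (W (B s (\<Theta> s u)))"
        using \<Theta>_eq[OF elim, of u] by (metis add_diff_cancel_left' minus_diff_eq norm_minus_cancel diff_add_cancel)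
      also have "\<dots> \<le> norm W * (CB * \<bar>s - t0\<bar> * (2 * norm u))"
        using pos d3(2)[OF less(3)[OF elim]] \<Theta>(3)[OF elim]
        by (intro order_trans[OF norm_blinfun] mult_left_mono mult_mono) auto
      finally show ?case by (simp add: mult.assoc)
    qed
  qed
  have \<Theta>0: "\<Theta> t0 u = u" using \<Theta>_eq[OF t0, of u] B(2) by simp
  have dB: "((\<lambda>s. B s (\<Theta> s u)) has_vector_derivative B' u) (at t0)"
    using bounded_bilinear.has_derivative_vanishing[OF
        bounded_bilinear.flip[OF bounded_bilinear_blinfun_apply] _ B(1)[unfolded has_vector_derivative_def] B(2),
        of "\<lambda>s. \<Theta> s u"] lim_\<Theta> \<Theta>0
    by (simp add: has_vector_derivative_def blinfun.scaleR_left)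
  have dTru: "((\<lambda>s. Tr s u) has_vector_derivative Tr' t0 u) (at t0)"
    by (rule C1_family_on_apply(1)[OF Tr(1) J(1) D u(1) graph_size_scaleR[OF u(1)] _ J(2)]) auto
  have dTr: "((\<lambda>s. Omega (Tr s u - T u) (Tr s (\<Theta> s u))) has_vector_derivative Omega (Tr' t0 u) (T u)) (at t0)"
  proof -
    have "((\<lambda>s. Tr s u - T u) has_derivative (\<lambda>h. h *\<^sub>R Tr' t0 u)) (at t0)"
      using has_vector_derivative_diff[OF dTru has_vector_derivative_const, of "T u"]
      by (simp add: has_vector_derivative_def)
    from bounded_bilinear.has_derivative_vanishing[OF
        bounded_bilinear.flip[OF bounded_bilinear_Omega] _ this, of "\<lambda>s. Tr s (\<Theta> s u)"]
    show ?thesis using lim_Tr \<Theta>0 Tr(2)[OF u(1)]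
      by (simp add: has_vector_derivative_def Omega.scaleR_left)
  qed
  \<comment> \<open>The form \<open>Omega (Tr s u) (Tr s u)\<close> vanishes identically, hence so does its derivative.\<close>
  have skew: "Omega (T u) (Tr' t0 u) + Omega (Tr' t0 u) (T u) = 0"
  proof -
    have "((\<lambda>s. Omega (Tr s u) (Tr s u)) has_vector_derivative
        (Omega (Tr t0 u) (Tr' t0 u) + Omega (Tr' t0 u) (Tr t0 u))) (at t0)"
      by (rule Omega.has_vector_derivative[OF dTru dTru])
    moreover have "((\<lambda>s. Omega (Tr s u) (Tr s u)) has_vector_derivative 0) (at t0)"
      by (rule has_vector_derivative_transform_within_open[OF has_vector_derivative_const J])
        (use Tr(3)[OF _ u(1) u(1)] u in auto)
    ultimately show ?thesis
      using vector_derivative_unique_at Tr(2)[OF u(1)] by fastforce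
  qed
  show ?thesis
  proof (rule crossing_form_eq_derivative[where \<Lambda> = \<Lambda> and r = r and C = C\<Lambda>])
    have "csubspace (range Pr)"
      unfolding range_Pr by (rule csubspaceI) (simp_all add: blinfun.add_right Pr_scaleC)
    then show "csubspace (Y t0)" unfolding Y0 by (intro csubspace_Times csubspace_T_kern)
    show "closed (Y t0)"
      unfolding Y0 range_Pr
      by (intro closed_Times closed_T_kern closed_Collect_eq continuous_intros)
    show "Omega_tilde p q = 0" if "p \<in> Y t0" "q \<in> Y t0" for p q
    proof -
      have "fst p \<in> T ` kern" "fst q \<in> T ` kern" "Pr (snd p) = snd p" "Pr (snd q) = snd q"
        using that by (auto simp: Y0 range_Pr)
      then obtain w v where wv: "w \<in> kern" "v \<in> kern" "fst p = T w" "fst q = T v" by blast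
      then have "Omega (fst p) (fst q) = 0" using green[of w v] by (simp add: kern_def)
      then show ?thesis
        using isotropic'[OF \<open>Pr (snd p) = snd p\<close> \<open>Pr (snd q) = snd q\<close>] by (simp add: Omega_tilde_def)
    qed
    show "Y s = \<Lambda> s ` Y t0" if s: "\<bar>s - t0\<bar> < r" for s
    proof -
      have "Y s = (Tr s ` \<Theta> s ` kern) \<times> range (Q s)" by (simp add: Y[OF sJ[OF s]] ker_image[OF s])
      also have "range (Q s) = Q s ` range Pr" using Q_onto[OF s] by (force simp: image_iff)
      also have "Tr s ` \<Theta> s ` kern = (\<lambda>y. Tr s (\<Theta> s (\<kappa> y))) ` T ` kern"
        unfolding image_image by (rule image_cong) (simp_all add: \<kappa>_T)
      also have "\<dots> \<times> Q s ` range Pr = \<Lambda> s ` Y t0"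
        unfolding Y0 \<Lambda>_def by (rule image_paired_Times[symmetric, unfolded case_prod_unfold])
      finally show ?thesis .
    qed
    show "\<Lambda> s (x - y) = \<Lambda> s x - \<Lambda> s y" if s: "\<bar>s - t0\<bar> < r" and xy: "x \<in> Y t0" "y \<in> Y t0" for s x y
    proof -
      have "fst x \<in> T ` kern" "fst y \<in> T ` kern" using xy by (auto simp: Y0)
      then show ?thesis
        using clinear_on_diff[OF D Tr_lin[OF s]] \<Theta>_ker[OF s] \<kappa>(1)
        by (simp add: \<Lambda>_def \<kappa>_diff blinfun.diff_right)
    qed
    let ?f = "\<lambda>s. cinner u (B s (\<Theta> s u)) - Omega (Tr s u - T u) (Tr s (\<Theta> s u)) - Omega (T u) (Q s (T u))"
    have "(?f has_vector_derivative (cinner u (B' u) - Omega (Tr' t0 u) (T u) - Omega (T u) (Q' (T u)))) (at t0)"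
      by (intro has_vector_derivative_diff dTr
          bounded_linear.has_vector_derivative[OF bounded_bilinear.bounded_linear_right[OF bounded_bilinear_cinner] dB]
          bounded_linear.has_vector_derivative[OF Omega.bounded_linear_right]
          bounded_linear.has_vector_derivative[OF blinfun.bounded_linear_left Q(1)])
    also have "cinner u (B' u) - Omega (Tr' t0 u) (T u) - Omega (T u) (Q' (T u))
        = cnj (cinner (B' u) u - Omega (Tr' t0 u) (T u) + Omega (Q' (T u)) (T u))"
    proof -
      have "cnj (Omega (Tr' t0 u) (T u)) = Omega (Tr' t0 u) (T u)"
        using skew Omega_skew[of "T u" "Tr' t0 u"] by (simp add: eq_neg_iff_add_eq_0 neg_eq_iff_add_eq_0)
      then show ?thesis
        using Omega_skew[of "T u" "Q' (T u)"] by (simp add: cinner_commute[symmetric])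
    qed
    finally show "((\<lambda>s. Omega_tilde (T u, T u) (\<Lambda> s (T u, T u))) has_vector_derivative
        cnj (cinner (B' u) u - Omega (Tr' t0 u) (T u) + Omega (Q' (T u)) (T u))) (at t0)"
    proof (rule has_vector_derivative_transform_within_open[of _ _ _ "{t0 - r<..<t0 + r}"])
      fix s assume "s \<in> {t0 - r<..<t0 + r}"
      then have s: "\<bar>s - t0\<bar> < r" by auto
      have k: "\<Theta> s u \<in> D" "S (\<Theta> s u) = - B s (\<Theta> s u)" using \<Theta>_ker[OF s kern_intros(4)] by auto
      have "Omega (Tr s u) (Tr s (\<Theta> s u)) = cinner u (B s (\<Theta> s u))"
        using Tr(3)[OF sJ[OF s] u(1) k(1)] u(2) k(2) by (simp add: cinner_minus_right)
      then show "?f s = Omega_tilde (T u, T u) (\<Lambda> s (T u, T u))"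
        by (simp add: Omega_tilde_def \<Lambda>q Omega.diff_left)
    qed (use \<open>r > 0\<close> in auto)
  qed (use q near \<open>r > 0\<close> in auto)
qed

end

section \<open>Adjoints, self-adjoint extensions and block operators\<close>

lemma op_shift_iff: "(x, y) \<in> op_shift T z \<longleftrightarrow> (x, y + z *\<^sub>C x) \<in> T"
  unfolding op_shift_def op_plus_def op_of_def by (auto simp: algebra_simps)

lemma csubspace_op_adj: "csubspace (op_adj T)"
  by (rule csubspaceI)
    (simp_all add: op_adj_def case_prod_unfold cinner_add_right cinner_scaleC_right scaleC_prod_def)

lemma single_valued_op_adj:
  assumes "densely_defined T"
  shows "single_valued (op_adj T)"
proof (rule single_valuedI)
  fix v w w' assume *: "(v, w) \<in> op_adj T" "(v, w') \<in> op_adj T"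
  have "Domain T \<subseteq> {x. cinner x (w - w') = 0}"
    using * by (fastforce simp: op_adj_def cinner_diff_right)
  moreover have "closed {x. cinner x (w - w') = 0}"
    by (intro closed_Collect_eq linear_continuous_on continuous_intros
        bounded_bilinear.bounded_linear_left[OF bounded_bilinear_cinner])
  ultimately have "closure (Domain T) \<subseteq> {x. cinner x (w - w') = 0}" by (rule closure_minimal)
  then have "cinner (w - w') (w - w') = 0" using assms by (auto simp: densely_defined_def)
  then show "w = w'" by (simp add: cinner_self)
qed

lemma op_app_iff:
  assumes "single_valued T"
  shows "(u, u') \<in> T \<longleftrightarrow> u \<in> Domain T \<and> u' = op_app T u"
proof -
  have "op_app T u = u'" if "(u, u') \<in> T" for u'
    unfolding op_app_def using assms that by (auto dest: single_valuedD)
  then show ?thesis by auto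
qed

lemma linear_op_app:
  assumes "linear_op T"
  shows "csubspace (Domain T)" and "clinear_on (Domain T) (op_app T)"
proof -
  have T: "csubspace T" and sv: "single_valued T" using assms by (auto simp: linear_op_def)
  note app = op_app_iff[OF sv]
  have add: "(u + v, op_app T u + op_app T v) \<in> T" if "u \<in> Domain T" "v \<in> Domain T" for u v
    using csubspaceD(2)[OF T, of "(u, op_app T u)" "(v, op_app T v)"] that app by simp
  have sc: "(a *\<^sub>C u, a *\<^sub>C op_app T u) \<in> T" if "u \<in> Domain T" for a u
    using csubspaceD(4)[OF T, of "(u, op_app T u)" a] that app by (simp add: scaleC_prod_def)
  show "csubspace (Domain T)"
    using csubspaceD(1)[OF T] by (intro csubspaceI) (metis DomainI zero_prod_def, metis DomainI add, metis DomainI sc)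
  show "clinear_on (Domain T) (op_app T)"
    unfolding clinear_on_def using add sc app by metis
qed

text \<open>A vector of the double adjoint splits along the closed graph; the component orthogonal to
  the graph, rotated by a quarter turn, belongs to the adjoint and is therefore zero.\<close>

lemma op_adj_op_adj_subset:
  assumes "linear_op A" "closed A"
  shows "op_adj (op_adj A) \<subseteq> A"
proof
  fix z assume z: "z \<in> op_adj (op_adj A)"
  have A: "csubspace A" using assms by (simp add: linear_op_def)
  obtain y where y: "y \<in> A" "z - y \<in> corth A" using orthogonal_decomposition[OF A \<open>closed A\<close>] .
  obtain p r where pr: "z - y = (p, r)" by (cases "z - y")
  have "(r, - p) \<in> op_adj A"
  proof -
    have "cinner a' r = cinner a (- p)" if "(a, a') \<in> A" for a a'
    proof -
      have "cinner p a + cinner r a' = 0" using y(2) that by (force simp: corth_def pr cinner_prod_def)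
      then have "cnj (cinner p a + cinner r a') = 0" by simp
      then show ?thesis by (simp add: cinner_commute[symmetric] cinner_minus_right eq_neg_iff_add_eq_0 add.commute)
    qed
    then show ?thesis by (auto simp: op_adj_def)
  qed
  moreover have "y \<in> op_adj (op_adj A)"
  proof -
    have "cinner v' (fst y) = cinner v (snd y)" if "(v, v') \<in> op_adj A" for v v'
    proof -
      have "cinner (snd y) v = cinner (fst y) v'" using that y(1) by (force simp: op_adj_def)
      then show ?thesis by (metis cinner_commute)
    qed
    then show ?thesis by (auto simp: op_adj_def split: prod.splits)
  qed
  with z have "(p, r) \<in> op_adj (op_adj A)"
    using csubspaceD(3)[OF csubspace_op_adj] pr by metis
  ultimately have "cinner (- p) p = cinner r r" by (auto simp: op_adj_def)
  then have "- complex_of_real ((norm p)\<^sup>2) = of_real ((norm r)\<^sup>2)"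
    by (simp add: cinner_minus_left cinner_self del: of_real_power)
  from arg_cong[OF this, of Re] have "- (norm p)\<^sup>2 = (norm r)\<^sup>2" by simp
  then have "(norm p)\<^sup>2 = 0" "(norm r)\<^sup>2 = 0"
    using zero_le_power2[of "norm p"] zero_le_power2[of "norm r"] by linarith+
  then have "p = 0" "r = 0" by simp_all
  then show "z \<in> A" using pr y by (simp add: zero_prod_def[symmetric])
qed

lemma green_identity_omega:
  assumes "green_identity S \<Gamma>0 \<Gamma>1" "(u, u') \<in> S" "(v, v') \<in> S"
  shows "cinner u' v - cinner u v' = omega (trace_map \<Gamma>0 \<Gamma>1 u) (trace_map \<Gamma>0 \<Gamma>1 v)"
  using assms by (fastforce simp: green_identity_def omega_def Jmat_def trace_map_def cinner_prod_def cinner_minus_left)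

lemma lagrangian_isotropic: "lagrangian L \<Longrightarrow> f \<in> L \<Longrightarrow> g \<in> L \<Longrightarrow> omega f g = 0"
  unfolding lagrangian_def by blast

text \<open>Vectors with boundary value in the Lagrangian subspace pair symmetrically with the domain of \<open>T\<close>,
  so they lie in the domain of the adjoint of \<open>T\<close>, which is \<open>T\<close> itself.\<close>

lemma selfadjoint_extension_eq:
  assumes sa: "selfadjoint_op T" "A \<subseteq> T" and g: "green_identity (op_adj A) \<Gamma>0 \<Gamma>1"
    and L: "trace_map \<Gamma>0 \<Gamma>1 ` Domain T = L" "lagrangian L"
  shows "(u, u') \<in> T \<longleftrightarrow> (u, u') \<in> op_adj A \<and> trace_map \<Gamma>0 \<Gamma>1 u \<in> L"
proof
  have "op_adj T \<subseteq> op_adj A" unfolding op_adj_def using sa(2) by blast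
  then have T: "op_adj T = T" "T \<subseteq> op_adj A" using sa(1) by (auto simp: selfadjoint_op_def)
  then show "(u, u') \<in> op_adj A \<and> trace_map \<Gamma>0 \<Gamma>1 u \<in> L" if "(u, u') \<in> T"
    using that L by auto
  assume u: "(u, u') \<in> op_adj A \<and> trace_map \<Gamma>0 \<Gamma>1 u \<in> L"
  have "cinner x' u = cinner x u'" if "(x, x') \<in> T" for x x'
  proof -
    have "trace_map \<Gamma>0 \<Gamma>1 x \<in> L" using that L by auto
    then show ?thesis
      using green_identity_omega[OF g, of x x' u u'] u that T(2) lagrangian_isotropic[OF L(2)] by auto
  qed
  then have "(u, u') \<in> op_adj T" by (auto simp: op_adj_def)
  then show "(u, u') \<in> T" using T by simp
qed

lemma op_adj_op_of:
  assumes "\<And>x y. cinner (f x) y = cinner x (g y)"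
  shows "op_adj (op_of f) = op_of g"
proof -
  have "w = g v" if "\<forall>u. cinner (f u) v = cinner u w" for v w
  proof -
    have "cinner (w - g v) (w - g v) = 0" using that assms by (simp add: cinner_diff_right)
    then show ?thesis by (simp add: cinner_self)
  qed
  then show ?thesis using assms by (auto simp: op_adj_def op_of_def)
qed

lemma selfadjoint_boundedD:
  assumes "selfadjoint_bounded F"
  shows "cinner (F x) y = cinner x (F y)" "F (a *\<^sub>C x) = a *\<^sub>C F x"
  using assms by (auto simp: selfadjoint_bounded_def clinear_on_def)

lemma op_ker_boundary_op:
  assumes "(0, 0) \<in> A" "selfadjoint_bounded F" "selfadjoint_bounded G"
  shows "w \<in> op_ker (boundary_op A F G l) \<longleftrightarrow>
    (\<exists>a b. (fst w, a) \<in> op_adj A \<and> (snd w, b) \<in> op_adj A \<and>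
       a + F (fst w) - l *\<^sub>R snd w = 0 \<and> - b - G (snd w) - l *\<^sub>R fst w = 0)"
proof -
  have "op_adj (op_of (block_blinfun G F)) = op_of (\<lambda>w. (F (snd w), - G (fst w)))"
    by (rule op_adj_op_of)
      (simp add: block_blinfun.rep_eq cinner_prod_def cinner_minus_left cinner_minus_right
        selfadjoint_boundedD[OF assms(2)] selfadjoint_boundedD[OF assms(3)])
  then have "w \<in> op_ker (boundary_op A F G l) \<longleftrightarrow>
    (\<exists>a b. (fst w, a) \<in> op_adj A \<and> (snd w, b) \<in> op_adj A \<and>
       l *\<^sub>R snd w = a + F (fst w) \<and> l *\<^sub>R fst w = - b - G (snd w))"
    unfolding op_ker_def boundary_op_def op_adj_block_op[OF assms(1)]
    by (cases w) (auto simp: op_shift_iff relcomp_unfold op_of_def op_plus_def scaleC_prod_def scaleC_of_real)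
  then show ?thesis by (auto simp: eq_commute[of "l *\<^sub>R _"])
qed

lemma perturbed_op_iff:
  "(w, y) \<in> op_shift (perturbed_op TA TB F G) (complex_of_real l) \<longleftrightarrow>
    (\<exists>a b. (fst w, a) \<in> TA \<and> (snd w, b) \<in> TB \<and>
       y = (- b - G (snd w) - l *\<^sub>R fst w, a + F (fst w) - l *\<^sub>R snd w))"
  by (cases w; cases y) (auto simp: op_shift_iff perturbed_op_def op_plus_def block_op_def op_of_def
      block_blinfun.rep_eq scaleC_prod_def scaleC_of_real algebra_simps)

lemma eigenvalue_in_Spec:
  assumes "w \<in> op_ker (op_shift T z)" "w \<noteq> 0" "(0, 0) \<in> op_shift T z"
  shows "z \<in> Spec T"
proof (rule ccontr)
  assume "z \<notin> Spec T"
  then obtain R :: "'a \<Rightarrow>\<^sub>L 'a" where "(op_shift T z)\<inverse> = op_of (blinfun_apply R)"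
    by (auto simp: Spec_def resolvent_set_def)
  then have "(y, x) \<in> op_of (blinfun_apply R)" if "(x, y) \<in> op_shift T z" for x y
    using that by (metis converse_iff)
  then have R: "x = R y" if "(x, y) \<in> op_shift T z" for x y
    using that by (fastforce simp: op_of_def)
  have "(w, 0) \<in> op_shift T z" using assms(1) by (simp add: op_ker_def)
  from R[OF this] R[OF assms(3)] show False using assms(2) by simp
qed

lemma one_dimensional:
  assumes "csubspace V" "cdim V = 1" "u \<in> V" "u \<noteq> 0" "v \<in> V"
  shows "\<exists>a. v = a *\<^sub>C u"
proof -
  obtain B where B: "B \<subseteq> V" "complex_vector.independent B" "V \<subseteq> cspan B" "card B = cdim V"
    using complex_vector.basis_exists[of V] by blast
  then obtain b where "B = {b}" using assms(2) card_1_singletonE by metis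
  then have span: "\<And>x. x \<in> V \<Longrightarrow> \<exists>k. x = k *\<^sub>C b"
    using B(3) by (auto simp: complex_vector.span_singleton)
  obtain k l where k: "u = k *\<^sub>C b" and l: "v = l *\<^sub>C b" using span assms by metis
  have "k \<noteq> 0" using k assms(4) by auto
  then have "v = (l / k) *\<^sub>C u" by (simp add: k l scaleC_scaleC)
  then show ?thesis by blast
qed

section \<open>Regularity of the families\<close>

lemma onorm_on_bound:
  assumes "\<And>x. x \<in> D \<Longrightarrow> norm (f x) \<le> K * \<nu> x" "\<And>x. x \<in> D \<Longrightarrow> 0 \<le> \<nu> x" "x \<in> D"
  shows "norm (f x) \<le> onorm_on D \<nu> f * \<nu> x"
proof (cases "\<nu> x = 0")
  case False
  then have "\<nu> x > 0" using assms(2,3) by (simp add: order_less_le)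
  have "norm (f y) / \<nu> y \<le> \<bar>K\<bar>" if "y \<in> D" for y
  proof -
    have "norm (f y) \<le> \<bar>K\<bar> * \<nu> y"
      using assms(1,2)[OF that] by (meson abs_ge_self mult_right_mono order_trans)
    then show ?thesis using assms(2)[OF that] by (cases "\<nu> y = 0") (auto simp: divide_le_eq)
  qed
  then have "norm (f x) / \<nu> x \<le> onorm_on D \<nu> f"
    unfolding onorm_on_def using assms(3) by (intro cSUP_upper) (auto intro!: bdd_aboveI)
  then show ?thesis using \<open>\<nu> x > 0\<close> by (simp add: divide_le_eq)
qed (use assms in fastforce)

lemma onorm_tendsto_0_bound:
  fixes t e :: real
  assumes lim: "((\<lambda>s. onorm_on D \<nu> (f s)) \<longlongrightarrow> 0) (at t within I)" and "e > 0"
    and f: "\<And>s. s \<in> I \<Longrightarrow> s \<noteq> t \<Longrightarrow> \<exists>K. \<forall>x\<in>D. norm (f s x) \<le> K * \<nu> x" and \<nu>: "\<And>x. x \<in> D \<Longrightarrow> 0 \<le> \<nu> x"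
  shows "\<exists>d>0. \<forall>s\<in>I. s \<noteq> t \<longrightarrow> \<bar>s - t\<bar> < d \<longrightarrow> (\<forall>x\<in>D. norm (f s x) \<le> e * \<nu> x)"
proof -
  obtain d where "d > 0" and d': "\<forall>s\<in>I. s \<noteq> t \<and> dist s t < d \<longrightarrow> dist (onorm_on D \<nu> (f s)) 0 < e"
    using tendstoD[OF lim \<open>e > 0\<close>] unfolding eventually_at by blast
  have d: "onorm_on D \<nu> (f s) < e" if "s \<in> I" "s \<noteq> t" "\<bar>s - t\<bar> < d" for s
    using bspec[OF d' that(1)] that by (simp add: dist_real_def)
  have "norm (f s x) \<le> e * \<nu> x" if s: "s \<in> I" "s \<noteq> t" "\<bar>s - t\<bar> < d" and x: "x \<in> D" for s x
  proof -
    obtain K where "\<And>x. x \<in> D \<Longrightarrow> norm (f s x) \<le> K * \<nu> x" using f s by blast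
    then have "norm (f s x) \<le> onorm_on D \<nu> (f s) * \<nu> x" using \<nu> x by (intro onorm_on_bound)
    also have "\<dots> \<le> e * \<nu> x" using d[OF s] by (intro mult_right_mono \<nu> x) auto
    finally show ?thesis .
  qed
  then show ?thesis using \<open>d > 0\<close> by blast
qed

text \<open>The operator norm is a supremum of reals and bounds the map only if the set is bounded above,
  hence the detour through some bound \<open>K\<close> for the difference quotients.\<close>

lemma has_onorm_derivative_on_bound:
  assumes T: "\<And>t. t \<in> I \<Longrightarrow> bounded_clinear_on D \<nu> (T t)" "\<And>t. t \<in> I \<Longrightarrow> bounded_clinear_on D \<nu> (T' t)"
    and der: "has_onorm_derivative_on D \<nu> I T T'" and "t \<in> I" "e > (0::real)" and \<nu>: "\<And>x. x \<in> D \<Longrightarrow> 0 \<le> \<nu> x"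
  shows "\<exists>d>0. \<forall>s\<in>I. \<bar>s - t\<bar> < d \<longrightarrow>
    (\<forall>x\<in>D. norm (T s x - T t x - (s - t) *\<^sub>R T' t x) \<le> e * \<bar>s - t\<bar> * \<nu> x)"
proof -
  let ?f = "\<lambda>s x. (T s x - T t x) /\<^sub>R (s - t) - T' t x"
  have bnd: "\<exists>K. \<forall>x\<in>D. norm (?f s x) \<le> K * \<nu> x" if s: "s \<in> I" "s \<noteq> t" for s
  proof -
    obtain K1 K2 K3 where K: "\<And>x. x \<in> D \<Longrightarrow> norm (T s x) \<le> K1 * \<nu> x" "\<And>x. x \<in> D \<Longrightarrow> norm (T t x) \<le> K2 * \<nu> x"
      "\<And>x. x \<in> D \<Longrightarrow> norm (T' t x) \<le> K3 * \<nu> x"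
      using T s \<open>t \<in> I\<close> unfolding bounded_clinear_on_def by meson
    have "norm (?f s x) \<le> ((K1 + K2) / \<bar>s - t\<bar> + K3) * \<nu> x" if x: "x \<in> D" for x
    proof -
      have "norm (?f s x) \<le> norm (T s x - T t x) / \<bar>s - t\<bar> + norm (T' t x)"
        by (rule order_trans[OF norm_triangle_ineq4]) (simp add: divide_inverse mult.commute)
      also have "\<dots> \<le> (K1 * \<nu> x + K2 * \<nu> x) / \<bar>s - t\<bar> + K3 * \<nu> x"
        by (intro add_mono divide_right_mono order_trans[OF norm_triangle_ineq4] K x) auto
      finally show ?thesis by (simp add: algebra_simps add_divide_distrib)
    qed
    then show ?thesis by blast
  qed
  from onorm_tendsto_0_bound[where f = ?f and I = I and t = t, OF _ \<open>e > 0\<close> bnd \<nu>]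
  obtain d where "d > 0" and d: "\<And>s x. s \<in> I \<Longrightarrow> s \<noteq> t \<Longrightarrow> \<bar>s - t\<bar> < d \<Longrightarrow> x \<in> D \<Longrightarrow> norm (?f s x) \<le> e * \<nu> x"
    using der \<open>t \<in> I\<close> unfolding has_onorm_derivative_on_def by blast
  have "norm (T s x - T t x - (s - t) *\<^sub>R T' t x) \<le> e * \<bar>s - t\<bar> * \<nu> x"
    if "s \<in> I" "\<bar>s - t\<bar> < d" "x \<in> D" for s x
  proof (cases "s = t")
    case False
    then have "T s x - T t x - (s - t) *\<^sub>R T' t x = (s - t) *\<^sub>R ?f s x" by (simp add: scaleR_diff_right)
    then show ?thesis
      using mult_left_mono[OF d[OF that(1) False that(2,3)], of "\<bar>s - t\<bar>"] by (simp add: mult_ac)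
  qed (use \<nu> that in simp)
  then show ?thesis using \<open>d > 0\<close> by blast
qed

lemma C2_onorm_on_imp_C1_family_on:
  assumes C2: "C2_onorm_on D \<nu> I T" and J: "J \<subseteq> I"
    and \<nu>: "\<And>x. x \<in> D \<Longrightarrow> 0 \<le> \<nu> x" "\<And>x. x \<in> D \<Longrightarrow> \<nu> x \<le> C * \<mu> x" and "C > 0"
  shows "\<exists>T'. C1_family_on D \<mu> J T T'"
proof -
  obtain T1 T2 where T: "\<And>t. t \<in> I \<Longrightarrow> bounded_clinear_on D \<nu> (T t)" "\<And>t. t \<in> I \<Longrightarrow> bounded_clinear_on D \<nu> (T1 t)"
      "\<And>t. t \<in> I \<Longrightarrow> bounded_clinear_on D \<nu> (T2 t)"
    and der: "has_onorm_derivative_on D \<nu> I T T1" "has_onorm_derivative_on D \<nu> I T1 T2"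
    using C2 unfolding C2_onorm_on_def by blast
  have bd: "bounded_clinear_on D \<mu> f" if f: "bounded_clinear_on D \<nu> f" for f :: "'a \<Rightarrow> 'b"
  proof -
    obtain K where "clinear_on D f" and K: "\<And>x. x \<in> D \<Longrightarrow> norm (f x) \<le> K * \<nu> x"
      using f by (auto simp: bounded_clinear_on_def)
    have "norm (f x) \<le> (\<bar>K\<bar> * C) * \<mu> x" if x: "x \<in> D" for x
    proof -
      have "norm (f x) \<le> \<bar>K\<bar> * \<nu> x" using K[OF x] \<nu>(1)[OF x] by (meson abs_ge_self mult_right_mono order_trans)
      also have "\<dots> \<le> \<bar>K\<bar> * (C * \<mu> x)" by (intro mult_left_mono \<nu> x) auto
      finally show ?thesis by simp
    qed
    then show ?thesis using \<open>clinear_on D f\<close> by (auto simp: bounded_clinear_on_def)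
  qed
  have "\<exists>d>0. \<forall>s\<in>J. \<bar>s - t\<bar> < d \<longrightarrow> (\<forall>w\<in>D.
        norm (T s w - T t w - (s - t) *\<^sub>R T1 t w) \<le> e * \<bar>s - t\<bar> * \<mu> w \<and>
        norm (T1 s w - T1 t w) \<le> e * \<mu> w)" if t: "t \<in> I" and "e > 0" for t e
  proof -
    have eC: "e / C > 0" using \<open>e > 0\<close> \<open>C > 0\<close> by simp
    obtain d1 where d1: "d1 > 0" "\<And>s x. s \<in> I \<Longrightarrow> \<bar>s - t\<bar> < d1 \<Longrightarrow> x \<in> D \<Longrightarrow>
        norm (T s x - T t x - (s - t) *\<^sub>R T1 t x) \<le> e / C * \<bar>s - t\<bar> * \<nu> x"
      using has_onorm_derivative_on_bound[OF T(1,2) der(1) t eC \<nu>(1)] by blast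
    obtain d2 where d2: "d2 > 0" "\<And>s x. s \<in> I \<Longrightarrow> \<bar>s - t\<bar> < d2 \<Longrightarrow> x \<in> D \<Longrightarrow>
        norm (T1 s x - T1 t x - (s - t) *\<^sub>R T2 t x) \<le> 1 * \<bar>s - t\<bar> * \<nu> x"
      using has_onorm_derivative_on_bound[OF T(2,3) der(2) t zero_less_one \<nu>(1)] by blast
    obtain K where K: "\<And>x. x \<in> D \<Longrightarrow> norm (T2 t x) \<le> K * \<nu> x"
      using T(3)[OF t] by (auto simp: bounded_clinear_on_def)
    define d where "d = Min {d1, d2, e / C / (1 + \<bar>K\<bar>)}"
    have "d > 0" using d1 d2 \<open>e > 0\<close> \<open>C > 0\<close> by (simp add: d_def add_pos_nonneg)
    have e\<nu>: "e / C * r * \<nu> x \<le> e * r * \<mu> x" if "x \<in> D" "r \<ge> 0" for x r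
    proof -
      have "e / C * r * \<nu> x \<le> e / C * r * (C * \<mu> x)"
        using that \<open>e > 0\<close> \<open>C > 0\<close> by (intro mult_left_mono \<nu>) auto
      then show ?thesis using \<open>C > 0\<close> by (simp add: field_simps)
    qed
    have "norm (T s w - T t w - (s - t) *\<^sub>R T1 t w) \<le> e * \<bar>s - t\<bar> * \<mu> w \<and> norm (T1 s w - T1 t w) \<le> e * \<mu> w"
      if s: "s \<in> J" "\<bar>s - t\<bar> < d" and w: "w \<in> D" for s w
    proof
      have sd: "s \<in> I" "\<bar>s - t\<bar> < d1" "\<bar>s - t\<bar> < d2" "\<bar>s - t\<bar> < e / C / (1 + \<bar>K\<bar>)"
        using s J by (auto simp: d_def)
      show "norm (T s w - T t w - (s - t) *\<^sub>R T1 t w) \<le> e * \<bar>s - t\<bar> * \<mu> w"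
        using d1(2)[OF sd(1,2) w] e\<nu>[OF w, of "\<bar>s - t\<bar>"] by simp
      have Ks: "(1 + \<bar>K\<bar>) * \<bar>s - t\<bar> < e / C"
        using sd(4) by (subst (asm) pos_less_divide_eq) (auto simp: mult.commute)
      have KK: "norm (T2 t w) \<le> \<bar>K\<bar> * \<nu> w"
        using K[OF w] \<nu>(1)[OF w] by (meson abs_ge_self mult_right_mono order_trans)
      have "norm (T1 s w - T1 t w) = norm ((T1 s w - T1 t w - (s - t) *\<^sub>R T2 t w) + (s - t) *\<^sub>R T2 t w)" by simp
      also have "\<dots> \<le> 1 * \<bar>s - t\<bar> * \<nu> w + \<bar>s - t\<bar> * (\<bar>K\<bar> * \<nu> w)"
        using KK by (intro order_trans[OF norm_triangle_ineq] add_mono d2 sd w) (auto intro!: mult_left_mono)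
      also have "\<dots> = ((1 + \<bar>K\<bar>) * \<bar>s - t\<bar>) * \<nu> w" by (simp add: algebra_simps)
      also have "\<dots> \<le> e / C * 1 * \<nu> w"
        using Ks by (intro mult_right_mono \<nu> w) simp
      also have "\<dots> \<le> e * 1 * \<mu> w" by (intro e\<nu> w) auto
      finally show "norm (T1 s w - T1 t w) \<le> e * \<mu> w" by simp
    qed
    then show ?thesis using \<open>d > 0\<close> by blast
  qed
  then have "C1_family_on D \<mu> J T T1"
    unfolding C1_family_on_def using J T bd by blast
  then show ?thesis by (rule exI[of _ T1])
qed

lemma C1_family_on_const:
  assumes "bounded_clinear_on D \<mu> f" "\<And>w. w \<in> D \<Longrightarrow> 0 \<le> \<mu> w"
  shows "C1_family_on D \<mu> J (\<lambda>_. f) (\<lambda>_ _. 0)"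
proof -
  have "bounded_clinear_on D \<mu> (\<lambda>_. 0)"
    by (auto simp: bounded_clinear_on_def clinear_on_def intro!: exI[of _ 0])
  then show ?thesis using assms
    by (auto simp: C1_family_on_def intro!: exI[of _ 1])
qed

lemma C2_on_imp_C1:
  assumes "C2_on I f" "open J" "J \<subseteq> I"
  obtains f' where "\<And>t. t \<in> J \<Longrightarrow> (f has_vector_derivative f' t) (at t)" "continuous_on J f'"
proof -
  obtain f1 f2 where f: "\<And>t. t \<in> I \<Longrightarrow> (f has_vector_derivative f1 t) (at t within I)"
    "\<And>t. t \<in> I \<Longrightarrow> (f1 has_vector_derivative f2 t) (at t within I)"
    using assms(1) unfolding C2_on_def by blast
  have at: "(g has_vector_derivative g') (at t)" if "(g has_vector_derivative g') (at t within I)" "t \<in> J"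
    for g :: "real \<Rightarrow> 'a" and g' t
    using has_vector_derivative_within_subset[OF that(1) assms(3)] at_within_open[OF that(2) assms(2)] by simp
  show thesis
  proof
    show "continuous_on J f1"
      using at f(2) assms(3) by (intro continuous_at_imp_continuous_on ballI has_vector_derivative_continuous) blast
  qed (use at f(1) assms(3) in blast)
qed

section \<open>The two-component boundary value problem\<close>

lemma csubspace_op_ker:
  assumes "csubspace T"
  shows "csubspace (op_ker T)"
proof (rule csubspaceI)
  show "0 \<in> op_ker T" using csubspaceD(1)[OF assms] by (simp add: op_ker_def zero_prod_def)
  show "x + y \<in> op_ker T" if "x \<in> op_ker T" "y \<in> op_ker T" for x y
    using csubspaceD(2)[OF assms, of "(x, 0)" "(y, 0)"] that by (simp add: op_ker_def)
  show "a *\<^sub>C x \<in> op_ker T" if "x \<in> op_ker T" for a x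
    using csubspaceD(4)[OF assms, of "(x, 0)" a] that by (simp add: op_ker_def scaleC_prod_def[of a "(x, 0)"])
qed

lemma orthogonal_projection_idem: "orthogonal_projection T \<Longrightarrow> T (T x) = T x"
  unfolding orthogonal_projection_def by blast

definition prod_blinfun :: "('a::real_normed_vector \<Rightarrow>\<^sub>L 'a) \<Rightarrow> ('b::real_normed_vector \<Rightarrow>\<^sub>L 'b) \<Rightarrow> ('a \<times> 'b) \<Rightarrow>\<^sub>L ('a \<times> 'b)"
  where "prod_blinfun P Q = (inl_blinfun o\<^sub>L (P o\<^sub>L fst_blinfun)) + (inr_blinfun o\<^sub>L (Q o\<^sub>L snd_blinfun))"

lemma prod_blinfun_apply [simp]: "prod_blinfun P Q z = (P (fst z), Q (snd z))"
  by (simp add: prod_blinfun_def blinfun.add_left)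

lemma range_prod_blinfun: "range (prod_blinfun P Q) = range P \<times> range Q"
  by (auto simp: image_iff)

lemma prod_blinfun_has_vector_derivative:
  assumes "(P has_vector_derivative P') (at t)" "(Q has_vector_derivative Q') (at t)"
  shows "((\<lambda>t. prod_blinfun (P t) (Q t)) has_vector_derivative prod_blinfun P' Q') (at t)"
  unfolding prod_blinfun_def
  by (intro has_vector_derivative_add assms
      bounded_linear.has_vector_derivative[OF bounded_bilinear.bounded_linear_left[OF bounded_bilinear_blinfun_compose]]
      bounded_linear.has_vector_derivative[OF bounded_bilinear.bounded_linear_right[OF bounded_bilinear_blinfun_compose]])

lemma continuous_on_prod_blinfun:
  assumes "continuous_on J P" "continuous_on J Q"
  shows "continuous_on J (\<lambda>t. prod_blinfun (P t) (Q t))"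
  unfolding prod_blinfun_def
  by (intro continuous_intros bounded_bilinear.continuous_on[OF bounded_bilinear_blinfun_compose] assms)

definition swap_blinfun :: "('a::real_normed_vector \<times> 'a) \<Rightarrow>\<^sub>L ('a \<times> 'a)"
  where "swap_blinfun = (inl_blinfun o\<^sub>L snd_blinfun) + (inr_blinfun o\<^sub>L fst_blinfun)"

lemma swap_blinfun_apply [simp]: "swap_blinfun w = (snd w, fst w)"
  by (simp add: swap_blinfun_def blinfun.add_left)

text \<open>This is \<open>(N\<^sup>* + V\<^sup>* - l) \<tau>\<close> with \<open>M = A\<^sup>*\<close>, and the point of composing with \<open>\<tau>\<close>: it has \<open>A\<^sup>* + F\<close> and
  \<open>- A\<^sup>* - G\<close> on the diagonal and \<open>- l\<close> off the diagonal, so it is formally symmetric for real \<open>l\<close>.\<close>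

definition coupled_op ::
    "('h::chilbert_space \<times> 'h) set \<Rightarrow> ('h \<Rightarrow>\<^sub>L 'h) \<Rightarrow> ('h \<Rightarrow>\<^sub>L 'h) \<Rightarrow> real \<Rightarrow> 'h \<times> 'h \<Rightarrow> 'h \<times> 'h" where
  "coupled_op M F G l w =
     (op_app M (fst w) + F (fst w) - l *\<^sub>R snd w, - op_app M (snd w) - G (snd w) - l *\<^sub>R fst w)"

lemma clinear_on_coupled_op:
  assumes M: "linear_op M" and FG: "selfadjoint_bounded F" "selfadjoint_bounded G"
  shows "clinear_on (Domain M \<times> Domain M) (coupled_op M F G l)"
  unfolding clinear_on_def
proof safe
  note lin = clinear_onD(1,2)[OF linear_op_app(2)[OF M]]
  fix u v u' v' x y x' y' and a assume uv: "(u, x) \<in> M" "(v, y) \<in> M" 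
  then have D: "u \<in> Domain M" "v \<in> Domain M" by auto
  have "l *\<^sub>R a *\<^sub>C z = a *\<^sub>C l *\<^sub>R z" for z :: 'a
    by (simp add: scaleC_of_real[symmetric] scaleC_scaleC mult.commute)
  then show "coupled_op M F G l (a *\<^sub>C (u, v)) = a *\<^sub>C coupled_op M F G l (u, v)"
    using lin(2)[OF D(1)] lin(2)[OF D(2)]
    by (simp add: coupled_op_def scaleC_prod_def selfadjoint_boundedD(2)[OF FG(1)] selfadjoint_boundedD(2)[OF FG(2)]
        complex_vector.scale_right_diff_distrib scaleC_add_right complex_vector.scale_minus_right)
  assume "(u', x') \<in> M" "(v', y') \<in> M"
  then have D': "u' \<in> Domain M" "v' \<in> Domain M" by auto
  show "coupled_op M F G l ((u, v) + (u', v')) = coupled_op M F G l (u, v) + coupled_op M F G l (u', v')"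
    using lin(1)[OF D(1) D'(1)] lin(1)[OF D(2) D'(2)]
    by (simp add: coupled_op_def blinfun.add_right algebra_simps)
qed

lemma Omega_omega: "Omega f g = omega (fst f) (fst g) - omega (snd f) (snd g)"
  by (simp add: Omega_def calJ_def omega_def cinner_prod_def[of "(_, _)"] cinner_minus_left)

lemma coupled_op_green:
  assumes sv: "single_valued M" and g: "green_identity M \<Gamma>0 \<Gamma>1"
    and FG: "selfadjoint_bounded F" "selfadjoint_bounded G"
    and w: "w \<in> Domain M \<times> Domain M" and v: "v \<in> Domain M \<times> Domain M"
  shows "cinner (coupled_op M F G l w) v - cinner w (coupled_op M F G l v)
    = Omega (Trace_map \<Gamma>0 \<Gamma>1 w) (Trace_map \<Gamma>0 \<Gamma>1 v)"
proof -
  have M: "(fst w, op_app M (fst w)) \<in> M" "(snd w, op_app M (snd w)) \<in> M"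
      "(fst v, op_app M (fst v)) \<in> M" "(snd v, op_app M (snd v)) \<in> M"
    using w v op_app_iff[OF sv] by (auto simp: mem_Times_iff)
  show ?thesis
    unfolding Omega_omega Trace_map_def fst_conv snd_conv
      green_identity_omega[OF g M(1) M(3), symmetric] green_identity_omega[OF g M(2) M(4), symmetric]
    by (simp add: coupled_op_def cinner_prod_def[of w] cinner_prod_def[of _ v]
        cinner_add_left cinner_add_right cinner_diff_left cinner_diff_right cinner_minus_left cinner_minus_right
        cinner_scaleR_left cinner_scaleR_right selfadjoint_boundedD(1)[OF FG(1)] selfadjoint_boundedD(1)[OF FG(2)])
qed

text \<open>The graph norms of \<open>M\<close> and of the coupled operator are equivalent, because the two operators
  differ by bounded terms.\<close>

lemma graph_norm2_le:
  assumes "w \<in> Domain M \<times> Domain M"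
  shows "graph_norm2 M w \<le> (2 + 2 * (norm F + norm G + \<bar>l\<bar>)) * (norm w + norm (coupled_op M F G l w))"
proof -
  let ?c = "coupled_op M F G l w"
  have a: "norm (op_app M (fst w)) \<le> norm ?c + (norm F + \<bar>l\<bar>) * norm w"
  proof -
    have "op_app M (fst w) = fst ?c - F (fst w) + l *\<^sub>R snd w" by (simp add: coupled_op_def)
    then have "norm (op_app M (fst w)) = norm (fst ?c - F (fst w) + l *\<^sub>R snd w)" by simp
    also have "\<dots> \<le> norm (fst ?c) + norm (F (fst w)) + norm (l *\<^sub>R snd w)"
      by (intro order_trans[OF norm_triangle_ineq] add_mono norm_triangle_ineq4 order_refl)
    also have "\<dots> \<le> norm ?c + norm F * norm w + \<bar>l\<bar> * norm w"
      using norm_blinfun[of F "fst w"] mult_left_mono[OF norm_fst_le_norm[of w], of "norm F"]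
        mult_left_mono[OF norm_snd_le_norm[of w], of "\<bar>l\<bar>"] norm_fst_le_norm[of ?c] by simp
    finally show ?thesis by (simp add: algebra_simps)
  qed
  have b: "norm (op_app M (snd w)) \<le> norm ?c + (norm G + \<bar>l\<bar>) * norm w"
  proof -
    have "op_app M (snd w) = - (snd ?c + G (snd w) + l *\<^sub>R fst w)" by (simp add: coupled_op_def)
    then have "norm (op_app M (snd w)) = norm (snd ?c + G (snd w) + l *\<^sub>R fst w)"
      by (simp only: norm_minus_cancel)
    also have "\<dots> \<le> norm (snd ?c) + norm (G (snd w)) + norm (l *\<^sub>R fst w)"
      by (intro order_trans[OF norm_triangle_ineq] add_mono norm_triangle_ineq order_refl)
    also have "\<dots> \<le> norm ?c + norm G * norm w + \<bar>l\<bar> * norm w"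
      using norm_blinfun[of G "snd w"] mult_left_mono[OF norm_snd_le_norm[of w], of "norm G"]
        mult_left_mono[OF norm_fst_le_norm[of w], of "\<bar>l\<bar>"] norm_snd_le_norm[of ?c] by simp
    finally show ?thesis by (simp add: algebra_simps)
  qed
  have "graph_norm2 M w \<le> norm (graph_norm M (fst w)) + norm (graph_norm M (snd w))"
    unfolding graph_norm2_def by (rule norm_Pair_le)
  also have "\<dots> \<le> (norm (fst w) + norm (op_app M (fst w))) + (norm (snd w) + norm (op_app M (snd w)))"
    unfolding graph_norm_def real_norm_def abs_norm_cancel by (intro add_mono norm_Pair_le)
  also have "\<dots> \<le> (norm w + (norm ?c + (norm F + \<bar>l\<bar>) * norm w)) + (norm w + (norm ?c + (norm G + \<bar>l\<bar>) * norm w))"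
    by (intro add_mono a b norm_fst_le_norm norm_snd_le_norm)
  also have "\<dots> \<le> (2 + 2 * (norm F + norm G + \<bar>l\<bar>)) * (norm w + norm ?c)"
  proof -
    have "0 \<le> norm F * norm w" "0 \<le> norm G * norm w" "0 \<le> norm F * norm ?c" "0 \<le> norm G * norm ?c"
      "0 \<le> \<bar>l\<bar> * norm ?c" by auto
    then show ?thesis by (simp add: algebra_simps)
  qed
  finally show ?thesis .
qed

lemma op_ker_boundary_op_eq:
  assumes A: "(0, 0) \<in> A" "densely_defined A" and FG: "selfadjoint_bounded F" "selfadjoint_bounded G"
  shows "op_ker (boundary_op A F G l)
    = {w \<in> Domain (op_adj A) \<times> Domain (op_adj A). coupled_op (op_adj A) F G l w = 0}"
proof (rule set_eqI)
  fix w
  show "w \<in> op_ker (boundary_op A F G l) \<longleftrightarrow>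
    w \<in> {w \<in> Domain (op_adj A) \<times> Domain (op_adj A). coupled_op (op_adj A) F G l w = 0}"
    unfolding op_ker_boundary_op[OF A(1) FG] op_app_iff[OF single_valued_op_adj[OF A(2)]]
    by (auto simp: coupled_op_def mem_Times_iff zero_prod_def)
qed

text \<open>The self-adjoint extensions are recovered from their boundary conditions, so the shifted
  operator is the coupled operator with its two rows interchanged.\<close>

lemma perturbed_op_coupled:
  fixes P Q :: "('k::chilbert_space \<times> 'k) \<Rightarrow>\<^sub>L ('k \<times> 'k)"
  assumes A: "densely_defined A" and g: "green_identity (op_adj A) \<Gamma>0 \<Gamma>1"
    and TA: "selfadjoint_op TA" "A \<subseteq> TA" "trace_map \<Gamma>0 \<Gamma>1 ` Domain TA = range P"
    and TB: "selfadjoint_op TB" "A \<subseteq> TB" "trace_map \<Gamma>0 \<Gamma>1 ` Domain TB = range Q"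
    and P: "orthogonal_projection P" "lagrangian (range P)"
    and Q: "orthogonal_projection Q" "lagrangian (range Q)"
  shows "(w, y) \<in> op_shift (perturbed_op TA TB F G) (complex_of_real l) \<longleftrightarrow>
    w \<in> Domain (op_adj A) \<times> Domain (op_adj A) \<and>
    prod_blinfun P Q (Trace_map \<Gamma>0 \<Gamma>1 w) = Trace_map \<Gamma>0 \<Gamma>1 w \<and>
    prod.swap y = coupled_op (op_adj A) F G l w"
proof -
  have ran: "z \<in> range R \<longleftrightarrow> R z = z" if "orthogonal_projection R" for R :: "('k \<times> 'k) \<Rightarrow>\<^sub>L ('k \<times> 'k)" and z
    using that unfolding orthogonal_projection_def by (metis rangeE rangeI)
  note app = op_app_iff[OF single_valued_op_adj[OF A]]
  show ?thesis
    unfolding perturbed_op_iff selfadjoint_extension_eq[OF TA(1,2) g TA(3) P(2)]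
      selfadjoint_extension_eq[OF TB(1,2) g TB(3) Q(2)] app ran[OF P(1)] ran[OF Q(1)]
    by (cases y) (auto simp: coupled_op_def mem_Times_iff Trace_map_def)
qed

section \<open>The eigenvalue curves\<close>

text \<open>The values of both crossing forms at \<open>q\<close> turn out to be \<open>(norm u)\<^sup>2\<close> times the corresponding partial
  derivatives of the eigenvalue function, so the two curves are its zero set, written as a graph over either variable.\<close>

theorem theorem4p2:
  fixes A :: "('h::chilbert_space \<times> 'h) set"
    and \<A> \<B> :: "real \<Rightarrow> ('h \<times> 'h) set"
    and \<Gamma>0 \<Gamma>1 :: "real \<Rightarrow> 'h \<Rightarrow> 'k::chilbert_space"
    and P Q :: "real \<Rightarrow> ('k \<times> 'k) \<Rightarrow>\<^sub>L ('k \<times> 'k)"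
    and F G :: "real \<Rightarrow> 'h \<Rightarrow>\<^sub>L 'h"
    and lam0 t0 :: real and I :: "real set" and u :: "'h \<times> 'h"
  assumes separable: "separable_space (euclidean :: 'h topology)"
      "separable_space (euclidean :: 'k topology)"
    and A: "linear_op A" "closed A" "densely_defined A" "symmetric_op A"
    and deficiency: "finite_cdim (op_ker (op_shift (op_adj A) (- \<i>)))"
      "finite_cdim (op_ker (op_shift (op_adj A) \<i>))"
      "cdim (op_ker (op_shift (op_adj A) (- \<i>))) = cdim (op_ker (op_shift (op_adj A) \<i>))"
    and trace: "\<And>t. t \<in> {0..1} \<Longrightarrow>
        bounded_clinear_on (Domain (op_adj A)) (graph_norm (op_adj A)) (trace_map (\<Gamma>0 t) (\<Gamma>1 t))"
      "\<And>t. t \<in> {0..1} \<Longrightarrow> trace_map (\<Gamma>0 t) (\<Gamma>1 t) ` Domain (op_adj A) = UNIV"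
      "\<And>t. t \<in> {0..1} \<Longrightarrow> green_identity (op_adj A) (\<Gamma>0 t) (\<Gamma>1 t)"
    and proj: "\<And>t. t \<in> {0..1} \<Longrightarrow> orthogonal_projection (P t) \<and> lagrangian (range (P t))"
      "\<And>t. t \<in> {0..1} \<Longrightarrow> orthogonal_projection (Q t) \<and> lagrangian (range (Q t))"
    and ext: "\<And>t. t \<in> {0..1} \<Longrightarrow> selfadjoint_op (\<A> t) \<and> A \<subseteq> \<A> t"
      "\<And>t. t \<in> {0..1} \<Longrightarrow> selfadjoint_op (\<B> t) \<and> A \<subseteq> \<B> t"
      "\<And>t. t \<in> {0..1} \<Longrightarrow> trace_map (\<Gamma>0 t) (\<Gamma>1 t) ` Domain (\<A> t) = range (P t)"
      "\<And>t. t \<in> {0..1} \<Longrightarrow> trace_map (\<Gamma>0 t) (\<Gamma>1 t) ` Domain (\<B> t) = range (Q t)"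
    and FG: "\<And>t. t \<in> {0..1} \<Longrightarrow> selfadjoint_bounded (F t) \<and> selfadjoint_bounded (G t)"
    and t0: "t0 \<in> {0<..<1}"
    and i: "complex_of_real lam0 \<notin> Spec_ess (perturbed_op (\<A> t0) (\<B> t0) (F t0) (G t0))"
    and ii: "cdim (op_ker (op_shift (perturbed_op (\<A> t0) (\<B> t0) (F t0) (G t0)) (complex_of_real lam0))) = 1"
      "u \<in> op_ker (op_shift (perturbed_op (\<A> t0) (\<B> t0) (F t0) (G t0)) (complex_of_real lam0))" "u \<noteq> 0"
    and I: "is_interval I" "I \<subseteq> {0..1}" "t0 \<in> interior I"
    and iii: "C2_on I (\<lambda>t. block_blinfun (G t) (F t))" "C2_on I P" "C2_on I Q"
      "C2_onorm_on (Domain (op_adj A) \<times> Domain (op_adj A)) (graph_norm2 (op_adj A)) I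
        (\<lambda>t. Trace_map (\<Gamma>0 t) (\<Gamma>1 t))"
    and iv: "\<forall>\<^sub>F l in nhds lam0. \<forall>t\<in>I.
        op_ker (boundary_op A (F t) (G t) l) \<inter> Domain (block_op A A O op_of prod.swap) = {0}"
  shows "let q = (Trace_map (\<Gamma>0 t0) (\<Gamma>1 t0) u, Trace_map (\<Gamma>0 t0) (\<Gamma>1 t0) u);
             m_t = crossing_form (\<lambda>t. Upsilon A \<Gamma>0 \<Gamma>1 P Q F G lam0 t) t0 q q;
             m_l = crossing_form (\<lambda>l. Upsilon A \<Gamma>0 \<Gamma>1 P Q F G l t0) lam0 q q
         in (m_l \<noteq> 0 \<longrightarrow>
              (\<exists>\<epsilon>>0. \<exists>\<mu> :: real \<Rightarrow> real.
                 {t0 - \<epsilon><..<t0 + \<epsilon>} \<subseteq> {0..1} \<and>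
                 \<mu> C1_differentiable_on {t0 - \<epsilon><..<t0 + \<epsilon>} \<and> \<mu> t0 = lam0 \<and>
                 (\<forall>t\<in>{t0 - \<epsilon><..<t0 + \<epsilon>}.
                    complex_of_real (\<mu> t) \<in> Spec (perturbed_op (\<A> t) (\<B> t) (F t) (G t))) \<and>
                 complex_of_real (deriv \<mu> t0) = - m_t / m_l)) \<and>
            (m_t \<noteq> 0 \<longrightarrow>
              (\<exists>\<epsilon>>0. \<exists>\<theta> :: real \<Rightarrow> real.
                 \<theta> ` {lam0 - \<epsilon><..<lam0 + \<epsilon>} \<subseteq> {0..1} \<and>
                 \<theta> C1_differentiable_on {lam0 - \<epsilon><..<lam0 + \<epsilon>} \<and> \<theta> lam0 = t0 \<and>
                 (\<forall>l\<in>{lam0 - \<epsilon><..<lam0 + \<epsilon>}.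
                    complex_of_real l \<in>
                      Spec (perturbed_op (\<A> (\<theta> l)) (\<B> (\<theta> l)) (F (\<theta> l)) (G (\<theta> l)))) \<and>
                 complex_of_real (deriv \<theta> lam0) = - m_l / m_t))"
proof -
  let ?M = "op_adj A"
  define D where "D = Domain ?M \<times> Domain ?M"
  define Tr where "Tr t = Trace_map (\<Gamma>0 t) (\<Gamma>1 t)" for t
  define S where "S = coupled_op ?M (F t0) (G t0) lam0"
  define R where "R t = prod_blinfun (P t) (Q t)" for t
  define V where "V t = block_blinfun (G t) (F t)" for t
  define B where "B t = swap_blinfun o\<^sub>L (V t - V t0)" for t
  define L :: "('h \<times> 'h) \<Rightarrow>\<^sub>L ('h \<times> 'h)" where "L = - swap_blinfun"
  have A0: "(0, 0) \<in> A" using csubspaceD(1)[of A] A(1) by (simp add: linear_op_def zero_prod_def)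
  have sv: "single_valued ?M" by (rule single_valued_op_adj[OF A(3)])
  have M: "linear_op ?M" using sv csubspace_op_adj by (simp add: linear_op_def)
  note app = op_app_iff[OF sv]
  define J where "J = interior I"
  have J: "open J" "t0 \<in> J" "J \<subseteq> I" "J \<subseteq> {0..1}"
    using I interior_subset[of I] by (auto simp: J_def)
  have JU: "t \<in> {0..1}" if "t \<in> J" for t using J(4) that by blast
  have t01: "t0 \<in> {0..1}" using t0 by auto
  have FG': "selfadjoint_bounded (F t)" "selfadjoint_bounded (G t)" if "t \<in> J" for t
    using FG[OF JU[OF that]] by auto
  have D: "csubspace D"
    unfolding D_def by (intro csubspace_Times linear_op_app(1)[OF M])
  have shift: "S w + B t w + (l - lam0) *\<^sub>R L w = coupled_op ?M (F t) (G t) l w" for t l w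
    by (simp add: S_def B_def V_def L_def coupled_op_def block_blinfun.rep_eq blinfun.bilinear_simps algebra_simps)
  have green_family: "cinner (S w) v - cinner w (S v) = Omega (Tr t w) (Tr t v)"
    if "t \<in> {0..1}" "w \<in> D" "v \<in> D" for t w v
    using coupled_op_green[OF sv trace(3)[OF that(1)] _ _ _ _, of "F t0" "G t0" w v lam0] FG[OF t01] that
    by (simp add: D_def S_def Tr_def)
  have pert: "(w, y) \<in> op_shift (perturbed_op (\<A> t) (\<B> t) (F t) (G t)) (complex_of_real l) \<longleftrightarrow>
      w \<in> D \<and> R t (Tr t w) = Tr t w \<and> prod.swap y = coupled_op ?M (F t) (G t) l w" if "t \<in> {0..1}" for t l w y
    using perturbed_op_coupled[OF A(3) trace(3)[OF that], of "\<A> t" "P t" "\<B> t" "Q t" w y "F t" "G t" l]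
      ext[OF that] proj[OF that] by (simp add: D_def R_def Tr_def)
  have S0: "coupled_op ?M (F t0) (G t0) lam0 w = S w" for w by (simp add: S_def)
  have "\<exists>T'. C1_family_on D (\<lambda>w. norm w + norm (S w)) J Tr T'"
    unfolding Tr_def[abs_def]
    by (rule C2_onorm_on_imp_C1_family_on[OF iii(4)[folded D_def] J(3)])
      (use graph_norm2_le[of _ ?M "F t0" "G t0" lam0] in
        \<open>auto simp: D_def S_def graph_norm2_def intro: add_pos_nonneg\<close>)
  then obtain Tr' where Tr': "C1_family_on D (\<lambda>w. norm w + norm (S w)) J Tr Tr'" ..
  have TrB: "bounded_clinear_on D (\<lambda>w. norm w + norm (S w)) (Tr t0)"
    by (rule C1_family_onD(1)[OF Tr' J(2)])
  have u: "u \<in> D" "R t0 (Tr t0 u) = Tr t0 u" "S u = 0"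
    using ii(2) unfolding op_ker_def mem_Collect_eq pert[OF t01] S0 by (auto simp: zero_prod_def)
  \<comment> \<open>If the trace vanished, \<open>u\<close> would lie in the domain of the minimal operator, against \<open>iv\<close>.\<close>
  have "Tr t0 u \<noteq> 0"
  proof
    assume "Tr t0 u = 0"
    then have tr: "trace_map (\<Gamma>0 t0) (\<Gamma>1 t0) (fst u) = 0" "trace_map (\<Gamma>0 t0) (\<Gamma>1 t0) (snd u) = 0"
      by (auto simp: Tr_def Trace_map_def zero_prod_def)
    have in_A: "v \<in> Domain A" if v: "v \<in> Domain ?M" "trace_map (\<Gamma>0 t0) (\<Gamma>1 t0) v = 0" for v
    proof -
      have "cinner x' v = cinner x (op_app ?M v)" if "(x, x') \<in> ?M" for x x'
        using green_identity_omega[OF trace(3)[OF t01] that, of v "op_app ?M v"] app v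
        by (auto simp: omega_def)
      then have "(v, op_app ?M v) \<in> op_adj ?M" by (auto simp: op_adj_def)
      then show ?thesis using op_adj_op_adj_subset[OF A(1,2)] by auto
    qed
    have "u \<in> Domain (block_op A A O op_of prod.swap)"
    proof -
      have "fst u \<in> Domain A" "snd u \<in> Domain A"
        using in_A[OF _ tr(1)] in_A[OF _ tr(2)] u(1) by (simp_all add: D_def mem_Times_iff)
      then obtain a b where "(fst u, a) \<in> A" "(snd u, b) \<in> A" by blast
      then have "(u, (- b, a)) \<in> block_op A A" by (cases u) (auto simp: block_op_def)
      then show ?thesis by (auto simp: op_of_def)
    qed
    moreover have "u \<in> op_ker (boundary_op A (F t0) (G t0) lam0)"
      using u(1,3) FG[OF t01] op_ker_boundary_op_eq[OF A0 A(3)] by (simp add: D_def S_def)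
    moreover have "t0 \<in> I" using J by auto
    ultimately show False
      using eventually_nhds_x_imp_x[OF iv] ii(3) by auto
  qed
  have Ridem: "R t (R t z) = R t z" "Omega (R t y) (R t z) = 0" if "t \<in> J" for t y z
  proof -
    have "P t (P t x) = P t x" "Q t (Q t x) = Q t x" for x
      using proj[OF JU[OF that]] orthogonal_projection_idem by blast+
    then show "R t (R t z) = R t z" by (simp add: R_def)
    have "omega (P t x) (P t x') = 0" "omega (Q t x) (Q t x') = 0" for x x'
      using proj[OF JU[OF that]] lagrangian_isotropic by blast+
    then show "Omega (R t y) (R t z) = 0" by (simp add: R_def Omega_omega)
  qed
  interpret simple_eigenvalue D S "Tr t0" "R t0" u
  proof
    show "csubspace D" by (rule D)
    show "clinear_on D S" unfolding D_def S_def using FG[OF t01] M by (intro clinear_on_coupled_op) auto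
    show "clinear_on D (Tr t0)" "\<exists>K. \<forall>w\<in>D. norm (Tr t0 w) \<le> K * (norm w + norm (S w))"
      using TrB by (auto simp: bounded_clinear_on_def)
    show "Tr t0 ` D = UNIV"
      using trace(2)[OF t01] unfolding D_def Tr_def Trace_map_def[abs_def]
      by (simp add: image_paired_Times[unfolded case_prod_unfold])
    have PQ: "selfadjoint_bounded (P t0)" "selfadjoint_bounded (Q t0)"
      using proj[OF t01] by (simp_all add: orthogonal_projection_def)
    have fst_scaleC: "fst (x *\<^sub>C z) = x *\<^sub>C fst z" and snd_scaleC: "snd (x *\<^sub>C z) = x *\<^sub>C snd z"
      and Pair_scaleC: "x *\<^sub>C (fst z, snd z) = (x *\<^sub>C fst z, x *\<^sub>C snd z)" for x and z :: "'k pow4"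
      by (simp_all add: scaleC_prod_def)
    show "clinear_on UNIV (R t0)"
      unfolding clinear_on_def R_def
      using Pair_scaleC[of _ "prod_blinfun (P t0) (Q t0) _"]
      by (simp add: blinfun.add_right fst_scaleC snd_scaleC selfadjoint_boundedD(2)[OF PQ(1)] selfadjoint_boundedD(2)[OF PQ(2)])
    show "R t0 (R t0 z) = R t0 z" "Omega (R t0 y) (R t0 z) = 0" for y z
      by (rule Ridem[OF J(2)])+
    have "{S w | w. w \<in> D \<and> R t0 (Tr t0 w) = Tr t0 w} =
        prod.swap -` Range (op_shift (perturbed_op (\<A> t0) (\<B> t0) (F t0) (G t0)) (complex_of_real lam0))"
      unfolding Range_iff[abs_def] set_eq_iff vimage_def using pert[OF t01] S0 
      by (auto simp: Range_iff)
    moreover have "closed (Range (op_shift (perturbed_op (\<A> t0) (\<B> t0) (F t0) (G t0)) (complex_of_real lam0)))"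
      using i by (simp add: Spec_ess_def fredholm_op_def)
    ultimately show "closed {S w | w. w \<in> D \<and> R t0 (Tr t0 w) = Tr t0 w}"
      by (auto intro!: closed_vimage continuous_intros simp: prod.swap_def)
    fix v assume v: "\<And>w. w \<in> D \<Longrightarrow> R t0 (Tr t0 w) = Tr t0 w \<Longrightarrow> cinner (S w) v = 0"
    have "v \<in> op_ker (op_shift (perturbed_op (\<A> t0) (\<B> t0) (F t0) (G t0)) (complex_of_real lam0))"
    proof -
      let ?T = "op_shift (perturbed_op (\<A> t0) (\<B> t0) (F t0) (G t0)) (complex_of_real lam0)"
      have zero: "(0, 0) \<in> \<A> t0" "(0, 0) \<in> \<B> t0" using A0 ext(1,2)[OF t01] by auto
      have orth: "cinner (prod.swap y) v = 0" if "(w, y) \<in> ?T" for w y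
        using that v[of w] unfolding pert[OF t01] S0 by simp
      have "cinner x' (fst v) = cinner x (lam0 *\<^sub>R snd v - F t0 (fst v))" if "(x, x') \<in> \<A> t0" for x x'
      proof -
        have "((x, 0), (- (lam0 *\<^sub>R x), x' + F t0 x)) \<in> ?T"
          unfolding perturbed_op_iff using that zero
          by (intro exI[of _ x'] exI[of _ 0]) (simp add: zero_prod_def)
        from orth[OF this] show ?thesis
          using FG[OF t01] by (simp add: cinner_prod_def cinner_add_left cinner_diff_right cinner_minus_left
            cinner_scaleR_left cinner_scaleR_right selfadjoint_boundedD(1) algebra_simps)
      qed
      then have "(fst v, lam0 *\<^sub>R snd v - F t0 (fst v)) \<in> op_adj (\<A> t0)" by (auto simp: op_adj_def)
      moreover have "cinner x' (snd v) = cinner x (- (lam0 *\<^sub>R fst v) - G t0 (snd v))" if "(x, x') \<in> \<B> t0" for x x'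
      proof -
        have "((0, x), (- x' - G t0 x, - (lam0 *\<^sub>R x))) \<in> ?T"
          unfolding perturbed_op_iff using that zero
          by (intro exI[of _ 0] exI[of _ x']) simp
        from orth[OF this] have "- cinner x' (snd v) = cinner x (G t0 (snd v)) + of_real lam0 * cinner x (fst v)"
          using FG[OF t01] by (simp add: cinner_prod_def cinner_diff_left cinner_minus_left
            cinner_scaleR_left selfadjoint_boundedD(1) algebra_simps)
        from arg_cong[OF this, of uminus] show ?thesis
          by (simp add: cinner_diff_right cinner_minus_right cinner_scaleR_right)
      qed
      then have "(snd v, - (lam0 *\<^sub>R fst v) - G t0 (snd v)) \<in> op_adj (\<B> t0)" by (auto simp: op_adj_def)
      ultimately have "(fst v, lam0 *\<^sub>R snd v - F t0 (fst v)) \<in> \<A> t0"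
          "(snd v, - (lam0 *\<^sub>R fst v) - G t0 (snd v)) \<in> \<B> t0"
        using ext(1,2)[OF t01] by (simp_all add: selfadjoint_op_def)
      then show ?thesis
        unfolding op_ker_def mem_Collect_eq perturbed_op_iff
        by (intro exI conjI) (assumption, assumption, simp add: zero_prod_def)
    qed
    moreover have "csubspace (op_ker (op_shift (perturbed_op (\<A> t0) (\<B> t0) (F t0) (G t0)) (complex_of_real lam0)))"
      using i by (intro csubspace_op_ker) (simp add: Spec_ess_def fredholm_op_def linear_op_def)
    ultimately show "\<exists>a. v = a *\<^sub>C u" using one_dimensional ii by blast
  qed (use green_family[OF t01] u \<open>Tr t0 u \<noteq> 0\<close> in auto)
  obtain V' where V': "\<And>t. t \<in> J \<Longrightarrow> (V has_vector_derivative V' t) (at t)" "continuous_on J V'"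
    using C2_on_imp_C1[OF iii(1)[folded V_def[abs_def]] J(1,3)] by blast
  obtain P' where P': "\<And>t. t \<in> J \<Longrightarrow> (P has_vector_derivative P' t) (at t)" "continuous_on J P'"
    using C2_on_imp_C1[OF iii(2) J(1,3)] by blast
  obtain Q' where Q': "\<And>t. t \<in> J \<Longrightarrow> (Q has_vector_derivative Q' t) (at t)" "continuous_on J Q'"
    using C2_on_imp_C1[OF iii(3) J(1,3)] by blast
  define B' where "B' t = swap_blinfun o\<^sub>L V' t" for t
  define R' where "R' t = prod_blinfun (P' t) (Q' t)" for t
  have dB: "(B has_vector_derivative B' t) (at t)" if "t \<in> J" for t
  proof -
    have "((\<lambda>t. V t - V t0) has_vector_derivative (V' t - 0)) (at t)"
      by (intro has_vector_derivative_diff V' that has_vector_derivative_const)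
    then show ?thesis
      unfolding B_def[abs_def] B'_def
      using bounded_linear.has_vector_derivative[OF bounded_bilinear.bounded_linear_right[OF bounded_bilinear_blinfun_compose]]
      by fastforce
  qed
  have B0: "B t0 = 0" by (simp add: B_def blinfun_eqI)
  have dR: "(R has_vector_derivative R' t) (at t)" if "t \<in> J" for t
    unfolding R_def[abs_def] R'_def by (intro prod_blinfun_has_vector_derivative P' Q' that)
  have cont: "continuous_on J B'" "continuous_on J R'"
    unfolding B'_def[abs_def] R'_def[abs_def]
    by (intro continuous_on_prod_blinfun V' P' Q' continuous_intros
        bounded_bilinear.continuous_on[OF bounded_bilinear_blinfun_compose])+
  have real: "cinner (H x) x \<in> \<real>" if "selfadjoint_bounded H" for H :: "'h \<Rightarrow>\<^sub>L 'h" and x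
    using selfadjoint_boundedD(1)[OF that, of x x] by (metis Reals_cnj_iff cinner_commute)
  have Breal: "cinner (B t v) v \<in> \<real>" if "t \<in> J" for t v
    using FG'[OF that] FG'[OF J(2)] real
    by (simp add: B_def V_def block_blinfun.rep_eq blinfun.bilinear_simps cinner_prod_def cinner_diff_left
        cinner_minus_left cinner_add_left)
  have Lreal: "cinner (L v) v \<in> \<real>" for v
    by (simp add: L_def blinfun.minus_left cinner_minus_left cinner_prod_def Reals_cnj_iff
        cinner_commute[symmetric] add.commute)
  obtain U c a b where U: "open U" "(lam0, t0) \<in> U" "U \<subseteq> UNIV \<times> J" "c (lam0, t0) = (0::real)"
    and c: "\<And>p. p \<in> U \<Longrightarrow> (c has_derivative (\<lambda>(x, t). x * a p + t * b p)) (at p)"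
    and ab: "continuous_on U a" "continuous_on U b"
    and a0: "of_real (a (lam0, t0) * (norm u)\<^sup>2) = cinner (L u) u"
    and b0: "of_real (b (lam0, t0) * (norm u)\<^sup>2) =
       cinner (B' t0 u) u - Omega (Tr' t0 u) (Tr t0 u) + Omega (R' t0 (Tr t0 u)) (Tr t0 u)"
    and eig: "\<And>x t. (x, t) \<in> U \<Longrightarrow> c (x, t) = 0 \<Longrightarrow>
       \<exists>w\<in>D. w \<noteq> 0 \<and> S w + B t w + (x - lam0) *\<^sub>R L w = 0 \<and> R t (Tr t w) = Tr t w"
    using eigenvalue_function[OF J(1,2) dB cont(1) B0 Breal Lreal dR cont(2) refl Ridem Tr' refl green_family[OF JU], of lam0]
    by blast
  have Spec: "complex_of_real x \<in> Spec (perturbed_op (\<A> t) (\<B> t) (F t) (G t))" if p: "(x, t) \<in> U" "c (x, t) = 0" for x t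
  proof -
    have t: "t \<in> {0..1}" using p U(3) JU by blast
    obtain w where "w \<in> D" "w \<noteq> 0" "coupled_op ?M (F t) (G t) x w = 0" "R t (Tr t w) = Tr t w"
      using eig[OF p] by (auto simp: shift)
    then have "w \<in> op_ker (op_shift (perturbed_op (\<A> t) (\<B> t) (F t) (G t)) (complex_of_real x))"
      unfolding op_ker_def mem_Collect_eq pert[OF t] by (simp add: zero_prod_def)
    moreover have "(0, 0) \<in> op_shift (perturbed_op (\<A> t) (\<B> t) (F t) (G t)) (complex_of_real x)"
      unfolding perturbed_op_iff using A0 ext(1,2)[OF t]
      by (intro exI[of _ 0]) (auto simp: zero_prod_def)
    ultimately show ?thesis using \<open>w \<noteq> 0\<close> by (intro eigenvalue_in_Spec)
  qed
  have Ups: "Upsilon A \<Gamma>0 \<Gamma>1 P Q F G l t = (Tr t ` {w \<in> D. S w + B t w + (l - lam0) *\<^sub>R L w = 0}) \<times> range (R t)"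
    if "t \<in> J" for l t
    unfolding Upsilon_def op_ker_boundary_op_eq[OF A0 A(3) FG'[OF that]] R_def range_prod_blinfun shift D_def Tr_def
    by (rule refl)
  let ?q = "(Tr t0 u, Tr t0 u)"
  have mt: "crossing_form (\<lambda>t. Upsilon A \<Gamma>0 \<Gamma>1 P Q F G lam0 t) t0 ?q ?q = of_real (b (lam0, t0) * (norm u)\<^sup>2)"
    using crossing_form_at_eigenvalue[OF J(1,2) dB[OF J(2)] B0 dR[OF J(2)] refl Ridem(1) Tr' refl green_family[OF JU],
        of "\<lambda>t. Upsilon A \<Gamma>0 \<Gamma>1 P Q F G lam0 t"] Ups[of _ lam0]
    unfolding b0[symmetric] by simp
  have ml: "crossing_form (\<lambda>l. Upsilon A \<Gamma>0 \<Gamma>1 P Q F G l t0) lam0 ?q ?q = of_real (a (lam0, t0) * (norm u)\<^sup>2)"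
  proof -
    have dL: "((\<lambda>l. (l - lam0) *\<^sub>R L) has_vector_derivative L) (at lam0)"
      by (auto intro!: derivative_eq_intros simp: has_vector_derivative_def)
    have "crossing_form (\<lambda>l. Upsilon A \<Gamma>0 \<Gamma>1 P Q F G l t0) lam0 ?q ?q =
        cnj (cinner (L u) u - Omega 0 (Tr t0 u) + Omega (blinfun_apply 0 (Tr t0 u)) (Tr t0 u))"
      by (rule crossing_form_at_eigenvalue[OF open_UNIV UNIV_I dL _ has_vector_derivative_const refl Ridem(1)[OF J(2)]
          C1_family_on_const[OF TrB] refl green_family[OF t01]])
        (use Ups[OF J(2)] B0 in \<open>auto simp: blinfun.scaleR_left\<close>)
    then show ?thesis unfolding a0[symmetric] by (simp add: Omega.zero_left)
  qed
  have nu: "(norm u)\<^sup>2 \<noteq> 0" using norm_u by simp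
  show ?thesis
    unfolding Let_def Tr_def[symmetric] mt ml
  proof (intro conjI impI)
    assume "complex_of_real (a (lam0, t0) * (norm u)\<^sup>2) \<noteq> 0"
    then have "a (lam0, t0) \<noteq> 0" by auto
    from implicit_curve[OF U(1,2) c ab U(4) this]
    obtain e \<mu> where \<mu>: "e > 0" "\<mu> t0 = lam0" "\<mu> C1_differentiable_on {t0 - e<..<t0 + e}"
      "\<And>t. t \<in> {t0 - e<..<t0 + e} \<Longrightarrow> (\<mu> t, t) \<in> U \<and> c (\<mu> t, t) = 0"
      "deriv \<mu> t0 = - b (lam0, t0) / a (lam0, t0)" by blast
    show "\<exists>\<epsilon>>0. \<exists>\<mu>. {t0 - \<epsilon><..<t0 + \<epsilon>} \<subseteq> {0..1} \<and>
        \<mu> C1_differentiable_on {t0 - \<epsilon><..<t0 + \<epsilon>} \<and> \<mu> t0 = lam0 \<and>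
        (\<forall>t\<in>{t0 - \<epsilon><..<t0 + \<epsilon>}. complex_of_real (\<mu> t) \<in> Spec (perturbed_op (\<A> t) (\<B> t) (F t) (G t))) \<and>
        complex_of_real (deriv \<mu> t0) =
          - complex_of_real (b (lam0, t0) * (norm u)\<^sup>2) / complex_of_real (a (lam0, t0) * (norm u)\<^sup>2)"
    proof (intro exI[of _ e] exI[of _ \<mu>] conjI ballI)
      show "{t0 - e<..<t0 + e} \<subseteq> {0..1}" using \<mu>(4) U(3) JU by blast
      show "complex_of_real (deriv \<mu> t0) =
          - complex_of_real (b (lam0, t0) * (norm u)\<^sup>2) / complex_of_real (a (lam0, t0) * (norm u)\<^sup>2)"
        using \<mu>(5) nu by simp
    qed (use \<mu> Spec in auto)
  next
    assume "complex_of_real (b (lam0, t0) * (norm u)\<^sup>2) \<noteq> 0"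
    then have nz: "(b \<circ> prod.swap) (t0, lam0) \<noteq> 0" by auto
    define U2 where "U2 = prod.swap -` U"
    have U2: "open U2" "(t0, lam0) \<in> U2"
      using U(2) unfolding U2_def by (auto intro!: open_vimage U(1) continuous_intros simp: prod.swap_def)
    have c2: "((c \<circ> prod.swap) has_derivative (\<lambda>(x, t). x * (b \<circ> prod.swap) p + t * (a \<circ> prod.swap) p)) (at p)"
      if "p \<in> U2" for p
    proof -
      have "(prod.swap has_derivative prod.swap) (at p)"
        unfolding prod.swap_def by (auto intro!: derivative_eq_intros)
      from has_derivative_compose[OF this c[of "prod.swap p"]] that
      show ?thesis by (simp add: U2_def o_def case_prod_unfold add.commute)
    qed
    have swap: "continuous_on U2 (f \<circ> prod.swap)" if "continuous_on U f" for f :: "real \<times> real \<Rightarrow> real"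
      unfolding o_def by (rule continuous_on_compose2[OF that]) (auto intro!: continuous_intros simp: U2_def prod.swap_def)
    from implicit_curve[OF U2 c2 swap[OF ab(2)] swap[OF ab(1)] _ nz] U(4)
    obtain e \<theta> where \<theta>: "e > 0" "\<theta> lam0 = t0" "\<theta> C1_differentiable_on {lam0 - e<..<lam0 + e}"
      "\<And>l. l \<in> {lam0 - e<..<lam0 + e} \<Longrightarrow> (\<theta> l, l) \<in> U2 \<and> (c \<circ> prod.swap) (\<theta> l, l) = 0"
      "deriv \<theta> lam0 = - (a \<circ> prod.swap) (t0, lam0) / (b \<circ> prod.swap) (t0, lam0)" by auto
    have \<theta>': "(l, \<theta> l) \<in> U" "c (l, \<theta> l) = 0" if "l \<in> {lam0 - e<..<lam0 + e}" for l
      using \<theta>(4)[OF that] by (auto simp: U2_def)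
    show "\<exists>\<epsilon>>0. \<exists>\<theta>. \<theta> ` {lam0 - \<epsilon><..<lam0 + \<epsilon>} \<subseteq> {0..1} \<and>
        \<theta> C1_differentiable_on {lam0 - \<epsilon><..<lam0 + \<epsilon>} \<and> \<theta> lam0 = t0 \<and>
        (\<forall>l\<in>{lam0 - \<epsilon><..<lam0 + \<epsilon>}. complex_of_real l
            \<in> Spec (perturbed_op (\<A> (\<theta> l)) (\<B> (\<theta> l)) (F (\<theta> l)) (G (\<theta> l)))) \<and>
        complex_of_real (deriv \<theta> lam0) =
          - complex_of_real (a (lam0, t0) * (norm u)\<^sup>2) / complex_of_real (b (lam0, t0) * (norm u)\<^sup>2)"
    proof (intro exI[of _ e] exI[of _ \<theta>] conjI ballI)
      show "\<theta> ` {lam0 - e<..<lam0 + e} \<subseteq> {0..1}" using \<theta>'(1) U(3) JU by blast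
      show "complex_of_real (deriv \<theta> lam0) =
          - complex_of_real (a (lam0, t0) * (norm u)\<^sup>2) / complex_of_real (b (lam0, t0) * (norm u)\<^sup>2)"
        using \<theta>(5) nu by simp
    qed (use \<theta> \<theta>' Spec in auto)
  qed
qed

end
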